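(* The space $\mathcal{A}(\mathbb{C}_+)$ is isometrically isomorphic to $\mathcal{A}_u(B_{c_0})$.
   Context: $\mathbb{C}_+=\{s\in\mathbb{C}:\operatorname{Re} s>0\}$. $\mathcal{A}(\mathbb{C}_+)$ is the set of all Dirichlet series $D(s)=\sum_{n=1}^{\infty}\frac{a_n}{n^s}$ ($a_n\in\mathbb{C}$) which are convergent at every point of $\mathbb{C}_+$ and define a uniformly continuous function on $\mathbb{C}_+$; it is endowed with the supremum norm $\|D\|_\infty=\sup_{s\in\mathbb{C}_+}|D(s)|$ (such functions are bounded on $\mathbb{C}_+$). $c_0$ is the complex Banach space of complex sequences converging to zero, with the sup norm, and $B_{c_0}$ is its open unit ball. $\mathcal{A}_u(B_{c_0})$ is the Banach algebra of all functions $f:B_{c_0}\to\mathbb{C}$ which are uniformly continuous and complex Fréchet differentiable on $B_{c_0}$, with norm $\|f\|_{B_{c_0}}=\sup\{|f(x)|:x\in B_{c_0}\}$. *)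

theory Defs
  imports "HOL-Analysis.Analysis"
begin

section \<open>The complex Banach space of null sequences\<close>

typedef c0 = "{x :: nat \<Rightarrow> complex. x \<longlonglongrightarrow> 0}"
  morphisms c0_nth Abs_c0
  by (rule exI[of _ "\<lambda>_. 0"]) simp

setup_lifting type_definition_c0

lemma c0_nth_tendsto: "c0_nth x \<longlonglongrightarrow> 0"
  using c0_nth[of x] by simp

lemma c0_eqI: "(\<And>n. c0_nth x n = c0_nth y n) \<Longrightarrow> x = y"
  by (simp add: c0_nth_inject[symmetric] fun_eq_iff)

lemma bdd_above_c0: "bdd_above (range (\<lambda>n. cmod (c0_nth x n)))"
proof -
  have "Bseq (c0_nth x)"
    using c0_nth_tendsto convergentI convergent_imp_Bseq by blast
  then show ?thesis by (auto simp: Bseq_def bdd_above_def)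
qed

lift_definition scaleC_c0 :: "complex \<Rightarrow> c0 \<Rightarrow> c0" is "\<lambda>c x n. c * x n"
  by (rule tendsto_mult_right_zero)

instantiation c0 :: real_normed_vector
begin

lift_definition zero_c0 :: c0 is "\<lambda>_. 0" by simp
lift_definition plus_c0 :: "c0 \<Rightarrow> c0 \<Rightarrow> c0" is "\<lambda>x y n. x n + y n"
  by (rule tendsto_add_zero)
lift_definition uminus_c0 :: "c0 \<Rightarrow> c0" is "\<lambda>x n. - x n"
  using tendsto_minus by fastforce
lift_definition minus_c0 :: "c0 \<Rightarrow> c0 \<Rightarrow> c0" is "\<lambda>x y n. x n - y n"
  using tendsto_diff by fastforce
lift_definition scaleR_c0 :: "real \<Rightarrow> c0 \<Rightarrow> c0" is "\<lambda>r x n. r *\<^sub>R x n"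
  using tendsto_scaleR[OF tendsto_const] by fastforce

definition norm_c0 :: "c0 \<Rightarrow> real" where
  "norm_c0 x = (SUP n. cmod (c0_nth x n))"
definition dist_c0 :: "c0 \<Rightarrow> c0 \<Rightarrow> real" where
  "dist_c0 x y = norm (x - y)"
definition sgn_c0 :: "c0 \<Rightarrow> c0" where
  "sgn_c0 x = inverse (norm x) *\<^sub>R x"
definition uniformity_c0 :: "(c0 \<times> c0) filter" where
  "uniformity_c0 = (INF e\<in>{0<..}. principal {(x, y). dist x y < e})"
definition open_c0 :: "c0 set \<Rightarrow> bool" where
  "open_c0 U = (\<forall>x\<in>U. eventually (\<lambda>(x', y). x' = x \<longrightarrow> y \<in> U) uniformity)"

instance
proof
  fix x y z :: c0 and a b :: real and U :: "c0 set"
  show "x + y + z = x + (y + z)" by transfer (simp add: add.assoc)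
  show "x + y = y + x" by transfer (simp add: add.commute)
  show "0 + x = x" by transfer simp
  show "- x + x = 0" by transfer simp
  show "x - y = x + - y" by transfer simp
  show "a *\<^sub>R (x + y) = a *\<^sub>R x + a *\<^sub>R y"
    by transfer (simp add: scaleR_add_right)
  show "(a + b) *\<^sub>R x = a *\<^sub>R x + b *\<^sub>R x"
    by transfer (simp add: scaleR_add_left)
  show "a *\<^sub>R b *\<^sub>R x = (a * b) *\<^sub>R x" by transfer simp
  show "1 *\<^sub>R x = x" by transfer simp
  show "dist x y = norm (x - y)" by (rule dist_c0_def)
  show "sgn x = inverse (norm x) *\<^sub>R x" by (simp add: sgn_c0_def)
  show "uniformity = (INF e\<in>{0<..}. principal {(x, y :: c0). dist x y < e})"
    by (rule uniformity_c0_def)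
  show "open U = (\<forall>x\<in>U. eventually (\<lambda>(x', y). x' = x \<longrightarrow> y \<in> U) uniformity)"
    by (rule open_c0_def)
  have le: "cmod (c0_nth u n) \<le> norm u" for u n
    unfolding norm_c0_def by (rule cSUP_upper[OF UNIV_I bdd_above_c0])
  have least: "norm u \<le> B" if "\<And>n. cmod (c0_nth u n) \<le> B" for u B
    unfolding norm_c0_def by (rule cSUP_least) (use that in auto)
  show "(norm x = 0) = (x = 0)"
  proof
    assume "norm x = 0"
    then have "c0_nth x n = 0" for n using le[of x n] by simp
    then show "x = 0" by (intro c0_eqI) (simp add: zero_c0.rep_eq)
  qed (simp add: norm_c0_def zero_c0.rep_eq)
  show "norm (x + y) \<le> norm x + norm y"
    by (rule least)
      (use le[of x] le[of y] in \<open>auto simp: plus_c0.rep_eq intro: norm_triangle_le add_mono\<close>)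
  have sc: "norm (r *\<^sub>R u) \<le> \<bar>r\<bar> * norm u" for r and u :: c0
    by (rule least) (auto simp: scaleR_c0.rep_eq norm_mult intro: mult_left_mono le)
  show "norm (a *\<^sub>R x) = \<bar>a\<bar> * norm x"
  proof (cases "a = 0")
    case True
    then show ?thesis by (simp add: norm_c0_def scaleR_c0.rep_eq)
  next
    case False
    have "inverse a *\<^sub>R a *\<^sub>R x = x" by (rule c0_eqI) (use False in \<open>simp add: scaleR_c0.rep_eq\<close>)
    then have "norm x \<le> \<bar>inverse a\<bar> * norm (a *\<^sub>R x)" using sc[of "inverse a" "a *\<^sub>R x"] by simp
    then have "\<bar>a\<bar> * norm x \<le> norm (a *\<^sub>R x)" using False by (simp add: field_simps)
    then show ?thesis using sc[of a x] by simp
  qed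
qed

end

lemma norm_c0_nth_le: "cmod (c0_nth x n) \<le> norm x"
  unfolding norm_c0_def by (rule cSUP_upper[OF UNIV_I bdd_above_c0])

lemma norm_c0_least: "(\<And>n. cmod (c0_nth x n) \<le> B) \<Longrightarrow> norm x \<le> B"
  unfolding norm_c0_def by (rule cSUP_least) auto

instance c0 :: banach
proof
  fix X :: "nat \<Rightarrow> c0"
  assume X: "Cauchy X"
  have coord: "dist (c0_nth (X m) k) (c0_nth (X n) k) \<le> dist (X m) (X n)" for m n k
    using norm_c0_nth_le[of "X m - X n" k] by (simp add: dist_norm minus_c0.rep_eq)
  have "convergent (\<lambda>n. c0_nth (X n) k)" for k
    unfolding Cauchy_convergent_iff[symmetric]
    using X coord[of _ k] by (meson Cauchy_def order_le_less_trans)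
  then obtain L where L: "\<And>k. (\<lambda>n. c0_nth (X n) k) \<longlonglongrightarrow> L k"
    unfolding convergent_def by metis
  have unif: "\<exists>N. \<forall>n\<ge>N. \<forall>k. cmod (c0_nth (X n) k - L k) \<le> e" if "e > 0" for e
  proof -
    obtain N where N: "\<And>m n. m \<ge> N \<Longrightarrow> n \<ge> N \<Longrightarrow> dist (X m) (X n) < e"
      using X \<open>e > 0\<close> unfolding Cauchy_def by blast
    have "cmod (c0_nth (X n) k - L k) \<le> e" if "n \<ge> N" for n k
    proof (rule tendsto_upperbound)
      show "(\<lambda>m. cmod (c0_nth (X n) k - c0_nth (X m) k)) \<longlonglongrightarrow> cmod (c0_nth (X n) k - L k)"
        by (intro tendsto_intros L)
      have "cmod (c0_nth (X n) k - c0_nth (X m) k) \<le> e" if "m \<ge> N" for m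
        using coord[of n k m] N[OF \<open>n \<ge> N\<close> that] by (simp add: dist_norm)
      then show "\<forall>\<^sub>F m in sequentially. cmod (c0_nth (X n) k - c0_nth (X m) k) \<le> e"
        unfolding eventually_sequentially by blast
    qed simp
    then show ?thesis by blast
  qed
  have L0: "L \<longlonglongrightarrow> 0"
  proof (rule LIMSEQ_I)
    fix r :: real assume "r > 0"
    obtain N where N: "\<And>k. cmod (c0_nth (X N) k - L k) \<le> r/2"
      using unif[of "r/2"] \<open>r > 0\<close> by auto
    obtain K where K: "\<And>k. k \<ge> K \<Longrightarrow> cmod (c0_nth (X N) k) < r/2"
      using LIMSEQ_D[OF c0_nth_tendsto[of "X N"], of "r/2"] \<open>r > 0\<close> by auto
    have "cmod (L k - 0) < r" if "k \<ge> K" for k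
      using norm_triangle_sub[of "L k" "c0_nth (X N) k"] N[of k] K[OF that]
      by (simp add: norm_minus_commute)
    then show "\<exists>no. \<forall>n\<ge>no. norm (L n - 0) < r" by blast
  qed
  have nthL: "c0_nth (Abs_c0 L) = L" using L0 by (simp add: Abs_c0_inverse)
  have "X \<longlonglongrightarrow> Abs_c0 L"
  proof (rule LIMSEQ_I)
    fix r :: real assume "r > 0"
    obtain N where N: "\<forall>n\<ge>N. \<forall>k. cmod (c0_nth (X n) k - L k) \<le> r/2"
      using unif[of "r/2"] \<open>r > 0\<close> by auto
    have "norm (X n - Abs_c0 L) < r" if "n \<ge> N" for n
    proof -
      have "norm (X n - Abs_c0 L) \<le> r/2"
        by (rule norm_c0_least) (use N that in \<open>simp add: minus_c0.rep_eq nthL\<close>)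
      then show ?thesis using \<open>r > 0\<close> by simp
    qed
    then show "\<exists>no. \<forall>n\<ge>no. norm (X n - Abs_c0 L) < r" by blast
  qed
  then show "convergent X" unfolding convergent_def by blast
qed


section \<open>Function spaces with the supremum norm\<close>

text \<open>
  A space of complex functions on a set \<open>S\<close> is represented by a set of total functions that
  vanish outside \<open>S\<close>. So equality of its members is equality on \<open>S\<close>, and the vector space
  operations are the pointwise ones.
\<close>

definition sup_norm :: "'a set \<Rightarrow> ('a \<Rightarrow> complex) \<Rightarrow> real" where
  "sup_norm S f = (SUP x\<in>S. cmod (f x))"

definition isometrically_isomorphic ::
  "'a set \<Rightarrow> ('a \<Rightarrow> complex) set \<Rightarrow> 'b set \<Rightarrow> ('b \<Rightarrow> complex) set \<Rightarrow> bool" where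
  "isometrically_isomorphic S V T W \<longleftrightarrow>
    (\<exists>\<Phi>. bij_betw \<Phi> V W
      \<and> (\<forall>f\<in>V. \<forall>g\<in>V. \<Phi> (\<lambda>x. f x + g x) = (\<lambda>y. \<Phi> f y + \<Phi> g y))
      \<and> (\<forall>c. \<forall>f\<in>V. \<Phi> (\<lambda>x. c * f x) = (\<lambda>y. c * \<Phi> f y))
      \<and> (\<forall>f\<in>V. sup_norm T (\<Phi> f) = sup_norm S f))"

definition right_half_plane :: "complex set" where
  "right_half_plane = {s. Re s > 0}"

text \<open>The coefficient \<open>a\<^sub>n\<close>, for \<open>n \<ge> 1\<close>, is \<open>a (n - 1)\<close>.\<close>

definition dirichlet_algebra :: "(complex \<Rightarrow> complex) set" where
  "dirichlet_algebra = {D.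
     (\<exists>a :: nat \<Rightarrow> complex. \<forall>s\<in>right_half_plane.
        (\<lambda>n. a n / of_nat (Suc n) powr s) sums D s)
     \<and> uniformly_continuous_on right_half_plane D
     \<and> (\<forall>s. s \<notin> right_half_plane \<longrightarrow> D s = 0)}"

definition complex_frechet_differentiable :: "(c0 \<Rightarrow> complex) \<Rightarrow> c0 \<Rightarrow> bool" where
  "complex_frechet_differentiable f x \<longleftrightarrow>
    (\<exists>L. (f has_derivative L) (at x) \<and> (\<forall>c h. L (scaleC_c0 c h) = c * L h))"

definition ball_algebra :: "(c0 \<Rightarrow> complex) set" where
  "ball_algebra = {f.
     uniformly_continuous_on (ball 0 1) f
     \<and> (\<forall>x\<in>ball 0 1. complex_frechet_differentiable f x)
     \<and> (\<forall>x. x \<notin> ball 0 1 \<longrightarrow> f x = 0)}"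


section \<open>The supremum norms are finite and the spaces are linear\<close>

lemma uniformly_continuous_oscillation:
  fixes f :: "'a::real_normed_vector \<Rightarrow> complex"
  assumes "uniformly_continuous_on S f" and "convex S"
  obtains B where "\<And>x y. x \<in> S \<Longrightarrow> y \<in> S \<Longrightarrow> norm (y - x) \<le> R \<Longrightarrow> cmod (f y - f x) \<le> B"
proof -
  obtain d where d: "d > 0" "\<And>x y. x \<in> S \<Longrightarrow> y \<in> S \<Longrightarrow> dist y x < d \<Longrightarrow> dist (f y) (f x) < 1"
    using assms(1) unfolding uniformly_continuous_on_def by (meson zero_less_one)
  obtain N where N: "R / d < real N" using reals_Archimedean2 by blast
  define M where "M = Suc N"
  have M: "R < real M * d" "M > 0"
    using N d(1) by (auto simp: M_def field_simps)
  have "cmod (f y - f x) \<le> real M" if xy: "x \<in> S" "y \<in> S" "norm (y - x) \<le> R" for x y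
  proof -
    define p where "p k = x + (real k / real M) *\<^sub>R (y - x)" for k
    have pS: "p k \<in> S" if "k \<le> M" for k
    proof -
      have "p k = (1 - real k / real M) *\<^sub>R x + (real k / real M) *\<^sub>R y"
        by (simp add: p_def algebra_simps)
      then show ?thesis
        using convexD_alt[OF assms(2) xy(1,2), of "real k / real M"] that M(2) by simp
    qed
    have "cmod (f (p k) - f (p 0)) \<le> real k" if "k \<le> M" for k
      using that
    proof (induction k)
      case (Suc k)
      have "p (Suc k) - p k = (1 / real M) *\<^sub>R (y - x)"
        by (simp add: p_def add_divide_distrib scaleR_add_left)
      then have "dist (p (Suc k)) (p k) = norm (y - x) / real M"
        by (simp add: dist_norm)
      also have "\<dots> < d" using xy(3) M by (simp add: field_simps)
      finally have "cmod (f (p (Suc k)) - f (p k)) < 1"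
        using d(2)[OF pS pS] Suc.prems by (simp add: dist_norm)
      then show ?case
        using Suc norm_triangle_ineq[of "f (p (Suc k)) - f (p k)" "f (p k) - f (p 0)"] by simp
    qed simp
    from this[of M] show ?thesis using M(2) by (simp add: p_def)
  qed
  then show thesis by (rule that)
qed

lemma convex_right_half_plane: "convex right_half_plane"
  unfolding right_half_plane_def by (rule convex_halfspace_Re_gt)

lemma bdd_above_ball_algebra:
  assumes "f \<in> ball_algebra"
  shows "bdd_above ((\<lambda>x. cmod (f x)) ` ball 0 1)"
proof -
  have "uniformly_continuous_on (ball 0 1) f" using assms by (simp add: ball_algebra_def)
  from uniformly_continuous_oscillation[OF this convex_ball, of 1]
  obtain B where B: "\<And>x y. x \<in> ball 0 1 \<Longrightarrow> y \<in> ball 0 1 \<Longrightarrow> norm (y - x) \<le> 1 \<Longrightarrow> cmod (f y - f x) \<le> B"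
    by blast
  have "cmod (f y) \<le> cmod (f 0) + B" if "y \<in> ball 0 1" for y
    using B[of 0 y] that norm_triangle_sub[of "f y" "f 0"] by simp
  then show ?thesis by (auto intro!: bdd_aboveI)
qed

lemma bdd_above_dirichlet_algebra:
  assumes "D \<in> dirichlet_algebra"
  shows "bdd_above ((\<lambda>s. cmod (D s)) ` right_half_plane)"
proof -
  obtain a where a: "\<And>s. s \<in> right_half_plane \<Longrightarrow> (\<lambda>n. a n / of_nat (Suc n) powr s) sums D s"
    and uc: "uniformly_continuous_on right_half_plane D"
    using assms by (auto simp: dirichlet_algebra_def)
  have nrm: "cmod (a n / of_nat (Suc n) powr s) = cmod (a n) / real (Suc n) powr Re s" for n s
    by (simp add: norm_divide norm_powr_real_powr del: of_nat_Suc)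
  have "(\<lambda>n. a n / of_nat (Suc n) powr (1/2)) \<longlonglongrightarrow> 0"
    using a[of "1/2"] by (intro summable_LIMSEQ_zero) (auto simp: right_half_plane_def sums_iff)
  then have "Bseq (\<lambda>n. a n / of_nat (Suc n) powr (1/2))"
    by (rule convergent_imp_Bseq[OF convergentI])
  then obtain C where C: "\<forall>n. cmod (a n / of_nat (Suc n) powr (1/2)) \<le> C"
    by (rule BseqE)
  have "summable (\<lambda>n. real n powr (-3/2))" by (simp add: summable_real_powr_iff)
  then have "summable (\<lambda>n. real (Suc n) powr (-3/2))" by (subst summable_Suc_iff)
  then have sm: "summable (\<lambda>n. C * real (Suc n) powr (-3/2))" by (rule summable_mult)
  have far: "cmod (D w) \<le> (\<Sum>n. C * real (Suc n) powr (-3/2))" if "Re w \<ge> 2" for w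
  proof -
    have le: "cmod (a n / of_nat (Suc n) powr w) \<le> C * real (Suc n) powr (-3/2)" for n
    proof -
      have "cmod (a n / of_nat (Suc n) powr w) = cmod (a n) / real (Suc n) powr Re w"
        by (rule nrm)
      also have "\<dots> \<le> cmod (a n) / real (Suc n) powr 2"
        using that by (intro divide_left_mono powr_mono) auto
      also have "\<dots> = cmod (a n / of_nat (Suc n) powr (1/2)) * real (Suc n) powr (-3/2)"
        unfolding nrm by (simp add: powr_minus field_simps flip: powr_add)
      also have "\<dots> \<le> C * real (Suc n) powr (-3/2)"
        by (intro mult_right_mono C[rule_format]) simp
      finally show ?thesis .
    qed
    have "D w = (\<Sum>n. a n / of_nat (Suc n) powr w)"
      using a[of w] that by (simp add: right_half_plane_def sums_iff)
    then show ?thesis using norm_suminf_le[OF le sm] by simp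
  qed
  from uniformly_continuous_oscillation[OF uc convex_right_half_plane, of 2]
  obtain B where B: "\<And>x y. x \<in> right_half_plane \<Longrightarrow> y \<in> right_half_plane \<Longrightarrow> norm (y - x) \<le> 2
      \<Longrightarrow> cmod (D y - D x) \<le> B"
    by blast
  have "cmod (D s) \<le> (\<Sum>n. C * real (Suc n) powr (-3/2)) + B" if "s \<in> right_half_plane" for s
    using B[of "s + 2" s] that far[of "s + 2"] norm_triangle_sub[of "D s" "D (s + 2)"]
    by (simp add: right_half_plane_def)
  then show ?thesis by (auto intro!: bdd_aboveI)
qed

lemma dirichlet_algebra_add:
  assumes "D \<in> dirichlet_algebra" "E \<in> dirichlet_algebra"
  shows "(\<lambda>s. D s + E s) \<in> dirichlet_algebra"
proof -
  obtain a b where ab: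
    "\<And>s. s \<in> right_half_plane \<Longrightarrow> (\<lambda>n. a n / of_nat (Suc n) powr s) sums D s"
    "\<And>s. s \<in> right_half_plane \<Longrightarrow> (\<lambda>n. b n / of_nat (Suc n) powr s) sums E s"
    using assms by (auto simp: dirichlet_algebra_def)
  have "(\<lambda>n. (a n + b n) / of_nat (Suc n) powr s) sums (D s + E s)"
    if "s \<in> right_half_plane" for s
    unfolding add_divide_distrib using ab that by (intro sums_add)
  then show ?thesis using assms
    by (auto simp: dirichlet_algebra_def intro!: uniformly_continuous_on_add
        exI[of _ "\<lambda>n. a n + b n"])
qed

lemma dirichlet_algebra_mult_const:
  assumes "D \<in> dirichlet_algebra"
  shows "(\<lambda>s. c * D s) \<in> dirichlet_algebra"
proof -
  obtain a where a:
    "\<And>s. s \<in> right_half_plane \<Longrightarrow> (\<lambda>n. a n / of_nat (Suc n) powr s) sums D s"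
    using assms by (auto simp: dirichlet_algebra_def)
  have "(\<lambda>n. (c * a n) / of_nat (Suc n) powr s) sums (c * D s)"
    if "s \<in> right_half_plane" for s
    unfolding times_divide_eq_right[symmetric] using a[OF that] by (rule sums_mult)
  then show ?thesis using assms
    by (auto simp: dirichlet_algebra_def intro!: exI[of _ "\<lambda>n. c * a n"]
        bounded_linear.uniformly_continuous_on[OF bounded_linear_mult_right])
qed

lemma ball_algebra_add:
  assumes "f \<in> ball_algebra" "g \<in> ball_algebra"
  shows "(\<lambda>x. f x + g x) \<in> ball_algebra"
proof -
  have "complex_frechet_differentiable (\<lambda>x. f x + g x) x" if "x \<in> ball 0 1" for x
  proof -
    have "complex_frechet_differentiable f x" "complex_frechet_differentiable g x"
      using assms that unfolding ball_algebra_def by blast+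
    then obtain L M where "(f has_derivative L) (at x)" "\<forall>c h. L (scaleC_c0 c h) = c * L h"
      "(g has_derivative M) (at x)" "\<forall>c h. M (scaleC_c0 c h) = c * M h"
      unfolding complex_frechet_differentiable_def by blast
    then show ?thesis unfolding complex_frechet_differentiable_def
      by (intro exI[of _ "\<lambda>h. L h + M h"]) (auto intro: has_derivative_add simp: distrib_left)
  qed
  then show ?thesis using assms
    by (auto simp: ball_algebra_def intro!: uniformly_continuous_on_add)
qed

lemma ball_algebra_mult_const:
  assumes "f \<in> ball_algebra"
  shows "(\<lambda>x. c * f x) \<in> ball_algebra"
proof -
  have "complex_frechet_differentiable (\<lambda>x. c * f x) x" if "x \<in> ball 0 1" for x
  proof -
    have "complex_frechet_differentiable f x"
      using assms that unfolding ball_algebra_def by blast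
    then obtain L where "(f has_derivative L) (at x)" "\<forall>c h. L (scaleC_c0 c h) = c * L h"
      unfolding complex_frechet_differentiable_def by blast
    then show ?thesis unfolding complex_frechet_differentiable_def
      by (intro exI[of _ "\<lambda>h. c * L h"]) (auto intro: has_derivative_mult_right)
  qed
  then show ?thesis using assms
    by (auto simp: ball_algebra_def
        intro!: bounded_linear.uniformly_continuous_on[OF bounded_linear_mult_right])
qed

end

theory Submission
  imports Defs "HOL-Complex_Analysis.Complex_Analysis"
begin

text \<open>
  The isomorphism is Bohr's change of variables. Let \<open>p\<^sub>k\<close> be the \<open>k\<close>-th prime. The transform sends a
  function \<open>f\<close> on the ball to \<open>s \<mapsto> f (p\<^sub>0 powr -s, p\<^sub>1 powr -s, \<dots>)\<close>. By unique factorization it turns the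
  monomial with exponents \<open>\<alpha>\<close> into \<open>n powr -s\<close> with \<open>n = \<Prod> p\<^sub>k ^ \<alpha>\<^sub>k\<close>, so it maps the polynomials in finitely
  many coordinates bijectively to the Dirichlet polynomials. Three facts extend this to the two algebras.

  First, the correspondence of polynomials is isometric (\<open>bohr_poly_le_of_half_plane\<close>). One inequality is
  clear. For the other, Parseval's inequality bounds the coefficients of every power \<open>P^j\<close> in terms of the
  \<open>j\<close>-th power of the supremum \<open>M\<close> on the half-plane; at a fixed point of the ball the Cauchy-Schwarz
  inequality then gives \<open>\<bar>P x\<bar>^j \<le> C * M^j\<close> with \<open>C\<close> independent of \<open>j\<close>, and \<open>C\<close> disappears as
  \<open>j \<rightarrow> \<infinity>\<close>. This replaces the usual combination of Kronecker's theorem and the maximum principle.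

  Second, polynomials are dense on both sides. A Dirichlet series that is uniformly continuous on the
  half-plane is the uniform limit of its averages against a band-limited kernel on vertical lines, and these
  averages are Dirichlet polynomials (\<open>dirichlet_algebra_approx\<close>). On the ball, the essential point is that
  \<open>f x\<close> is uniformly close to the value of \<open>f\<close> at the first \<open>k\<close> coordinates of \<open>x\<close>
  (\<open>uniform_head_approx\<close>), although the truncations do not converge to \<open>x\<close> uniformly. By Parseval, a bounded
  holomorphic function cannot react by a fixed amount to many disjoint perturbations of one point
  (\<open>disjoint_block_square_sum\<close>); a gliding hump argument and the compactness of the closed unit ball of
  \<open>\<ell>\<^sub>\<infinity>\<close> for coordinatewise convergence make this uniform on a small ball, and power series
  in one complex variable carry it to the unit ball. Functions of finitely many coordinates are
  approximated by interpolation at roots of unity (\<open>polydisc_approx\<close>).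

  Third, uniform limits of polynomials belong to the algebras. On the ball this follows from Cauchy's estimate for
  the Frechet derivatives (\<open>ball_algebra_uniform_limit\<close>). On the half-plane the limit must still be shown to
  be a convergent Dirichlet series (\<open>dirichlet_series_uniform_limit\<close>): a kernel with trapezoidal Fourier
  transform shows that taking the \<open>N\<close>-th partial sum costs at most a factor \<open>C * N powr e\<close> on a vertical line,
  and summation by parts removes this factor on a line slightly further to the right.
\<close>

section \<open>Integral kernels with prescribed Fourier transform\<close>

text \<open>
  The common majorant of all kernels below: integrable for \<open>e > 0\<close>, bounded near \<open>0\<close>.
\<close>

definition decay :: "real \<Rightarrow> real \<Rightarrow> real" where
  "decay e t = min 1 (\<bar>t\<bar> powr (- 1 - e))"

lemma decay_nonneg: "0 \<le> decay e t"
  by (simp add: decay_def)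

lemma borel_measurable_decay [measurable]: "decay e \<in> borel_measurable borel"
  unfolding decay_def by measurable

lemma integrable_decay:
  assumes "e > 0"
  shows "integrable lborel (decay e)"
proof -
  define g :: "real \<Rightarrow> real" where "g t = indicator {1..} t * t powr (- 1 - e)" for t
  have meas: "g \<in> borel_measurable borel" unfolding g_def by measurable
  have "((\<lambda>x. x powr (- 1 - e)) has_integral - (1 powr (- 1 - e + 1)) / (- 1 - e + 1)) {1::real..}"
    using assms by (intro has_integral_powr_to_inf) auto
  then have "(\<lambda>x. x powr (- 1 - e)) absolutely_integrable_on {1::real..}"
    by (intro nonnegative_absolutely_integrable_1) auto
  then have "integrable lebesgue g"
    by (simp add: set_integrable_def g_def[abs_def])
  then have g: "integrable lborel g"
    using meas integrable_completion[of g lborel] by simp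
  have g': "integrable lborel (\<lambda>t. g (- t))"
    using lborel_integrable_real_affine[OF g, of "-1" 0] by simp
  have i: "integrable lborel (indicator {-1..1::real} :: real \<Rightarrow> real)"
    by (rule integrable_real_indicator) auto
  have s: "integrable lborel (\<lambda>t. indicator {-1..1::real} t + g t + g (- t))"
    by (intro Bochner_Integration.integrable_add i g g')
  show ?thesis
  proof (rule Bochner_Integration.integrable_bound[OF s])
    show "AE x in lborel. norm (decay e x) \<le> norm (indicator {-1..1} x + g x + g (- x))"
    proof (intro AE_I2)
      fix x :: real
      show "norm (decay e x) \<le> norm (indicator {-1..1} x + g x + g (- x))"
        by (cases "x \<ge> 1"; cases "x \<le> -1") (auto simp: g_def decay_def indicator_def)
    qed
  qed measurable
qed

lemma integrable_of_decay:
  fixes f :: "real \<Rightarrow> 'a::{banach, second_countable_topology}"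
  assumes "f \<in> borel_measurable borel" "e > 0" "\<And>t. norm (f t) \<le> C * decay e t"
  shows "integrable lborel f"
  by (rule Bochner_Integration.integrable_bound[OF integrable_mult_right[OF integrable_decay[OF assms(2)], of C]])
     (use assms in \<open>auto intro: order_trans[OF assms(3) abs_ge_self]\<close>)

lemma le_decay_1I:
  assumes "x \<le> C" "x * t\<^sup>2 \<le> C" "t = 0 \<Longrightarrow> x \<le> 0"
  shows "x \<le> C * decay 1 t"
proof (cases "t = 0")
  case False
  have "\<bar>t\<bar> powr - 2 = 1 / t\<^sup>2"
    using False by (simp add: powr_minus field_simps)
  then have "C * decay 1 t = C * min 1 (1 / t\<^sup>2)"
    by (simp add: decay_def)
  moreover have "x \<le> C / t\<^sup>2" using assms(2) False by (simp add: field_simps)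
  ultimately show ?thesis using assms(1) by (cases "1 \<le> 1 / t\<^sup>2") (simp_all only: min_def if_True if_False mult_1_right times_divide_eq_right)
qed (use assms in \<open>simp add: decay_def\<close>)

lemma one_minus_cos_le: "1 - cos x \<le> x\<^sup>2 / 2" for x :: real
proof -
  have "1 - cos x = 2 * (sin (x/2))\<^sup>2"
    using cos_double_sin[of "x/2"] by simp
  moreover have "(sin (x/2))\<^sup>2 \<le> (x/2)\<^sup>2"
    using abs_sin_x_le_abs_x[of "x/2"] by (simp only: abs_le_square_iff)
  ultimately show ?thesis by (simp add: power_divide)
qed

lemma cos_second_order_bounds:
  fixes x :: real
  shows "cos x - 1 + x\<^sup>2 / 2 \<le> x^4 / 24" "0 \<le> cos x - 1 + x\<^sup>2 / 2"
proof -
  obtain t where t: "cos x = (\<Sum>m<4. cos_coeff m * x ^ m) + cos (t + 1/2 * real (4::nat) * pi) / fact 4 * x^4"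
    using Maclaurin_cos_expansion[of x 4] by blast
  have "(\<Sum>m<4. cos_coeff m * x ^ m) = 1 - x\<^sup>2 / 2"
    by (simp add: eval_nat_numeral cos_coeff_Suc sin_coeff_Suc)
  then have "cos x - 1 + x\<^sup>2 / 2 = cos (t + 2 * pi) / 24 * x^4"
    using t by (simp add: fact_numeral)
  moreover have "cos (t + 2 * pi) / 24 * x^4 \<le> 1 / 24 * x^4"
    by (intro mult_right_mono divide_right_mono) auto
  ultimately show "cos x - 1 + x\<^sup>2 / 2 \<le> x^4 / 24" by simp
  show "0 \<le> cos x - 1 + x\<^sup>2 / 2" using one_minus_cos_le[of x] by simp
qed

lemma integral_pos_of_pos_on_1_2:
  fixes f :: "real \<Rightarrow> real"
  assumes "integrable lborel f" "\<And>t. 0 \<le> f t" "c > 0" "\<And>t. 1 \<le> t \<Longrightarrow> t \<le> 2 \<Longrightarrow> c \<le> f t"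
  shows "0 < integral\<^sup>L lborel f"
proof -
  have "c = integral\<^sup>L lborel (\<lambda>t. c * indicator {1..2::real} t)" by simp
  also have "\<dots> \<le> integral\<^sup>L lborel f"
    by (intro integral_mono integrable_mult_right integrable_real_indicator assms(1))
       (use assms in \<open>auto simp: indicator_def\<close>)
  finally show ?thesis using assms by simp
qed

lemma one_minus_cos_ge:
  assumes "1 \<le> t" "t \<le> (2::real)" shows "1 - cos 1 \<le> 1 - cos t"
  using assms pi_gt3 by (auto intro!: cos_monotone_0_pi_le)

lemma cos_1_less_1: "cos (1::real) < 1"
  using cos_monotone_0_pi[of 0 "1::real"] pi_gt3 by simp

text \<open>
  The sine part of the Fourier integral of an even kernel is odd and integrates to \<open>0\<close>.
\<close>

lemma integral_even_cis:
  fixes k :: "real \<Rightarrow> real"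
  assumes k: "integrable lborel k" and even: "\<And>t. k (- t) = k t"
  shows "(LINT t|lborel. k t *\<^sub>R cis (l * t)) = of_real (LINT t|lborel. k t * cos (l * t))"
proof -
  have [measurable]: "k \<in> borel_measurable borel" using borel_measurable_integrable[OF k] by simp
  have c: "integrable lborel (\<lambda>t. k t * cos (l * t))"
    by (rule Bochner_Integration.integrable_bound[OF k]) (auto simp: abs_mult mult_left_le)
  have s: "integrable lborel (\<lambda>t. k t * sin (l * t))"
    by (rule Bochner_Integration.integrable_bound[OF k]) (auto simp: abs_mult mult_left_le)
  have "(LINT t|lborel. k t * sin (l * t)) = (LINT t|lborel. k (-t) * sin (l * (-t)))"
    using lborel_integral_real_affine[of "-1" "\<lambda>t. k t * sin (l * t)" 0] by simp
  then have s0: "(LINT t|lborel. k t * sin (l * t)) = 0" by (simp add: even)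
  have "(LINT t|lborel. k t *\<^sub>R cis (l * t))
      = (LINT t|lborel. of_real (k t * cos (l * t)) + \<i> * of_real (k t * sin (l * t)))"
    by (intro Bochner_Integration.integral_cong) (auto simp: complex_eq_iff)
  also have "\<dots> = of_real (LINT t|lborel. k t * cos (l * t)) + \<i> * of_real (LINT t|lborel. k t * sin (l * t))"
    using c s by (subst Bochner_Integration.integral_add) (auto simp del: of_real_mult)
  finally show ?thesis by (simp add: s0)
qed

lemma fejer_bound: "norm ((1 - cos (a * t)) / t\<^sup>2) \<le> (a\<^sup>2 / 2 + 2) * decay 1 t" for a t :: real
proof (rule le_decay_1I)
  have "1 - cos (a * t) \<le> a\<^sup>2 / 2 * t\<^sup>2" using one_minus_cos_le[of "a * t"] by (simp add: power_mult_distrib)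
  then have "(1 - cos (a * t)) / t\<^sup>2 \<le> a\<^sup>2 / 2" by (cases "t = 0") (simp_all add: divide_le_eq)
  moreover have "norm ((1 - cos (a * t)) / t\<^sup>2) = (1 - cos (a * t)) / t\<^sup>2" by simp
  ultimately show "norm ((1 - cos (a * t)) / t\<^sup>2) \<le> a\<^sup>2 / 2 + 2" by linarith
  have "1 - cos (a * t) \<le> 2" using cos_ge_minus_one[of "a * t"] by simp
  then show "norm ((1 - cos (a * t)) / t\<^sup>2) * t\<^sup>2 \<le> a\<^sup>2 / 2 + 2"
    by (cases "t = 0") (simp_all add: add_increasing)
qed simp

lemma integrable_fejer: "integrable lborel (\<lambda>t::real. (1 - cos (a * t)) / t\<^sup>2)"
  by (rule integrable_of_decay[OF _ zero_less_one fejer_bound]) measurable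

text \<open>
  The value is \<open>pi\<close>, but only its positivity matters: the kernels are normalized by it.
\<close>

definition fejer_mass :: real where
  "fejer_mass = (LINT t|lborel. (1 - cos t) / t\<^sup>2)"

lemma fejer_mass_pos: "fejer_mass > 0"
  unfolding fejer_mass_def
proof (rule integral_pos_of_pos_on_1_2[where c = "(1 - cos 1) / 4"])
  show "integrable lborel (\<lambda>t::real. (1 - cos t) / t\<^sup>2)" using integrable_fejer[of 1] by simp
  show "(1 - cos 1) / 4 \<le> (1 - cos t) / t\<^sup>2" if t: "1 \<le> t" "t \<le> 2" for t :: real
    using one_minus_cos_ge[OF t] t cos_1_less_1 power_mono[of t 2 2]
    by (intro frac_le) auto
qed (use cos_1_less_1 in auto)

text \<open>
  Substituting \<open>a * t\<close> for \<open>t\<close>. The point of the formula is that the right-hand side is piecewise linear in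
  \<open>a\<close>, so that combinations of such integrals give piecewise linear Fourier transforms.
\<close>

lemma integral_fejer: "(LINT t|lborel. (1 - cos (a * t)) / t\<^sup>2) = fejer_mass * \<bar>a\<bar>"
proof (cases "a = 0")
  case False
  have "fejer_mass = \<bar>a\<bar> * (LINT t|lborel. (1 - cos (a * t)) / (a * t)\<^sup>2)"
    unfolding fejer_mass_def using lborel_integral_real_affine[OF False, of "\<lambda>t. (1 - cos t) / t\<^sup>2" 0] by simp
  also have "(LINT t|lborel. (1 - cos (a * t)) / (a * t)\<^sup>2) = (LINT t|lborel. inverse (a\<^sup>2) * ((1 - cos (a * t)) / t\<^sup>2))"
    by (intro Bochner_Integration.integral_cong) (auto simp: field_simps)
  also have "\<dots> = inverse (a\<^sup>2) * (LINT t|lborel. (1 - cos (a * t)) / t\<^sup>2)"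
    by (rule integral_mult_right_zero)
  finally show ?thesis using False by (cases "a > 0") (simp_all add: field_simps power2_eq_square)
qed simp

text \<open>
  The analogue of the Fejer integrand one order higher: two Taylor terms of the cosine are
  removed so that the singularity of \<open>1 / t^4\<close> at \<open>0\<close> disappears.
\<close>

definition quartic :: "real \<Rightarrow> real \<Rightarrow> real" where
  "quartic a t = (cos (a * t) - 1 + (a * t)\<^sup>2 / 2) / t^4"

lemma quartic_bound: "norm (quartic a t) \<le> (a^4 / 24 + a\<^sup>2 / 2) * decay 1 t"
proof (rule le_decay_1I)
  have p: "(a * t)^4 = a^4 * t^4" "(a * t)\<^sup>2 = a\<^sup>2 * t\<^sup>2" by (simp_all add: power_mult_distrib)
  have nn: "norm (quartic a t) = quartic a t"
    using cos_second_order_bounds(2)[of "a * t"] by (simp add: quartic_def)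
  have "quartic a t \<le> a^4 / 24"
    using cos_second_order_bounds(1)[of "a * t"] unfolding quartic_def
    by (cases "t = 0") (simp_all add: divide_le_eq p)
  then show "norm (quartic a t) \<le> a^4 / 24 + a\<^sup>2 / 2" unfolding nn by (simp add: add_increasing2)
  have "cos (a * t) - 1 + (a * t)\<^sup>2 / 2 \<le> (a * t)\<^sup>2 / 2" by simp
  then have "quartic a t * t\<^sup>2 \<le> a\<^sup>2 / 2"
    using mult_right_mono[of _ "(a * t)\<^sup>2 / 2" "t\<^sup>2"]
    unfolding quartic_def by (cases "t = 0") (simp_all add: p divide_le_eq mult.assoc flip: power_add)
  then show "norm (quartic a t) * t\<^sup>2 \<le> a^4 / 24 + a\<^sup>2 / 2" unfolding nn by (simp add: add_increasing)
qed (simp add: quartic_def)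

lemma integrable_quartic: "integrable lborel (quartic a)"
  by (rule integrable_of_decay[OF _ zero_less_one quartic_bound]) (unfold quartic_def, measurable)

text \<open>
  Again by substitution; now the dependence on \<open>a\<close> is piecewise cubic.
\<close>

lemma integral_quartic: "integral\<^sup>L lborel (quartic a) = integral\<^sup>L lborel (quartic 1) * \<bar>a\<bar>^3"
proof (cases "a = 0")
  case False
  have "integral\<^sup>L lborel (quartic 1) = \<bar>a\<bar> * (LINT t|lborel. quartic 1 (a * t))"
    using lborel_integral_real_affine[OF False, of "quartic 1" 0] by simp
  also have "(LINT t|lborel. quartic 1 (a * t)) = (LINT t|lborel. inverse (a^4) * quartic a t)"
    by (intro Bochner_Integration.integral_cong) (auto simp: quartic_def field_simps)
  also have "\<dots> = inverse (a^4) * integral\<^sup>L lborel (quartic a)" by simp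
  finally have "integral\<^sup>L lborel (quartic 1) * \<bar>a\<bar>^3 = \<bar>a\<bar>^4 * inverse (a^4) * integral\<^sup>L lborel (quartic a)"
    by (simp add: eval_nat_numeral)
  then show ?thesis using False by simp
next
  case True
  then have "quartic a = (\<lambda>_. 0)" by (simp add: quartic_def fun_eq_iff)
  then show ?thesis using True by simp
qed



text \<open>
  The kernel is a multiple of \<open>(1 - cos t)\<^sup>2 / t^4\<close>. Multiplying it by \<open>cos (l * t)\<close> and expanding gives a
  fourth difference of \<open>quartic\<close> in the frequency, so its Fourier transform is a fourth difference of
  \<open>\<bar>l\<bar>^3\<close>, which vanishes where the stencil \<open>l - 2, \<dots>, l + 2\<close> does not straddle \<open>0\<close> and \<open>\<bar>l\<bar>^3\<close> is a
  cubic polynomial. The decay of order 4 leaves room for the factor \<open>1 + \<bar>t\<bar>\<close>, which is the growth of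
  partial sums of Dirichlet series along vertical lines.
\<close>

lemma band_limited_kernel:
  obtains H :: "real \<Rightarrow> real" where
    "\<And>t. 0 \<le> H t" "integrable lborel (\<lambda>t. (1 + \<bar>t\<bar>) * H t)" "integrable lborel H"
    "integral\<^sup>L lborel H = 1"
    "\<And>l. 2 \<le> \<bar>l\<bar> \<Longrightarrow> (LINT t|lborel. H t *\<^sub>R cis (l * t)) = 0"
proof -
  define G :: "real \<Rightarrow> real" where "G t = (1 - cos t)\<^sup>2 / t^4" for t
  have [measurable]: "G \<in> borel_measurable borel" unfolding G_def by measurable
  have G0: "0 \<le> G t" for t by (simp add: G_def)
  have G1: "G t \<le> 1/4" for t
  proof -
    have "(1 - cos t)\<^sup>2 \<le> (t\<^sup>2 / 2)\<^sup>2" by (intro power_mono one_minus_cos_le) auto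
    then show ?thesis by (cases "t = 0") (simp_all add: G_def divide_le_eq power_divide)
  qed
  have G2: "G t * t^4 \<le> 4" for t
  proof -
    have "(1 - cos t)\<^sup>2 \<le> 2\<^sup>2" using cos_ge_minus_one[of t] by (intro power_mono) auto
    then show ?thesis by (cases "t = 0") (simp_all add: G_def)
  qed
  have pol: "1 + u + u\<^sup>2 + u^3 \<le> 4 * (1 + u^4)" if "u \<ge> 0" for u :: real
  proof (cases "u \<le> 1")
    case True
    then have "u\<^sup>2 \<le> 1" "u^3 \<le> 1" using that by (auto intro: power_le_one)
    then have "1 + u + u\<^sup>2 + u^3 \<le> 4" using True by simp
    also have "\<dots> \<le> 4 * (1 + u^4)" using that by simp
    finally show ?thesis .
  next
    case False
    then have "u^1 \<le> u^4" "u\<^sup>2 \<le> u^4" "u^3 \<le> u^4" by (intro power_increasing; simp)+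
    then have "1 + u + u\<^sup>2 + u^3 \<le> 1 + 3 * u^4" by simp
    also have "\<dots> \<le> 4 * (1 + u^4)" using that by (simp add: add_increasing)
    finally show ?thesis .
  qed
  have G3: "(1 + \<bar>t\<bar>) * G t * (1 + t\<^sup>2) \<le> 17" for t
  proof -
    have "(1 + \<bar>t\<bar>) * (1 + t\<^sup>2) = 1 + \<bar>t\<bar> + \<bar>t\<bar>\<^sup>2 + \<bar>t\<bar>^3"
      by (simp add: algebra_simps power2_eq_square power3_eq_cube)
    also have "\<dots> \<le> 4 * (1 + t^4)" using pol[of "\<bar>t\<bar>"] by simp
    finally have "(1 + \<bar>t\<bar>) * (1 + t\<^sup>2) * G t \<le> 4 * (1 + t^4) * G t"
      using G0 by (rule mult_right_mono)
    also have "\<dots> \<le> 17" using G1[of t] G2[of t] by (simp add: algebra_simps)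
    finally show ?thesis by (simp add: mult_ac)
  qed
  have nn: "0 \<le> (1 + \<bar>t\<bar>) * G t" for t using G0 by simp
  have dec: "norm ((1 + \<bar>t\<bar>) * G t) \<le> 17 * decay 1 t" for t
  proof (rule le_decay_1I)
    have "(1 + \<bar>t\<bar>) * G t + (1 + \<bar>t\<bar>) * G t * t\<^sup>2 \<le> 17" using G3[of t] by (simp add: distrib_left)
    moreover have "0 \<le> (1 + \<bar>t\<bar>) * G t * t\<^sup>2" using nn[of t] by simp
    moreover have "norm ((1 + \<bar>t\<bar>) * G t) = (1 + \<bar>t\<bar>) * G t" using nn[of t] by simp
    ultimately show "norm ((1 + \<bar>t\<bar>) * G t) \<le> 17" "norm ((1 + \<bar>t\<bar>) * G t) * t\<^sup>2 \<le> 17"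
      using nn[of t] by (simp_all only:)
  qed (simp add: G_def)
  have i1: "integrable lborel (\<lambda>t. (1 + \<bar>t\<bar>) * G t)"
    by (rule integrable_of_decay[OF _ zero_less_one dec]) measurable
  have i0: "integrable lborel G"
  proof (rule Bochner_Integration.integrable_bound[OF i1])
    have "norm (G t) \<le> norm ((1 + \<bar>t\<bar>) * G t)" for t
      using mult_right_mono[of 1 "1 + \<bar>t\<bar>" "G t"] G0[of t] by simp
    then show "AE t in lborel. norm (G t) \<le> norm ((1 + \<bar>t\<bar>) * G t)" by blast
  qed measurable
  have pos: "integral\<^sup>L lborel G > 0"
  proof (rule integral_pos_of_pos_on_1_2[OF i0 G0])
    show "(1 - cos 1)\<^sup>2 / 16 > (0::real)" using cos_1_less_1 by simp
    show "(1 - cos 1)\<^sup>2 / 16 \<le> G t" if t: "1 \<le> t" "t \<le> 2" for t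
      unfolding G_def using one_minus_cos_ge[OF t] t cos_1_less_1 power_mono[of t 2 4]
      by (intro frac_le power_mono) auto
  qed
  have ft: "(LINT t|lborel. G t *\<^sub>R cis (l * t)) = 0" if l: "2 \<le> \<bar>l\<bar>" for l
  proof -
    have eq: "G t * cos (l * t) = 1/4 * quartic (l + 2) t - quartic (l + 1) t + 3/2 * quartic l t
        - quartic (l - 1) t + 1/4 * quartic (l - 2) t" for t
    proof -
      have "(1 - cos t)\<^sup>2 * cos (l * t) = 1/4 * cos ((l + 2) * t) - cos ((l + 1) * t) + 3/2 * cos (l * t)
        - cos ((l - 1) * t) + 1/4 * cos ((l - 2) * t)"
        by (simp add: distrib_right left_diff_distrib cos_add cos_diff cos_double_cos power2_eq_square)
           (simp add: field_simps)
      moreover have "1/4 * ((l + 2) * t)\<^sup>2 - ((l + 1) * t)\<^sup>2 + 3/2 * (l * t)\<^sup>2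
        - ((l - 1) * t)\<^sup>2 + 1/4 * ((l - 2) * t)\<^sup>2 = 0"
        by (simp add: power2_eq_square algebra_simps)
      ultimately have "(1 - cos t)\<^sup>2 * cos (l * t) = 1/4 * (cos ((l + 2) * t) - 1 + ((l + 2) * t)\<^sup>2 / 2)
        - (cos ((l + 1) * t) - 1 + ((l + 1) * t)\<^sup>2 / 2) + 3/2 * (cos (l * t) - 1 + (l * t)\<^sup>2 / 2)
        - (cos ((l - 1) * t) - 1 + ((l - 1) * t)\<^sup>2 / 2) + 1/4 * (cos ((l - 2) * t) - 1 + ((l - 2) * t)\<^sup>2 / 2)"
        by argo
      then show ?thesis
        unfolding G_def quartic_def by (simp add: add_divide_distrib diff_divide_distrib)
    qed
    have "(LINT t|lborel. G t * cos (l * t)) = integral\<^sup>L lborel (quartic 1) *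
       (1/4 * \<bar>l + 2\<bar>^3 - \<bar>l + 1\<bar>^3 + 3/2 * \<bar>l\<bar>^3 - \<bar>l - 1\<bar>^3 + 1/4 * \<bar>l - 2\<bar>^3)"
      (is "?I = ?R")
    proof -
      have "?I = 1/4 * integral\<^sup>L lborel (quartic (l + 2)) - integral\<^sup>L lborel (quartic (l + 1))
        + 3/2 * integral\<^sup>L lborel (quartic l) - integral\<^sup>L lborel (quartic (l - 1)) + 1/4 * integral\<^sup>L lborel (quartic (l - 2))"
        unfolding eq by (simp add: integrable_quartic)
      also have "\<dots> = ?R"
        unfolding integral_quartic[of "l + 2"] integral_quartic[of "l + 1"]
          integral_quartic[of l] integral_quartic[of "l - 1"] integral_quartic[of "l - 2"]
        by (simp add: distrib_left right_diff_distrib)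
      finally show ?thesis .
    qed
    also have "1/4 * \<bar>l + 2\<bar>^3 - \<bar>l + 1\<bar>^3 + 3/2 * \<bar>l\<bar>^3 - \<bar>l - 1\<bar>^3 + 1/4 * \<bar>l - 2\<bar>^3 = 0"
    proof (cases "l \<ge> 0")
      case True
      then have "\<bar>l + 2\<bar> = l + 2" "\<bar>l + 1\<bar> = l + 1" "\<bar>l\<bar> = l" "\<bar>l - 1\<bar> = l - 1" "\<bar>l - 2\<bar> = l - 2"
        using l by auto
      then show ?thesis by (simp only:) (simp add: power3_eq_cube field_simps)
    next
      case False
      then have "\<bar>l + 2\<bar> = - (l + 2)" "\<bar>l + 1\<bar> = - (l + 1)" "\<bar>l\<bar> = - l" "\<bar>l - 1\<bar> = - (l - 1)" "\<bar>l - 2\<bar> = - (l - 2)"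
        using l by auto
      then show ?thesis by (simp only:) (simp add: power3_eq_cube field_simps)
    qed
    finally show ?thesis
      by (subst integral_even_cis[OF i0]) (auto simp: G_def)
  qed
  define c where "c = inverse (integral\<^sup>L lborel G)"
  show thesis
  proof (rule that[of "\<lambda>t. c * G t"])
    show "(LINT t|lborel. (c * G t) *\<^sub>R cis (l * t)) = 0" if "2 \<le> \<bar>l\<bar>" for l
      using ft[OF that] by (simp flip: scaleR_scaleR)
    show "integrable lborel (\<lambda>t. (1 + \<bar>t\<bar>) * (c * G t))"
      using integrable_mult_right[OF i1, of c] by (simp add: mult_ac)
  qed (use pos i0 G0 in \<open>auto simp: c_def\<close>)
qed

text \<open>
  Integrating a Dirichlet polynomial against this kernel along a vertical line cuts it off after its
  \<open>N\<close>-th term. The Fourier transform is a trapezoid, equal to \<open>1\<close> on \<open>[-ln N, ln N]\<close> and to \<open>0\<close> outside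
  \<open>[-ln (N + 1), ln (N + 1)]\<close>, obtained as a difference of two Fejer triangles. The flanks have width about
  \<open>1 / N\<close>, which is why the \<open>L\<^sup>1\<close> norm grows; it is in fact logarithmic, and any power \<open>N powr e\<close>
  suffices below.
\<close>

lemma partial_sum_kernel:
  assumes e: "0 < e" "e < 1"
  obtains C where "\<And>N. 1 \<le> N \<Longrightarrow> \<exists>k. integrable lborel k \<and> (LINT t|lborel. \<bar>k t\<bar>) \<le> C * real N powr e
    \<and> (\<forall>n\<ge>1. (LINT t|lborel. k t *\<^sub>R cis (- ln (real n) * t)) = (if n \<le> N then 1 else 0))"
proof -
  define I where "I = integral\<^sup>L lborel (decay e)"
  have I: "I \<ge> 0" unfolding I_def by (intro integral_nonneg_AE) (simp add: decay_nonneg)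
  have main: "\<exists>k. integrable lborel k \<and> (LINT t|lborel. \<bar>k t\<bar>) \<le> (2 * 2 powr e + 2 powr e / e) * I / fejer_mass * real N powr e
    \<and> (\<forall>n\<ge>1. (LINT t|lborel. k t *\<^sub>R cis (- ln (real n) * t)) = (if n \<le> N then 1 else 0))"
    if N: "1 \<le> N" for N
  proof -
    define A where "A = ln (real N)"
    define B where "B = ln (real N + 1)"
    have A0: "0 \<le> A" using N by (simp add: A_def)
    have AB: "A < B" using N by (simp add: A_def B_def)
    have "1 / (real N + 1) \<le> B - A"
      using ln_le_minus_one[of "real N / (real N + 1)"] N by (simp add: A_def B_def ln_div field_simps)
    moreover have "1 / (2 * real N) \<le> 1 / (real N + 1)" using N by (intro frac_le) auto
    ultimately have gap: "1 / (2 * real N) \<le> B - A" by linarith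
    \<comment> \<open>the difference of the Fejer kernels \<open>(1 - cos (B * t)) / t\<^sup>2\<close> and \<open>(1 - cos (A * t)) / t\<^sup>2\<close>, normalized\<close>
    define k where "k t = (cos (A * t) - cos (B * t)) / t\<^sup>2 / (fejer_mass * (B - A))" for t
    have [measurable]: "k \<in> borel_measurable borel" unfolding k_def by measurable
    \<comment> \<open>the first summand bounds the kernel for \<open>\<bar>t\<bar> \<ge> 1\<close>, by \<open>\<bar>sin y\<bar> \<le> \<bar>y\<bar> powr (1 - e)\<close>; the second for \<open>\<bar>t\<bar> < 1\<close>\<close>
    define Q where "Q = 2 * (B - A) powr (1 - e) + (B - A) * (A + B) / 2"
    have Q0: "Q \<ge> 0" using A0 AB by (simp add: Q_def)
    have num: "\<bar>(cos (A * t) - cos (B * t)) / t\<^sup>2\<bar> \<le> Q * decay e t" for t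
    proof (cases "t = 0")
      case False
      have eq: "\<bar>cos (A * t) - cos (B * t)\<bar> = 2 * \<bar>sin ((A + B) / 2 * t)\<bar> * \<bar>sin ((B - A) / 2 * t)\<bar>"
        by (simp add: cos_diff_cos abs_mult algebra_simps add_divide_distrib diff_divide_distrib)
      have sB: "\<bar>sin ((B - A) / 2 * t)\<bar> \<le> (B - A) / 2 * \<bar>t\<bar>"
        using abs_sin_x_le_abs_x[of "(B - A) / 2 * t"] AB by (simp add: abs_mult)
      have sA: "\<bar>sin ((A + B) / 2 * t)\<bar> \<le> (A + B) / 2 * \<bar>t\<bar>"
        using abs_sin_x_le_abs_x[of "(A + B) / 2 * t"] A0 AB by (simp add: abs_mult)
      have "\<bar>cos (A * t) - cos (B * t)\<bar> \<le> Q * decay e t * t\<^sup>2"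
      proof (cases "\<bar>t\<bar> < 1")
        case True
        have "\<bar>t\<bar> powr (- 1 - e) \<ge> \<bar>t\<bar> powr 0"
          using True False e by (intro powr_mono') auto
        then have d: "decay e t = 1" using False by (simp add: decay_def)
        have "\<bar>cos (A * t) - cos (B * t)\<bar> \<le> 2 * ((A + B) / 2 * \<bar>t\<bar>) * ((B - A) / 2 * \<bar>t\<bar>)"
          unfolding eq using A0 AB by (intro mult_mono sA sB) auto
        also have "\<dots> = (B - A) * (A + B) / 2 * (\<bar>t\<bar> * \<bar>t\<bar>)" by (simp add: field_simps)
        also have "\<bar>t\<bar> * \<bar>t\<bar> = t\<^sup>2" by (simp add: power2_eq_square flip: abs_mult)
        also have "(B - A) * (A + B) / 2 * t\<^sup>2 \<le> Q * t\<^sup>2" unfolding Q_def using AB by (intro mult_right_mono) auto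
        finally show ?thesis by (simp add: d)
      next
        case False
        have "\<bar>t\<bar> powr (- 1 - e) \<le> \<bar>t\<bar> powr 0"
          using False e by (intro powr_mono) auto
        then have d: "decay e t = \<bar>t\<bar> powr (- 1 - e)" using False by (simp add: decay_def min_def split: if_splits)
        have "\<bar>sin ((B - A) / 2 * t)\<bar> \<le> ((B - A) * \<bar>t\<bar>) powr (1 - e)"
        proof (cases "(B - A) * \<bar>t\<bar> \<le> 1")
          case True
          have "(B - A) * \<bar>t\<bar> = ((B - A) * \<bar>t\<bar>) powr 1" using AB by simp
          also have "\<dots> \<le> ((B - A) * \<bar>t\<bar>) powr (1 - e)"
            using True AB e by (intro powr_mono') auto
          finally have "(B - A) * \<bar>t\<bar> \<le> ((B - A) * \<bar>t\<bar>) powr (1 - e)" .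
          moreover have "(B - A) / 2 * \<bar>t\<bar> \<le> (B - A) * \<bar>t\<bar>" using AB by (intro mult_right_mono) auto
          ultimately show ?thesis using sB by linarith
        next
          case False
          then have "1 \<le> ((B - A) * \<bar>t\<bar>) powr (1 - e)" using e by (intro ge_one_powr_ge_zero) auto
          then show ?thesis using abs_sin_le_one[of "(B - A) / 2 * t"] by linarith
        qed
        then have "\<bar>cos (A * t) - cos (B * t)\<bar> \<le> 2 * 1 * ((B - A) * \<bar>t\<bar>) powr (1 - e)"
          unfolding eq by (intro mult_mono) auto
        also have "\<dots> = 2 * (B - A) powr (1 - e) * \<bar>t\<bar> powr ((- 1 - e) + 2)"
          using AB by (simp add: powr_mult)
        also have "\<bar>t\<bar> powr ((- 1 - e) + 2) = \<bar>t\<bar> powr (- 1 - e) * \<bar>t\<bar> powr 2" by (rule powr_add)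
        also have "\<bar>t\<bar> powr 2 = t\<^sup>2" using False by simp
        also have "2 * (B - A) powr (1 - e) * (\<bar>t\<bar> powr (- 1 - e) * t\<^sup>2) \<le> Q * (\<bar>t\<bar> powr (- 1 - e) * t\<^sup>2)"
          unfolding Q_def using AB A0 by (intro mult_right_mono) auto
        finally show ?thesis by (simp add: d mult_ac)
      qed
      then show ?thesis using False by (simp add: abs_divide divide_le_eq)
    qed (simp add: decay_def)
    have kb: "norm (k t) \<le> Q / (fejer_mass * (B - A)) * decay e t" for t
    proof -
      have "norm (k t) = \<bar>(cos (A * t) - cos (B * t)) / t\<^sup>2\<bar> / (fejer_mass * (B - A))"
        using AB fejer_mass_pos by (simp add: k_def abs_mult)
      also have "\<dots> \<le> Q * decay e t / (fejer_mass * (B - A))"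
        using AB fejer_mass_pos by (intro divide_right_mono num) auto
      finally show ?thesis by simp
    qed
    have ik: "integrable lborel k" by (rule integrable_of_decay[OF _ e(1) kb]) measurable
    have "Q / (B - A) \<le> (2 * 2 powr e + 2 powr e / e) * real N powr e"
    proof -
      have "(B - A) powr (- e) \<le> (1 / (2 * real N)) powr (- e)"
        using gap e N by (intro powr_mono2') auto
      also have "\<dots> = 2 powr e * real N powr e"
        using N by (simp add: powr_minus powr_divide powr_mult)
      finally have 1: "(B - A) powr (- e) \<le> 2 powr e * real N powr e" .
      have "(A + B) / 2 \<le> B" using AB by simp
      also have "B \<le> (real N + 1) powr e / e" unfolding B_def by (intro ln_powr_bound e) auto
      also have "\<dots> \<le> (2 * real N) powr e / e"
        using N e by (intro divide_right_mono powr_mono2) auto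
      finally have 2: "(A + B) / 2 \<le> 2 powr e / e * real N powr e" using N by (simp add: powr_mult)
      have "(B - A) powr (1 - e) = (B - A) * (B - A) powr (- e)"
        using AB powr_add[of "B - A" 1 "- e"] by simp
      then have "Q / (B - A) = 2 * (B - A) powr (- e) + (A + B) / 2"
        using AB by (simp add: Q_def field_simps)
      also have "\<dots> \<le> 2 * (2 powr e * real N powr e) + 2 powr e / e * real N powr e"
        using 1 2 by linarith
      finally show ?thesis by (simp add: distrib_right)
    qed
    then have "Q / (B - A) * (I / fejer_mass) \<le> (2 * 2 powr e + 2 powr e / e) * real N powr e * (I / fejer_mass)"
      using I fejer_mass_pos by (intro mult_right_mono) auto
    moreover have "(LINT t|lborel. \<bar>k t\<bar>) \<le> (LINT t|lborel. Q / (fejer_mass * (B - A)) * decay e t)"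
      using kb by (intro integral_mono integrable_abs ik integrable_mult_right integrable_decay e) auto
    ultimately have norm: "(LINT t|lborel. \<bar>k t\<bar>) \<le> (2 * 2 powr e + 2 powr e / e) * I / fejer_mass * real N powr e"
      by (simp add: I_def field_simps)
    have ft: "(LINT t|lborel. k t *\<^sub>R cis (l * t))
        = of_real ((\<bar>B + l\<bar> + \<bar>B - l\<bar> - \<bar>A + l\<bar> - \<bar>A - l\<bar>) / (2 * (B - A)))" for l
    proof -
      have eq: "k t * cos (l * t) = inverse (2 * fejer_mass * (B - A)) * ((1 - cos ((B + l) * t)) / t\<^sup>2
         + (1 - cos ((B - l) * t)) / t\<^sup>2 - (1 - cos ((A + l) * t)) / t\<^sup>2 - (1 - cos ((A - l) * t)) / t\<^sup>2)" for t
      proof -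
        have "(1 - cos ((B + l) * t)) + (1 - cos ((B - l) * t)) - (1 - cos ((A + l) * t)) - (1 - cos ((A - l) * t))
          = 2 * ((cos (A * t) - cos (B * t)) * cos (l * t))"
          by (simp add: distrib_right left_diff_distrib cos_add cos_diff)
        then have "(1 - cos ((B + l) * t)) / t\<^sup>2
         + (1 - cos ((B - l) * t)) / t\<^sup>2 - (1 - cos ((A + l) * t)) / t\<^sup>2 - (1 - cos ((A - l) * t)) / t\<^sup>2
          = 2 * ((cos (A * t) - cos (B * t)) * cos (l * t)) / t\<^sup>2"
          by (simp flip: add_divide_distrib diff_divide_distrib)
        moreover define d where "d = fejer_mass * (B - A)"
        moreover have "inverse (2 * fejer_mass * (B - A)) = inverse 2 * inverse d"
          unfolding d_def by (simp add: mult.assoc)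
        ultimately show ?thesis
          by (simp only: k_def divide_inverse) (simp add: mult_ac)
      qed
      have "(LINT t|lborel. k t * cos (l * t)) = inverse (2 * fejer_mass * (B - A)) *
        (fejer_mass * \<bar>B + l\<bar> + fejer_mass * \<bar>B - l\<bar> - fejer_mass * \<bar>A + l\<bar> - fejer_mass * \<bar>A - l\<bar>)"
        unfolding eq by (simp add: integrable_fejer integral_fejer)
      also have "\<dots> = (\<bar>B + l\<bar> + \<bar>B - l\<bar> - \<bar>A + l\<bar> - \<bar>A - l\<bar>) / (2 * (B - A))"
        using AB fejer_mass_pos by (simp add: field_simps)
      finally show ?thesis by (subst integral_even_cis[OF ik]) (auto simp: k_def)
    qed
    have "(LINT t|lborel. k t *\<^sub>R cis (- ln (real n) * t)) = (if n \<le> N then 1 else 0)" if n: "n \<ge> 1" for n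
    proof (cases "n \<le> N")
      case True
      then have "0 \<le> ln (real n)" "ln (real n) \<le> A" using n by (simp_all add: A_def)
      then show ?thesis unfolding ft using True AB by simp
    next
      case False
      then have "real n \<ge> real N + 1" by linarith
      then have "B \<le> ln (real n)" unfolding B_def by (intro ln_mono) auto
      then show ?thesis unfolding ft using False AB A0 by simp
    qed
    then show ?thesis using ik norm by blast
  qed
  show thesis by (rule that[OF main])
qed

section \<open>Primes as coordinates\<close>

definition nth_prime :: "nat \<Rightarrow> nat" where
  "nth_prime = enumerate {p. prime p}"

lemma prime_nth_prime: "prime (nth_prime k)"
  using enumerate_in_set[OF primes_infinite, of k] by (simp add: nth_prime_def)

lemma bij_nth_prime: "bij_betw nth_prime UNIV {p. prime p}"
  unfolding nth_prime_def by (rule bij_enumerate[OF primes_infinite])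

lemma le_nth_prime: "k \<le> nth_prime k"
  unfolding nth_prime_def by (rule le_enumerate[OF primes_infinite])

definition prime_index :: "nat \<Rightarrow> nat" where
  "prime_index = inv nth_prime"

lemma prime_index_nth_prime [simp]: "prime_index (nth_prime k) = k"
  unfolding prime_index_def using bij_nth_prime by (intro inv_f_f) (simp add: bij_betw_def)

lemma nth_prime_prime_index [simp]: "prime p \<Longrightarrow> nth_prime (prime_index p) = p"
  unfolding prime_index_def using bij_nth_prime by (intro f_inv_into_f) (simp add: bij_betw_def)

text \<open>
  The monomial \<open>x ^ \<alpha>\<close> is indexed by the number \<open>n\<close> whose prime exponents are \<open>\<alpha>\<close>, so that products of
  monomials correspond to products of indices.
\<close>

definition bohr_monomial :: "nat \<Rightarrow> (nat \<Rightarrow> complex) \<Rightarrow> complex" where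
  "bohr_monomial n x = (\<Prod>p\<in>#prime_factorization n. x (prime_index p))"

lemma bohr_monomial_1 [simp]: "bohr_monomial (Suc 0) x = 1"
  by (simp add: bohr_monomial_def)

lemma bohr_monomial_mult:
  "m > 0 \<Longrightarrow> n > 0 \<Longrightarrow> bohr_monomial (m * n) x = bohr_monomial m x * bohr_monomial n x"
  by (simp add: bohr_monomial_def prime_factorization_mult)

lemma bohr_monomial_prime: "prime p \<Longrightarrow> bohr_monomial p x = x (prime_index p)"
  by (simp add: bohr_monomial_def prime_factorization_prime)

lemma bohr_monomial_prime_power: "bohr_monomial (nth_prime k ^ e) x = x k ^ e"
proof (induction e)
  case (Suc e)
  then show ?case
    using prime_nth_prime[of k] by (simp add: bohr_monomial_mult bohr_monomial_prime prime_gt_0_nat)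
qed simp

lemma bohr_monomial_cong:
  assumes "\<And>p. prime p \<Longrightarrow> p dvd n \<Longrightarrow> x (prime_index p) = y (prime_index p)"
  shows "bohr_monomial n x = bohr_monomial n y"
  unfolding bohr_monomial_def
  by (rule arg_cong[where f = prod_mset], rule image_mset_cong) (auto intro: assms)

lemma bohr_monomial_eq_0:
  assumes "n > 0" "prime r" "r dvd n" "x (prime_index r) = 0"
  shows "bohr_monomial n x = 0"
proof -
  have "r \<in># prime_factorization n" using assms by (simp add: in_prime_factors_iff)
  then have "0 \<in># image_mset (\<lambda>p. x (prime_index p)) (prime_factorization n)"
    using assms(4) by (auto simp: image_iff intro!: bexI[of _ r])
  then show ?thesis by (simp add: bohr_monomial_def prod_mset_zero_iff)
qed

lemma norm_of_nat_powr: "n > 0 \<Longrightarrow> cmod (of_nat n powr z) = real n powr Re z"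
  by (simp add: norm_powr_real_powr)

text \<open>
  The point of the infinite polydisc at which the monomial of index \<open>n\<close> takes the value \<open>n powr -s\<close>.
\<close>

definition bohr_point :: "complex \<Rightarrow> nat \<Rightarrow> complex" where
  "bohr_point s k = of_nat (nth_prime k) powr (- s)"

lemma norm_bohr_point: "cmod (bohr_point s k) = real (nth_prime k) powr (- Re s)"
  unfolding bohr_point_def by (subst norm_of_nat_powr) (auto simp: prime_gt_0_nat prime_nth_prime)

lemma norm_bohr_point_le:
  assumes "Re s > 0" shows "cmod (bohr_point s k) \<le> 2 powr (- Re s)"
  unfolding norm_bohr_point
  using assms prime_ge_2_nat[OF prime_nth_prime[of k]] by (intro powr_mono2') auto

lemma bohr_monomial_bohr_point: "n > 0 \<Longrightarrow> bohr_monomial n (bohr_point s) = of_nat n powr (- s)"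
proof (induction n rule: prime_divisors_induct)
  case (factor p n)
  then have p: "p > 0" "n > 0" using prime_gt_0_nat by auto
  have "of_nat (p * n) powr (- s) = of_nat p powr (- s) * (of_nat n powr (- s) :: complex)"
    unfolding of_nat_mult by (rule powr_times_real) auto
  then show ?case using factor p
    by (simp add: bohr_monomial_mult bohr_monomial_prime bohr_point_def)
qed auto

definition bohr_poly :: "(nat \<Rightarrow> complex) \<Rightarrow> nat \<Rightarrow> (nat \<Rightarrow> complex) \<Rightarrow> complex" where
  "bohr_poly a N x = (\<Sum>n<N. a n * bohr_monomial (Suc n) x)"

definition bohr_polys :: "((nat \<Rightarrow> complex) \<Rightarrow> complex) set" where
  "bohr_polys = {P. \<exists>a N. P = bohr_poly a N}"

lemma bohr_poly_bohr_point:
  "bohr_poly a N (bohr_point s) = (\<Sum>n<N. a n * of_nat (Suc n) powr (- s))"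
  by (simp add: bohr_poly_def bohr_monomial_bohr_point del: of_nat_Suc)

lemma bohr_polys_cmult_monomial:
  assumes "n > 0" shows "(\<lambda>x. c * bohr_monomial n x) \<in> bohr_polys"
proof -
  have "(\<lambda>x. c * bohr_monomial n x) = bohr_poly (\<lambda>m. if m = n - 1 then c else 0) n"
    using assms by (auto simp: bohr_poly_def fun_eq_iff if_distrib[of "\<lambda>z. z * _"] cong: if_cong)
  then show ?thesis by (auto simp: bohr_polys_def)
qed

text \<open>
  Padding with zero coefficients, to bring two polynomials to the same length.
\<close>

lemma bohr_poly_pad:
  "N \<le> N' \<Longrightarrow> bohr_poly a N = bohr_poly (\<lambda>n. if n < N then a n else 0) N'"
  unfolding bohr_poly_def fun_eq_iff
  by (intro allI sum.mono_neutral_cong_left) auto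

lemma bohr_polys_add:
  assumes "P \<in> bohr_polys" "Q \<in> bohr_polys"
  shows "(\<lambda>x. P x + Q x) \<in> bohr_polys"
proof -
  obtain a M b N where P: "P = bohr_poly a M" and Q: "Q = bohr_poly b N"
    using assms by (auto simp: bohr_polys_def)
  have "(\<lambda>x. P x + Q x) = bohr_poly (\<lambda>n. (if n < M then a n else 0) + (if n < N then b n else 0)) (max M N)"
    unfolding P Q bohr_poly_pad[of M "max M N", OF max.cobounded1] bohr_poly_pad[of N "max M N", OF max.cobounded2]
    by (simp add: bohr_poly_def fun_eq_iff distrib_right sum.distrib)
  then show ?thesis by (auto simp: bohr_polys_def)
qed

lemma bohr_polys_const: "(\<lambda>_. c) \<in> bohr_polys"
  using bohr_polys_cmult_monomial[of 1 c] by simp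

lemma bohr_polys_coord: "(\<lambda>x. x k) \<in> bohr_polys"
  using bohr_polys_cmult_monomial[of "nth_prime k" 1] prime_nth_prime[of k]
  by (simp add: bohr_monomial_prime prime_gt_0_nat)

lemma bohr_polys_sum:
  "(\<And>i. i \<in> A \<Longrightarrow> P i \<in> bohr_polys) \<Longrightarrow> (\<lambda>x. \<Sum>i\<in>A. P i x) \<in> bohr_polys"
  by (induction A rule: infinite_finite_induct) (auto intro: bohr_polys_add bohr_polys_const)

lemma bohr_polys_mult:
  assumes "P \<in> bohr_polys" "Q \<in> bohr_polys"
  shows "(\<lambda>x. P x * Q x) \<in> bohr_polys"
proof -
  obtain a M b N where P: "P = bohr_poly a M" and Q: "Q = bohr_poly b N"
    using assms by (auto simp: bohr_polys_def)
  have "(\<lambda>x. P x * Q x) = (\<lambda>x. \<Sum>m<M. \<Sum>n<N. (a m * b n) * bohr_monomial (Suc m * Suc n) x)"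
    unfolding P Q bohr_poly_def sum_product
    by (intro ext sum.cong refl) (simp add: bohr_monomial_mult del: mult_Suc mult_Suc_right)
  also have "\<dots> \<in> bohr_polys"
    by (intro bohr_polys_sum bohr_polys_cmult_monomial) simp
  finally show ?thesis .
qed

lemma bohr_polys_diff:
  assumes "P \<in> bohr_polys" "Q \<in> bohr_polys"
  shows "(\<lambda>x. P x - Q x) \<in> bohr_polys"
  using bohr_polys_add[OF assms(1) bohr_polys_mult[OF bohr_polys_const[of "-1"] assms(2)]] by simp

lemma bohr_polys_power: "P \<in> bohr_polys \<Longrightarrow> (\<lambda>x. P x ^ j) \<in> bohr_polys"
  by (induction j) (auto intro: bohr_polys_mult bohr_polys_const)


section \<open>Parseval's inequality and the comparison of the two norms\<close>

lemma of_nat_powr_minus_Complex: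
  "n > 0 \<Longrightarrow> of_nat n powr (- Complex r t) = of_real (real n powr (- r)) * cis (- ln (real n) * t)"
proof -
  assume n: "n > 0"
  have "of_nat n powr (- Complex r t) = exp (- Complex r t * of_real (ln (real n)))"
    using n by (simp add: powr_def Ln_of_nat)
  also have "- Complex r t * of_real (ln (real n)) = of_real (- r * ln (real n)) + \<i> * of_real (- ln (real n) * t)"
    by (simp add: complex_eq_iff)
  also have "exp \<dots> = of_real (exp (- r * ln (real n))) * cis (- ln (real n) * t)"
    unfolding exp_add cis_conv_exp by (simp only: exp_of_real)
  finally show ?thesis using n by (simp add: powr_def)
qed

lemma integral_kernel_trig_sum:
  assumes k: "integrable lborel k"
  shows "integrable lborel (\<lambda>t. k t *\<^sub>R cis (l * t))" (is ?A)
    and "(LINT t|lborel. k t *\<^sub>R (\<Sum>i\<in>I. c i * cis (f i * t))) = (\<Sum>i\<in>I. c i * (LINT t|lborel. k t *\<^sub>R cis (f i * t)))" (is ?B)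
proof -
  have [measurable]: "k \<in> borel_measurable borel" using borel_measurable_integrable[OF k] by simp
  have i: "integrable lborel (\<lambda>t. k t *\<^sub>R cis (l * t))" for l
  proof (rule Bochner_Integration.integrable_bound[OF k])
    have "(\<lambda>t. cis (l * t)) \<in> borel_measurable borel"
      by (intro borel_measurable_continuous_onI continuous_intros)
    then show "(\<lambda>t. k t *\<^sub>R cis (l * t)) \<in> borel_measurable lborel" by measurable
  qed auto
  then show ?A .
  have "(LINT t|lborel. k t *\<^sub>R (\<Sum>i\<in>I. c i * cis (f i * t))) = (LINT t|lborel. (\<Sum>i\<in>I. c i * (k t *\<^sub>R cis (f i * t))))"
    by (intro Bochner_Integration.integral_cong refl) (simp add: scaleR_sum_right)
  also have "\<dots> = (\<Sum>i\<in>I. (LINT t|lborel. c i * (k t *\<^sub>R cis (f i * t))))"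
    by (intro Bochner_Integration.integral_sum integrable_mult_right i)
  finally show ?B by (simp only: integral_mult_right_zero)
qed

text \<open>
  Average \<open>\<bar>D(\<sigma> + i B t)\<bar>\<^sup>2\<close> against the band-limited kernel. If \<open>B\<close> is so large that all differences
  \<open>B * (ln m - ln n)\<close> leave the band, then the mixed terms vanish exactly and the average is the sum of the squares
  of the coefficients on the line \<open>Re s = \<sigma>\<close>. Finally \<open>\<sigma> \<rightarrow> 0\<close>.
\<close>

lemma dirichlet_poly_parseval:
  assumes M: "\<And>s. Re s > 0 \<Longrightarrow> cmod (\<Sum>n<N. a n * of_nat (Suc n) powr (- s)) \<le> M"
  shows "(\<Sum>n<N. (cmod (a n))\<^sup>2) \<le> M\<^sup>2"
proof -
  obtain H :: "real \<Rightarrow> real" where H: "\<And>t. 0 \<le> H t" "integrable lborel H" "integral\<^sup>L lborel H = 1"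
    "\<And>l. 2 \<le> \<bar>l\<bar> \<Longrightarrow> (LINT t|lborel. H t *\<^sub>R cis (l * t)) = 0"
    by (rule band_limited_kernel) blast
  have int1: "(LINT t|lborel. H t *\<^sub>R cis (0 * t)) = 1"
    using H(3) by (simp add: scaleR_conv_of_real)
  define L where "L n = ln (real (Suc n))" for n
  define E where "E = {\<bar>L m - L n\<bar> | m n. m < N \<and> n < N \<and> m \<noteq> n}"
  have "E = (\<lambda>(m, n). \<bar>L m - L n\<bar>) ` ({..<N} \<times> {..<N} - Id)"
    by (auto simp: E_def image_iff)
  then have finE: "finite E" by simp
  define d where "d = Min (insert 1 E)"
  have dE: "d \<le> e" if "e \<in> E" for e unfolding d_def using finE that by (intro Min_le) auto
  have d: "d > 0" unfolding d_def using finE by (auto simp: E_def L_def)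
  \<comment> \<open>\<open>d\<close> is at most the smallest gap between frequencies, so \<open>B\<close> stretches all gaps to at least 2\<close>
  define B where "B = 2 / d"
  have B: "2 \<le> \<bar>B * (L n - L m)\<bar>" if "m < N" "n < N" "m \<noteq> n" for m n
  proof -
    have "d \<le> \<bar>L n - L m\<bar>" using that by (intro dE) (auto simp: E_def)
    then show ?thesis using d by (simp add: B_def abs_mult field_simps)
  qed
  have sig: "(\<Sum>n<N. (cmod (a n) * real (Suc n) powr (- \<sigma>))\<^sup>2) \<le> M\<^sup>2" if \<sigma>: "\<sigma> > 0" for \<sigma>
  proof -
    define b where "b n = a n * of_real (real (Suc n) powr (- \<sigma>))" for n
    define D where "D t = (\<Sum>n<N. b n * cis (- L n * t))" for t
    have DM: "cmod (D t) \<le> M" for t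
    proof -
      have "D t = (\<Sum>n<N. a n * of_nat (Suc n) powr (- Complex \<sigma> t))"
        unfolding D_def b_def L_def
        by (intro sum.cong refl) (simp add: of_nat_powr_minus_Complex del: of_nat_Suc)
      then show ?thesis using M[of "Complex \<sigma> t"] \<sigma> by simp
    qed
    have sq: "of_real ((cmod (D (B * t)))\<^sup>2) = (\<Sum>(m, n)\<in>{..<N} \<times> {..<N}. (b m * cnj (b n)) * cis (B * (L n - L m) * t))" for t
    proof -
      have "of_real ((cmod (D (B * t)))\<^sup>2) = D (B * t) * cnj (D (B * t))"
        by (rule complex_norm_square)
      also have "\<dots> = (\<Sum>m<N. \<Sum>n<N. (b m * cnj (b n)) * cis (B * (L n - L m) * t))"
        unfolding D_def cnj_sum sum_product
        by (intro sum.cong refl) (simp add: cis_cnj algebra_simps, simp add: cis_mult algebra_simps)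
      finally show ?thesis by (simp add: sum.cartesian_product)
    qed
    have [measurable]: "(\<lambda>t. (cmod (D (B * t)))\<^sup>2) \<in> borel_measurable borel"
      unfolding D_def by (intro borel_measurable_continuous_onI continuous_intros)
    have [measurable]: "H \<in> borel_measurable borel" using borel_measurable_integrable[OF H(2)] by simp
    have le: "H t * (cmod (D (B * t)))\<^sup>2 \<le> H t * M\<^sup>2" for t
      using DM H(1) by (intro mult_left_mono power_mono) auto
    have iD: "integrable lborel (\<lambda>t. H t * (cmod (D (B * t)))\<^sup>2)"
    proof (rule Bochner_Integration.integrable_bound[OF integrable_mult_left[OF H(2), of "M\<^sup>2"]])
      show "AE t in lborel. norm (H t * (cmod (D (B * t)))\<^sup>2) \<le> norm (H t * M\<^sup>2)"
        using le H(1) by (auto simp: abs_mult)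
    qed measurable
    have "of_real (LINT t|lborel. H t * (cmod (D (B * t)))\<^sup>2) = (LINT t|lborel. H t *\<^sub>R complex_of_real ((cmod (D (B * t)))\<^sup>2))"
      unfolding integral_complex_of_real[symmetric] by (simp add: scaleR_conv_of_real)
    also have "\<dots> = (\<Sum>(m, n)\<in>{..<N} \<times> {..<N}. (b m * cnj (b n)) * (LINT t|lborel. H t *\<^sub>R cis (B * (L n - L m) * t)))"
      unfolding sq case_prod_unfold by (rule integral_kernel_trig_sum(2)[OF H(2)])
    also have "\<dots> = (\<Sum>(m, n)\<in>{..<N} \<times> {..<N}. if m = n then b m * cnj (b m) else 0)"
      using H(4)[OF B] int1 by (intro sum.cong refl) (auto split: prod.splits)
    also have "\<dots> = (\<Sum>m<N. b m * cnj (b m))"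
      by (simp add: sum.cartesian_product[symmetric])
    also have "\<dots> = of_real (\<Sum>n<N. (cmod (b n))\<^sup>2)"
      by (simp only: complex_norm_square of_real_sum)
    finally have "(LINT t|lborel. H t * (cmod (D (B * t)))\<^sup>2) = (\<Sum>n<N. (cmod (b n))\<^sup>2)"
      using of_real_eq_iff by blast
    moreover have "(LINT t|lborel. H t * (cmod (D (B * t)))\<^sup>2) \<le> (LINT t|lborel. H t * M\<^sup>2)"
      by (intro integral_mono iD integrable_mult_left H(2) le)
    ultimately show ?thesis using H(3) by (simp add: b_def norm_mult)
  qed
  have "((\<lambda>\<sigma>. \<Sum>n<N. (cmod (a n) * real (Suc n) powr (- \<sigma>))\<^sup>2) \<longlongrightarrow> (\<Sum>n<N. (cmod (a n) * real (Suc n) powr (- 0))\<^sup>2)) (at_right 0)"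
    by (intro tendsto_intros) auto
  then have "(\<Sum>n<N. (cmod (a n) * real (Suc n) powr (- 0))\<^sup>2) \<le> M\<^sup>2"
  proof (rule tendsto_upperbound)
    show "\<forall>\<^sub>F \<sigma> in at_right 0. (\<Sum>n<N. (cmod (a n) * real (Suc n) powr (- \<sigma>))\<^sup>2) \<le> M\<^sup>2"
      by (rule eventually_mono[OF eventually_at_right_less]) (rule sig)
  qed simp
  then show ?thesis by simp
qed


text \<open>
  All monomials in \<open>K\<close> variables together give the product of \<open>K\<close> geometric series. The induction splits
  off the power of the last prime.
\<close>

lemma sum_bohr_monomial_le:
  assumes r: "0 \<le> r" "r < 1"
    and x: "\<And>k. cmod (x k) \<le> r" "\<And>k. k \<ge> K \<Longrightarrow> x k = 0"
    and A: "finite A" "0 \<notin> A"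
  shows "(\<Sum>n\<in>A. (cmod (bohr_monomial n x))\<^sup>2) \<le> (1 / (1 - r\<^sup>2)) ^ K"
  using x A
proof (induction K arbitrary: x A)
  case 0
  have z: "bohr_monomial n x = 0" if "n \<in> A" "n \<noteq> 1" for n
  proof -
    have "n > 0" using that 0 by (metis not_gr0)
    moreover obtain p where "prime p" "p dvd n" using prime_factor_nat[OF \<open>n \<noteq> 1\<close>] by blast
    ultimately show ?thesis using 0(2) by (intro bohr_monomial_eq_0) auto
  qed
  have "(\<Sum>n\<in>A. (cmod (bohr_monomial n x))\<^sup>2) = (\<Sum>n\<in>A \<inter> {1}. (cmod (bohr_monomial n x))\<^sup>2)"
    using 0 z by (intro sum.mono_neutral_right) auto
  also have "\<dots> \<le> 1" by (cases "1 \<in> A") auto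
  finally show ?case by simp
next
  case (Suc K)
  define p where "p = nth_prime K"
  define y where "y = x(K := 0)"
  define q where "q = r\<^sup>2"
  have q: "0 \<le> q" "q < 1" using r by (auto simp: q_def power_less_one_iff abs_square_less_1)
  have pp: "prime p" unfolding p_def by (rule prime_nth_prime)
  define h where "h n = (multiplicity p n, n div p ^ multiplicity p n)" for n
  have hn: "p ^ multiplicity p n * (n div p ^ multiplicity p n) = n" for n
    by (simp add: multiplicity_dvd)
  have inj: "inj_on h A"
  proof (rule inj_onI)
    fix m n assume "h m = h n"
    then show "m = n" using hn[of m] hn[of n] by (metis h_def prod.inject)
  qed
  define S where "S = fst ` h ` A"
  define A' where "A' = snd ` h ` A"
  have fin: "finite S" "finite A'" using Suc.prems by (auto simp: S_def A'_def)
  have A'0: "0 \<notin> A'"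
  proof
    assume "0 \<in> A'"
    then obtain n where "n \<in> A" "n div p ^ multiplicity p n = 0" by (auto simp: A'_def h_def)
    then show False using hn[of n] Suc.prems(4) by (metis mult_0_right)
  qed
  have each: "(cmod (bohr_monomial n x))\<^sup>2 \<le> q ^ fst (h n) * (cmod (bohr_monomial (snd (h n)) y))\<^sup>2" if "n \<in> A" for n
  proof -
    define m where "m = n div p ^ multiplicity p n"
    have n0: "n \<noteq> 0" using that Suc.prems by metis
    have n: "n = p ^ multiplicity p n * m" using hn[of n] by (simp add: m_def)
    have m0: "m > 0" using n n0 by (metis mult_0_right not_gr0)
    have ndvd: "\<not> p dvd m" unfolding m_def using n0 pp by (intro multiplicity_decompose) auto
    have "bohr_monomial n x = x K ^ multiplicity p n * bohr_monomial m x"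
      using pp m0 by (subst n) (simp add: bohr_monomial_mult prime_gt_0_nat, simp add: p_def bohr_monomial_prime_power)
    moreover have "bohr_monomial m x = bohr_monomial m y"
    proof (rule bohr_monomial_cong)
      fix l assume l: "prime l" "l dvd m"
      then have "l \<noteq> p" using ndvd by auto
      then have "prime_index l \<noteq> K" using l(1) by (metis nth_prime_prime_index p_def)
      then show "x (prime_index l) = y (prime_index l)" by (simp add: y_def)
    qed
    ultimately have "(cmod (bohr_monomial n x))\<^sup>2 = ((cmod (x K))\<^sup>2) ^ multiplicity p n * (cmod (bohr_monomial m y))\<^sup>2"
      by (simp add: norm_mult norm_power power_mult_distrib flip: power_mult) (simp add: mult.commute)
    also have "\<dots> \<le> q ^ multiplicity p n * (cmod (bohr_monomial m y))\<^sup>2"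
      unfolding q_def using Suc.prems(1) by (intro mult_right_mono power_mono) auto
    finally show ?thesis by (simp add: h_def m_def)
  qed
  have IH: "(\<Sum>n\<in>A'. (cmod (bohr_monomial n y))\<^sup>2) \<le> (1 / (1 - q)) ^ K"
    unfolding q_def
  proof (rule Suc.IH)
    show "cmod (y k) \<le> r" for k using Suc.prems(1)[of k] r by (simp add: y_def)
    show "y k = 0" if "k \<ge> K" for k using Suc.prems(2)[of k] that by (cases "k = K") (auto simp: y_def)
  qed (use fin A'0 in auto)
  have geo: "(\<Sum>e\<in>S. q ^ e) \<le> 1 / (1 - q)"
    using sum_le_suminf[of "\<lambda>e. q ^ e" S] q fin by (simp add: suminf_geometric summable_geometric)
  have "(\<Sum>n\<in>A. (cmod (bohr_monomial n x))\<^sup>2) \<le> (\<Sum>n\<in>A. (\<lambda>(e, m). q ^ e * (cmod (bohr_monomial m y))\<^sup>2) (h n))"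
    using each by (intro sum_mono) (simp add: case_prod_unfold)
  also have "\<dots> = (\<Sum>(e, m)\<in>h ` A. q ^ e * (cmod (bohr_monomial m y))\<^sup>2)"
    by (simp add: sum.reindex[OF inj] o_def)
  also have "\<dots> \<le> (\<Sum>(e, m)\<in>S \<times> A'. q ^ e * (cmod (bohr_monomial m y))\<^sup>2)"
    using fin q by (intro sum_mono2) (auto simp: S_def A'_def image_iff, (metis fst_conv snd_conv)+)
  also have "\<dots> = (\<Sum>e\<in>S. q ^ e) * (\<Sum>m\<in>A'. (cmod (bohr_monomial m y))\<^sup>2)"
    by (simp add: sum_product sum.cartesian_product)
  also have "\<dots> \<le> 1 / (1 - q) * (1 / (1 - q)) ^ K"
    using q IH geo by (intro mult_mono sum_nonneg) auto
  finally show ?case by (simp add: q_def)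
qed

lemma le_of_power_le_mult:
  fixes u M C :: real
  assumes "u \<ge> 0" "M \<ge> 0" and le: "\<And>j. u ^ j \<le> C * M ^ j"
  shows "u \<le> M"
proof (rule ccontr)
  assume "\<not> u \<le> M"
  then have uM: "M < u" by simp
  show False
  proof (cases "M = 0")
    case True
    then show False using le[of 1] uM by simp
  next
    case False
    then have M: "M > 0" using assms by simp
    have "1 < u / M" using uM M by simp
    then obtain j where "C < (u / M) ^ j" using real_arch_pow by blast
    then show False using le[of j] M by (simp add: power_divide field_simps)
  qed
qed

text \<open>
  The power trick: Parseval's inequality for \<open>P^j\<close> and the Cauchy-Schwarz inequality bound \<open>\<bar>P x\<bar>^j\<close> by
  \<open>C * M^j\<close>, where \<open>C\<close> depends on \<open>x\<close> and on the number of variables in \<open>P\<close> but not on \<open>j\<close>.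
\<close>

lemma bohr_poly_le_of_half_plane:
  assumes P: "P \<in> bohr_polys"
    and M: "\<And>s. Re s > 0 \<Longrightarrow> cmod (P (bohr_point s)) \<le> M"
    and x: "r < 1" "\<And>k. cmod (x k) \<le> r"
  shows "cmod (P x) \<le> M"
proof -
  have M0: "M \<ge> 0" using order_trans[OF norm_ge_zero M[of 1]] by simp
  have r0: "0 \<le> r" using order_trans[OF norm_ge_zero x(2)[of 0]] .
  obtain a N where aN: "P = bohr_poly a N" using P by (auto simp: bohr_polys_def)
  \<comment> \<open>primes up to \<open>N\<close> have index less than \<open>K\<close>, so \<open>P\<close> depends on the first \<open>K\<close> coordinates only\<close>
  define K where "K = Suc N"
  define y where "y k = (if k < K then x k else 0)" for k
  have "P x = P y" unfolding aN bohr_poly_def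
  proof (intro sum.cong refl arg_cong2[where f = "(*)"] bohr_monomial_cong)
    fix n p assume n: "n \<in> {..<N}" and p: "prime p" "p dvd Suc n"
    have "prime_index p \<le> p" using le_nth_prime[of "prime_index p"] p by simp
    also have "p \<le> Suc n" using p by (intro dvd_imp_le) auto
    finally show "x (prime_index p) = y (prime_index p)" using n by (simp add: y_def K_def)
  qed
  have y: "cmod (y k) \<le> r" "k \<ge> K \<Longrightarrow> y k = 0" for k using x(2) r0 by (auto simp: y_def)
  define C where "C = sqrt ((1 / (1 - r\<^sup>2)) ^ K)"
  have "cmod (P y) ^ j \<le> C * M ^ j" for j
  proof -
    obtain b L where bL: "(\<lambda>x. P x ^ j) = bohr_poly b L"
      using bohr_polys_power[OF P, of j] by (auto simp: bohr_polys_def)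
    have "(\<Sum>n<L. (cmod (b n))\<^sup>2) \<le> (M ^ j)\<^sup>2"
    proof (rule dirichlet_poly_parseval)
      fix s :: complex assume s: "Re s > 0"
      have "(\<Sum>n<L. b n * of_nat (Suc n) powr (- s)) = P (bohr_point s) ^ j"
        using fun_cong[OF bL, of "bohr_point s"] by (simp add: bohr_poly_bohr_point)
      then show "cmod (\<Sum>n<L. b n * of_nat (Suc n) powr (- s)) \<le> M ^ j"
        using M[OF s] by (simp add: norm_power power_mono)
    qed
    then have b: "sqrt (\<Sum>n<L. (cmod (b n))\<^sup>2) \<le> M ^ j" using M0 by (simp add: real_le_lsqrt sum_nonneg)
    have "(\<Sum>n\<in>Suc ` {..<L}. (cmod (bohr_monomial n y))\<^sup>2) \<le> (1 / (1 - r\<^sup>2)) ^ K"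
      using r0 x(1) y by (intro sum_bohr_monomial_le) auto
    then have m: "sqrt (\<Sum>n<L. (cmod (bohr_monomial (Suc n) y))\<^sup>2) \<le> C"
      unfolding C_def by (intro real_sqrt_le_mono) (simp add: sum.reindex)
    have "cmod (P y) ^ j = cmod (bohr_poly b L y)"
      using fun_cong[OF bL, of y] by (simp flip: norm_power)
    also have "\<dots> \<le> (\<Sum>n<L. cmod (b n) * cmod (bohr_monomial (Suc n) y))"
      unfolding bohr_poly_def by (rule order_trans[OF norm_sum]) (simp add: norm_mult)
    also have "\<dots> \<le> sqrt (\<Sum>n<L. (cmod (b n))\<^sup>2) * sqrt (\<Sum>n<L. (cmod (bohr_monomial (Suc n) y))\<^sup>2)"
      using L2_set_mult_ineq[of "\<lambda>n. cmod (b n)" "\<lambda>n. cmod (bohr_monomial (Suc n) y)" "{..<L}"] by (simp add: L2_set_def)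
    also have "\<dots> \<le> M ^ j * C" using b m M0 by (intro mult_mono) (auto intro: sum_nonneg)
    finally show ?thesis by (simp add: mult.commute)
  qed
  then show ?thesis using le_of_power_le_mult[of "cmod (P y)" M C] M0 \<open>P x = P y\<close> by simp
qed

section \<open>Partial sums of Dirichlet polynomials\<close>

text \<open>
  The mean value inequality for \<open>w powr -z\<close> on the segment from \<open>n\<close> to \<open>n + 1\<close>.
\<close>

lemma norm_powr_minus_diff_le:
  assumes n: "n \<ge> (1::nat)" and z: "Re z \<ge> 0"
  shows "cmod (of_nat n powr (- z) - of_nat (Suc n) powr (- z)) \<le> cmod z * real n powr (- Re z - 1)"
proof -
  define S where "S = closed_segment (of_nat n :: complex) (of_nat (Suc n))"
  have S: "\<exists>u\<ge>real n. w = of_real u" if w: "w \<in> S" for w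
  proof -
    obtain u where u: "0 \<le> u" "w = (1 - u) *\<^sub>R of_nat n + u *\<^sub>R of_nat (Suc n)"
      using w by (auto simp: S_def closed_segment_def)
    then have "w = of_real (real n + u)" by (simp add: scaleR_conv_of_real algebra_simps)
    then show ?thesis using u by (intro exI[of _ "real n + u"]) auto
  qed
  have "cmod (of_nat n powr (- z) - of_nat (Suc n) powr (- z))
      \<le> cmod z * real n powr (- Re z - 1) * cmod (of_nat n - of_nat (Suc n))"
  proof (rule field_differentiable_bound[where f' = "\<lambda>w. - z * w powr (- z - 1)"])
    fix w assume "w \<in> S"
    then obtain u where u: "real n \<le> u" "w = of_real u" using S by blast
    have "w \<notin> \<real>\<^sub>\<le>\<^sub>0" using u n by simp
    then show "((\<lambda>w. w powr (- z)) has_field_derivative - z * w powr (- z - 1)) (at w within S)"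
      by (auto intro!: derivative_eq_intros)
    have "cmod (- z * w powr (- z - 1)) = cmod z * u powr (- Re z - 1)"
      using u n by (simp add: norm_mult norm_powr_real_powr)
    also have "\<dots> \<le> cmod z * real n powr (- Re z - 1)"
      using u n z by (intro mult_left_mono powr_mono2') auto
    finally show "cmod (- z * w powr (- z - 1)) \<le> cmod z * real n powr (- Re z - 1)" .
  qed (auto simp: S_def)
  then show ?thesis by simp
qed

text \<open>
  Summation by parts. The bound is linear in \<open>\<bar>z\<bar>\<close>, and it gives both the uniform bound for partial sums
  (with real \<open>z\<close>) and their growth along vertical lines (with \<open>e = 0\<close>).
\<close>

lemma abel_partial_sum_bound:
  fixes u :: "nat \<Rightarrow> complex"
  assumes U: "\<And>N. cmod (\<Sum>n<N. u n) \<le> A * real N powr e"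
    and e: "0 \<le> e" "e < Re z"
  shows "cmod (\<Sum>n<N. u n * of_nat (Suc n) powr (- z))
    \<le> A * (1 + cmod z * (\<Sum>n. real (Suc n) powr (e - Re z - 1)))"
proof -
  define w where "w n = (of_nat (Suc n) :: complex) powr (- z)" for n
  define Z where "Z = (\<Sum>n. real (Suc n) powr (e - Re z - 1))"
  have A: "A \<ge> 0" using order_trans[OF norm_ge_zero U[of 1]] by simp
  have "summable (\<lambda>n. real n powr (e - Re z - 1))" using e by (simp add: summable_real_powr_iff)
  then have sm: "summable (\<lambda>n. real (Suc n) powr (e - Re z - 1))" by (subst summable_Suc_iff)
  have parts: "(\<Sum>n<N. u n * w n) = (\<Sum>n<N. u n) * w N + (\<Sum>n<N. (\<Sum>k<Suc n. u k) * (w n - w (Suc n)))" for N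
    by (induction N) (simp_all add: algebra_simps)
  have "cmod ((\<Sum>n<N. u n) * w N) \<le> (A * real N powr e) * real (Suc N) powr (- Re z)"
    unfolding norm_mult w_def using U[of N] A by (intro mult_mono) (auto simp: norm_of_nat_powr simp del: of_nat_Suc)
  also have "\<dots> \<le> (A * real (Suc N) powr e) * real (Suc N) powr (- Re z)"
    using A e by (intro mult_right_mono mult_left_mono powr_mono2) auto
  also have "\<dots> = A * real (Suc N) powr (e - Re z)" by (simp add: powr_diff powr_minus field_simps)
  also have "\<dots> \<le> A * real (Suc N) powr 0" using A e by (intro mult_left_mono powr_mono) auto
  finally have 1: "cmod ((\<Sum>n<N. u n) * w N) \<le> A" by simp
  have "cmod (\<Sum>n<N. (\<Sum>k<Suc n. u k) * (w n - w (Suc n))) \<le> (\<Sum>n<N. A * cmod z * real (Suc n) powr (e - Re z - 1))"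
  proof (rule sum_norm_le)
    fix n
    have "cmod ((\<Sum>k<Suc n. u k) * (w n - w (Suc n))) \<le> (A * real (Suc n) powr e) * (cmod z * real (Suc n) powr (- Re z - 1))"
      unfolding norm_mult w_def using e A by (intro mult_mono U norm_powr_minus_diff_le) auto
    also have "\<dots> = A * cmod z * (real (Suc n) powr e * real (Suc n) powr (- Re z - 1))" by simp
    also have "real (Suc n) powr e * real (Suc n) powr (- Re z - 1) = real (Suc n) powr (e - Re z - 1)"
      unfolding powr_add[symmetric] by (simp add: algebra_simps)
    finally show "cmod ((\<Sum>k<Suc n. u k) * (w n - w (Suc n))) \<le> A * cmod z * real (Suc n) powr (e - Re z - 1)" .
  qed
  also have "\<dots> = A * cmod z * (\<Sum>n<N. real (Suc n) powr (e - Re z - 1))" by (simp add: sum_distrib_left)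
  also have "\<dots> \<le> A * cmod z * Z" unfolding Z_def using A
    by (intro mult_left_mono sum_le_suminf sm) auto
  finally have 2: "cmod (\<Sum>n<N. (\<Sum>k<Suc n. u k) * (w n - w (Suc n))) \<le> A * cmod z * Z" .
  have "cmod (\<Sum>n<N. u n * w n) \<le> A + A * cmod z * Z"
    unfolding parts by (rule order_trans[OF norm_triangle_ineq]) (intro add_mono 1 2)
  then show ?thesis by (simp add: w_def Z_def algebra_simps)
qed

lemma of_nat_powr_minus_add:
  assumes "n > 0"
  shows "of_nat n powr (- (s + \<i> * of_real t)) = (of_nat n powr (- s) :: complex) * cis (- ln (real n) * t)"
proof -
  have "of_nat n powr (- (s + \<i> * of_real t)) = (of_nat n powr (- s) :: complex) * of_nat n powr (- (\<i> * of_real t))"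
    unfolding minus_add_distrib powr_add ..
  also have "- (\<i> * of_real t) = - Complex 0 t" by (simp add: complex_eq_iff)
  finally show ?thesis using assms by (simp add: of_nat_powr_minus_Complex)
qed

text \<open>
  The constant depends only on the line. On the line \<open>Re s = \<sigma> / 2\<close> the cut-off kernel bounds the partial sums of
  length \<open>L\<close> by a multiple of \<open>L powr e\<close> with \<open>e < \<sigma> / 2\<close>. Passing to the line \<open>Re s = \<sigma>\<close> multiplies the terms by
  \<open>n powr -(\<sigma> / 2)\<close>, and summation by parts absorbs the growth.
\<close>

lemma dirichlet_poly_partial_sums_bound:
  assumes \<sigma>: "\<sigma> > 0"
  shows "\<exists>C\<ge>0. \<forall>a N M K s. (\<forall>n\<ge>N. a n = 0) \<longrightarrow>
     (\<forall>s. Re s > 0 \<longrightarrow> cmod (\<Sum>n<N. a n * of_nat (Suc n) powr (- s)) \<le> M) \<longrightarrow> Re s = \<sigma> \<longrightarrow>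
     cmod (\<Sum>n<K. a n * of_nat (Suc n) powr (- s)) \<le> C * M"
proof -
  define e where "e = min (\<sigma> / 4) (1 / 2)"
  have e: "0 < e" "e < 1" "e < Re (of_real (\<sigma> / 2))" using \<sigma> by (auto simp: e_def)
  obtain C where C: "\<And>N. 1 \<le> N \<Longrightarrow> \<exists>k. integrable lborel k \<and> (LINT t|lborel. \<bar>k t\<bar>) \<le> C * real N powr e
    \<and> (\<forall>n\<ge>1. (LINT t|lborel. k t *\<^sub>R cis (- ln (real n) * t)) = (if n \<le> N then 1 else 0))"
    using partial_sum_kernel[OF e(1,2)] by blast
  have C0: "C \<ge> 0"
  proof -
    obtain k :: "real \<Rightarrow> real" where "(LINT t|lborel. \<bar>k t\<bar>) \<le> C * real 1 powr e" using C[of 1] by auto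
    moreover have "0 \<le> (LINT t|lborel. \<bar>k t\<bar>)" by (rule integral_nonneg_AE) auto
    ultimately have "0 \<le> C * real 1 powr e" by (rule order_trans[rotated])
    then show ?thesis by simp
  qed
  define Z where "Z = (\<Sum>n. real (Suc n) powr (e - \<sigma> / 2 - 1))"
  have "summable (\<lambda>n. real n powr (e - \<sigma> / 2 - 1))" using e by (simp add: summable_real_powr_iff)
  then have "summable (\<lambda>n. real (Suc n) powr (e - \<sigma> / 2 - 1))" by (subst summable_Suc_iff)
  then have Z: "Z \<ge> 0" unfolding Z_def by (intro suminf_nonneg) auto
  show ?thesis
  proof (intro exI[of _ "C * (1 + \<sigma> / 2 * Z)"] conjI allI impI)
    show "C * (1 + \<sigma> / 2 * Z) \<ge> 0" using C0 Z \<sigma> by simp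
    fix a :: "nat \<Rightarrow> complex" and N M K and s :: complex
    assume a': "\<forall>n\<ge>N. a n = 0"
      and M': "\<forall>s. Re s > 0 \<longrightarrow> cmod (\<Sum>n<N. a n * of_nat (Suc n) powr (- s)) \<le> M"
      and s: "Re s = \<sigma>"
    note a = a'[rule_format] and M = M'[rule_format]
    \<comment> \<open>half of the real part is spent on the cut-off kernel and half on summation by parts\<close>
    define s1 where "s1 = s - of_real (\<sigma> / 2)"
    have s1: "Re s1 > 0" using s \<sigma> by (simp add: s1_def)
    define u where "u n = a n * of_nat (Suc n) powr (- s1)" for n
    have U: "cmod (\<Sum>n<L. u n) \<le> (C * M) * real L powr e" for L
    proof (cases "L \<ge> 1")
      case True
      obtain k where k: "integrable lborel k" "(LINT t|lborel. \<bar>k t\<bar>) \<le> C * real L powr e"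
        "\<And>n. n \<ge> 1 \<Longrightarrow> (LINT t|lborel. k t *\<^sub>R cis (- ln (real n) * t)) = (if n \<le> L then 1 else 0)"
        using C[OF True] by blast
      have E: "(\<Sum>n<N. u n * cis (- ln (real (Suc n)) * t)) = (\<Sum>n<N. a n * of_nat (Suc n) powr (- (s1 + \<i> * of_real t)))" for t
        unfolding u_def by (simp only: of_nat_powr_minus_add[OF zero_less_Suc] mult.assoc)
      have "(\<Sum>n<L. u n) = (\<Sum>n\<in>{..<L} \<inter> {..<N}. u n)"
        using a by (intro sum.mono_neutral_right) (auto simp: u_def not_less Ball_def)
      also have "\<dots> = (\<Sum>n<N. u n * (if Suc n \<le> L then 1 else 0))"
        by (intro sum.mono_neutral_cong_left) auto
      also have "\<dots> = (LINT t|lborel. k t *\<^sub>R (\<Sum>n<N. u n * cis (- ln (real (Suc n)) * t)))"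
        unfolding integral_kernel_trig_sum(2)[OF k(1)] by (intro sum.cong refl) (subst k(3); simp)
      finally have "cmod (\<Sum>n<L. u n) = cmod (LINT t|lborel. k t *\<^sub>R (\<Sum>n<N. u n * cis (- ln (real (Suc n)) * t)))"
        by simp
      also have "\<dots> \<le> (LINT t|lborel. cmod (k t *\<^sub>R (\<Sum>n<N. u n * cis (- ln (real (Suc n)) * t))))"
        by (rule integral_norm_bound)
      also have "\<dots> \<le> (LINT t|lborel. \<bar>k t\<bar> * M)"
      proof (rule integral_mono')
        show "integrable lborel (\<lambda>t. \<bar>k t\<bar> * M)" using k(1) by (intro integrable_mult_left integrable_abs)
        have "M \<ge> 0" using order_trans[OF norm_ge_zero M[of 1]] by simp
        then show "0 \<le> \<bar>k t\<bar> * M" for t by simp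
        show "cmod (k t *\<^sub>R (\<Sum>n<N. u n * cis (- ln (real (Suc n)) * t))) \<le> \<bar>k t\<bar> * M" for t
          unfolding E norm_scaleR real_norm_def using s1 by (intro mult_left_mono M) auto
      qed
      also have "\<dots> = (LINT t|lborel. \<bar>k t\<bar>) * M" by simp
      also have "\<dots> \<le> C * real L powr e * M"
        using k(2) order_trans[OF norm_ge_zero M[of 1]] by (intro mult_right_mono) auto
      finally show ?thesis by (simp add: mult_ac)
    next
      case False
      then have "L = 0" by simp
      then show ?thesis by simp
    qed
    have "(\<Sum>n<K. a n * of_nat (Suc n) powr (- s)) = (\<Sum>n<K. u n * of_nat (Suc n) powr (- of_real (\<sigma> / 2)))"
      unfolding u_def s1_def mult.assoc powr_add[symmetric] by simp
    then show "cmod (\<Sum>n<K. a n * of_nat (Suc n) powr (- s)) \<le> C * (1 + \<sigma> / 2 * Z) * M"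
      using abel_partial_sum_bound[OF U _ e(3), of K] e(1) \<sigma> by (simp add: Z_def mult_ac)
  qed
qed


section \<open>Uniform limits of Dirichlet polynomials\<close>

lemma uniformly_continuous_uniform_approx:
  fixes f :: "'a::metric_space \<Rightarrow> 'b::metric_space"
  assumes "\<And>e. e > 0 \<Longrightarrow> \<exists>g. uniformly_continuous_on S g \<and> (\<forall>x\<in>S. dist (g x) (f x) \<le> e)"
  shows "uniformly_continuous_on S f"
  unfolding uniformly_continuous_on_def
proof (intro allI impI)
  fix e :: real assume "e > 0"
  then have "e / 4 > 0" by simp
  from assms[OF this] obtain g where g: "uniformly_continuous_on S g" "\<And>x. x \<in> S \<Longrightarrow> dist (g x) (f x) \<le> e / 4" by blast
  obtain d where d: "d > 0" "\<And>x y. x \<in> S \<Longrightarrow> y \<in> S \<Longrightarrow> dist y x < d \<Longrightarrow> dist (g y) (g x) < e / 4"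
    using g(1) \<open>e / 4 > 0\<close> unfolding uniformly_continuous_on_def by blast
  have "dist (f y) (f x) < e" if "x \<in> S" "y \<in> S" "dist y x < d" for x y
  proof -
    have "dist (f y) (f x) \<le> dist (g y) (f y) + dist (g y) (g x) + dist (g x) (f x)"
      using dist_triangle[of "f y" "f x" "g y"] dist_triangle[of "g y" "f x" "g x"]
      by (simp add: dist_commute)
    then show ?thesis using g(2)[OF that(1)] g(2)[OF that(2)] d(2)[OF that] \<open>e > 0\<close> by simp
  qed
  then show "\<exists>d>0. \<forall>x\<in>S. \<forall>x'\<in>S. dist x' x < d \<longrightarrow> dist (f x') (f x) < e" using d(1) by blast
qed

text \<open>
  The derivative is bounded by \<open>ln n\<close> on the half-plane.
\<close>

lemma uniformly_continuous_on_powr_minus: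
  assumes "n > 0"
  shows "uniformly_continuous_on right_half_plane (\<lambda>s. of_nat n powr (- s))"
proof (rule lipschitz_on_uniformly_continuous[of "ln (real n)"], rule lipschitz_onI)
  fix x y assume xy: "x \<in> right_half_plane" "y \<in> right_half_plane"
  show "dist (of_nat n powr (- x)) (of_nat n powr (- y)) \<le> ln (real n) * dist x y"
    unfolding dist_norm
  proof (rule field_differentiable_bound[where f' = "\<lambda>s. of_nat n powr (- s) * (- of_real (ln (real n)))"])
    fix s assume s: "s \<in> right_half_plane"
    show "((\<lambda>s. of_nat n powr (- s)) has_field_derivative of_nat n powr (- s) * (- of_real (ln (real n)))) (at s within right_half_plane)"
      using assms by (simp add: powr_def Ln_of_nat) (auto intro!: derivative_eq_intros)
    have "real n powr (- Re s) \<le> real n powr 0"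
      using assms s by (intro powr_mono) (auto simp: right_half_plane_def)
    then have "real n powr (- Re s) * ln (real n) \<le> 1 * ln (real n)"
      using assms by (intro mult_right_mono) auto
    then show "cmod (of_nat n powr (- s) * (- of_real (ln (real n)))) \<le> ln (real n)"
      using assms by (simp add: norm_mult norm_of_nat_powr)
  qed (use xy convex_right_half_plane in auto)
qed (use assms in auto)

lemma uniformly_continuous_bohr_poly:
  assumes "P \<in> bohr_polys"
  shows "uniformly_continuous_on right_half_plane (\<lambda>s. P (bohr_point s))"
proof -
  obtain a N where P: "P = bohr_poly a N" using assms by (auto simp: bohr_polys_def)
  have sum: "uniformly_continuous_on right_half_plane (\<lambda>s. \<Sum>n<N. a n * of_nat (Suc n) powr (- s))" for N
  proof (induction N)
    case (Suc N)
    have "uniformly_continuous_on right_half_plane (\<lambda>s. a N * of_nat (Suc N) powr (- s))"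
      by (rule bounded_linear.uniformly_continuous_on[OF bounded_linear_mult_right uniformly_continuous_on_powr_minus]) simp
    then show ?case using Suc by (simp del: of_nat_Suc add: uniformly_continuous_on_add)
  qed (simp add: uniformly_continuous_on_const)
  show ?thesis using sum[of N] by (simp add: P bohr_poly_bohr_point del: of_nat_Suc)
qed

text \<open>
  By Parseval the coefficients of the polynomials converge. The bound for partial sums, applied to
  differences of the polynomials, is uniform in the length, so it passes to the limit and allows the limits in
  the index of the polynomial and in the length to be exchanged.
\<close>

lemma dirichlet_series_uniform_limit:
  assumes P: "\<And>j. P j \<in> bohr_polys"
    and lim: "\<And>e. e > 0 \<Longrightarrow> \<forall>\<^sub>F j in sequentially. \<forall>s\<in>right_half_plane. cmod (P j (bohr_point s) - D s) \<le> e"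
  shows "(\<exists>a. \<forall>s\<in>right_half_plane. (\<lambda>n. a n / of_nat (Suc n) powr s) sums D s)
    \<and> uniformly_continuous_on right_half_plane D"
proof -
  have "\<exists>b N. P j = bohr_poly b N \<and> (\<forall>n\<ge>N. b n = 0)" for j
  proof -
    obtain b N where "P j = bohr_poly b N" using P[of j] by (auto simp: bohr_polys_def)
    then have "P j = bohr_poly (\<lambda>n. if n < N then b n else 0) N"
      by (rule trans[OF _ bohr_poly_pad[OF order_refl]])
    then show ?thesis
      by (intro exI[of _ "\<lambda>n. if n < N then b n else 0"] exI[of _ N] conjI) auto
  qed
  then obtain b N where bN: "\<And>j. P j = bohr_poly (b j) (N j)" "\<And>j n. n \<ge> N j \<Longrightarrow> b j n = 0" by metis
  define S where "S j K s = (\<Sum>n<K. b j n * of_nat (Suc n) powr (- s))" for j K and s :: complex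
  have SK: "S j K s = P j (bohr_point s)" if "K \<ge> N j" for j K s
    unfolding S_def bN(1) bohr_poly_bohr_point using bN(2) that by (intro sum.mono_neutral_right) auto
  have diffeq: "(\<Sum>n<K. (b i n - b j n) * of_nat (Suc n) powr (- s)) = S i K s - S j K s" for i j K s
    by (simp add: S_def left_diff_distrib sum_subtractf)
  have near: "\<exists>J. \<forall>i\<ge>J. \<forall>j\<ge>J. \<forall>s\<in>right_half_plane. cmod (P i (bohr_point s) - P j (bohr_point s)) \<le> e" if "e > 0" for e
  proof -
    obtain J where J: "\<And>j s. j \<ge> J \<Longrightarrow> s \<in> right_half_plane \<Longrightarrow> cmod (P j (bohr_point s) - D s) \<le> e / 2"
      using lim[of "e / 2"] \<open>e > 0\<close> by (auto simp: eventually_sequentially)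
    have "cmod (P i (bohr_point s) - P j (bohr_point s)) \<le> e" if "i \<ge> J" "j \<ge> J" "s \<in> right_half_plane" for i j s
      using norm_triangle_ineq4[of "P i (bohr_point s) - D s" "P j (bohr_point s) - D s"] J[of i s] J[of j s] that by simp
    then show ?thesis by blast
  qed
  have coef: "cmod (b i n - b j n) \<le> e"
    if "\<And>s. s \<in> right_half_plane \<Longrightarrow> cmod (P i (bohr_point s) - P j (bohr_point s)) \<le> e" for i j n e
  proof (cases "n < max (N i) (N j)")
    case True
    have e0: "e \<ge> 0" using order_trans[OF norm_ge_zero that[of 1]] by (simp add: right_half_plane_def)
    have "(\<Sum>n<max (N i) (N j). (cmod (b i n - b j n))\<^sup>2) \<le> e\<^sup>2"
      by (rule dirichlet_poly_parseval) (unfold diffeq, use that in \<open>simp add: SK right_half_plane_def\<close>)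
    moreover have "(cmod (b i n - b j n))\<^sup>2 \<le> (\<Sum>n<max (N i) (N j). (cmod (b i n - b j n))\<^sup>2)"
      using True by (intro member_le_sum) auto
    ultimately have "(cmod (b i n - b j n))\<^sup>2 \<le> e\<^sup>2" by linarith
    then show ?thesis using e0 by (simp add: power2_le_iff_abs_le)
  next
    case False
    then show ?thesis using bN(2) order_trans[OF norm_ge_zero that[of 1]] by (simp add: right_half_plane_def)
  qed
  have "Cauchy (\<lambda>j. b j n)" for n
    unfolding Cauchy_def dist_norm
  proof (intro allI impI)
    fix e :: real assume "e > 0"
    then obtain J where "\<And>i j s. i \<ge> J \<Longrightarrow> j \<ge> J \<Longrightarrow> s \<in> right_half_plane \<Longrightarrow> cmod (P i (bohr_point s) - P j (bohr_point s)) \<le> e / 2"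
      using near[of "e / 2"] by auto
    then have "cmod (b i n - b j n) \<le> e / 2" if "i \<ge> J" "j \<ge> J" for i j using coef that by blast
    then show "\<exists>J. \<forall>i\<ge>J. \<forall>j\<ge>J. cmod (b i n - b j n) < e" using \<open>e > 0\<close> by (intro exI[of _ J]) force
  qed
  then obtain a where a: "\<And>n. (\<lambda>j. b j n) \<longlonglongrightarrow> a n"
    unfolding Cauchy_convergent_iff convergent_def by metis
  show ?thesis
  proof (intro conjI exI[of _ a] ballI)
    fix s assume s: "s \<in> right_half_plane"
    then have \<sigma>: "Re s > 0" by (simp add: right_half_plane_def)
    obtain C where C: "C \<ge> 0" "\<forall>a N M K s'. (\<forall>n\<ge>N. a n = 0) \<longrightarrow>
     (\<forall>s. Re s > 0 \<longrightarrow> cmod (\<Sum>n<N. a n * of_nat (Suc n) powr (- s)) \<le> M) \<longrightarrow> Re s' = Re s \<longrightarrow>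
     cmod (\<Sum>n<K. a n * of_nat (Suc n) powr (- s')) \<le> C * M"
      using dirichlet_poly_partial_sums_bound[OF \<sigma>] by blast
    have "(\<lambda>K. \<Sum>n<K. a n * of_nat (Suc n) powr (- s)) \<longlonglongrightarrow> D s"
    proof (rule LIMSEQ_I)
      fix r :: real assume r: "r > 0"
      define e where "e = r / (2 * (C + 1))"
      have e: "e > 0" using r C by (simp add: e_def)
      obtain J1 where J1: "\<And>i j s. i \<ge> J1 \<Longrightarrow> j \<ge> J1 \<Longrightarrow> s \<in> right_half_plane \<Longrightarrow> cmod (P i (bohr_point s) - P j (bohr_point s)) \<le> e"
        using near[OF e] by auto
      obtain J2 where J2: "\<And>j. j \<ge> J2 \<Longrightarrow> cmod (P j (bohr_point s) - D s) \<le> e"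
        using lim[OF e] s by (auto simp: eventually_sequentially)
      define j where "j = max J1 J2"
      have "cmod ((\<Sum>n<K. a n * of_nat (Suc n) powr (- s)) - D s) < r" if K: "K \<ge> N j" for K
      proof -
        have "cmod (S i K s - S j K s) \<le> C * e" if i: "i \<ge> J1" for i
          unfolding diffeq[symmetric]
        proof (rule C(2)[rule_format, where N = "max (N i) (N j)"])
          show "cmod (\<Sum>n<max (N i) (N j). (b i n - b j n) * of_nat (Suc n) powr (- s)) \<le> e" if "Re s > 0" for s
            unfolding diffeq using J1[OF i, of j s] that by (simp add: SK j_def right_half_plane_def)
        qed (use bN(2) in auto)
        then have ev: "\<forall>\<^sub>F i in sequentially. cmod (S i K s - S j K s) \<le> C * e"
          by (auto simp: eventually_sequentially)
        have "(\<lambda>i. cmod (S i K s - S j K s)) \<longlonglongrightarrow> cmod ((\<Sum>n<K. a n * of_nat (Suc n) powr (- s)) - S j K s)"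
          unfolding S_def by (intro tendsto_intros a)
        then have "cmod ((\<Sum>n<K. a n * of_nat (Suc n) powr (- s)) - S j K s) \<le> C * e"
          by (rule tendsto_upperbound[OF _ ev]) simp
        moreover have "cmod (S j K s - D s) \<le> e" using J2[of j] K by (simp add: SK j_def)
        ultimately have "cmod ((\<Sum>n<K. a n * of_nat (Suc n) powr (- s)) - D s) \<le> (C + 1) * e"
          using norm_triangle_ineq[of "(\<Sum>n<K. a n * of_nat (Suc n) powr (- s)) - S j K s" "S j K s - D s"]
          by (simp add: distrib_right)
        also have "\<dots> = r / 2" using C(1) unfolding e_def by (simp add: divide_simps)
        finally show ?thesis using r by simp
      qed
      then show "\<exists>no. \<forall>K\<ge>no. cmod ((\<Sum>n<K. a n * of_nat (Suc n) powr (- s)) - D s) < r" by blast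
    qed
    then show "(\<lambda>n. a n / of_nat (Suc n) powr s) sums D s"
      by (simp add: sums_def powr_minus divide_inverse del: of_nat_Suc)
  next
    show "uniformly_continuous_on right_half_plane D"
    proof (rule uniformly_continuous_uniform_approx)
      fix e :: real assume "e > 0"
      from eventually_happens'[OF sequentially_bot lim[OF this]] obtain j
        where "\<forall>s\<in>right_half_plane. cmod (P j (bohr_point s) - D s) \<le> e" by blast
      then show "\<exists>g. uniformly_continuous_on right_half_plane g \<and> (\<forall>x\<in>right_half_plane. dist (g x) (D x) \<le> e)"
        by (intro exI[of _ "\<lambda>s. P j (bohr_point s)"] conjI uniformly_continuous_bohr_poly P) (simp add: dist_norm)
    qed
  qed
qed

section \<open>Density of the Dirichlet polynomials\<close>

text \<open>
  A bounded uniformly continuous function has an affine modulus of continuity, which can be integrated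
  against the first moment of a kernel.
\<close>

lemma uniformly_continuous_linear_modulus:
  fixes D :: "'a::metric_space \<Rightarrow> complex"
  assumes uc: "uniformly_continuous_on S D" and M: "\<And>s. s \<in> S \<Longrightarrow> cmod (D s) \<le> M" and "M \<ge> 0" and e: "e > 0"
  obtains L where "L \<ge> 0" "\<And>s s'. s \<in> S \<Longrightarrow> s' \<in> S \<Longrightarrow> cmod (D s' - D s) \<le> e + L * dist s' s"
proof -
  obtain d where d: "d > 0" "\<And>x y. x \<in> S \<Longrightarrow> y \<in> S \<Longrightarrow> dist y x < d \<Longrightarrow> dist (D y) (D x) < e"
    using uc e unfolding uniformly_continuous_on_def by blast
  show thesis
  proof (rule that[of "2 * M / d"])
    show "0 \<le> 2 * M / d" using d \<open>M \<ge> 0\<close> by simp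
    fix s s' assume s: "s \<in> S" "s' \<in> S"
    show "cmod (D s' - D s) \<le> e + 2 * M / d * dist s' s"
    proof (cases "dist s' s < d")
      case True
      have "0 \<le> 2 * M / d * dist s' s" using d \<open>M \<ge> 0\<close> by simp
      then show ?thesis using d(2)[OF s True] by (simp add: dist_norm)
    next
      case False
      have "cmod (D s' - D s) \<le> 2 * M" using norm_triangle_ineq4[of "D s'" "D s"] M[OF s(1)] M[OF s(2)] by simp
      also have "2 * M = 2 * M / d * d" using d by simp
      also have "\<dots> \<le> 2 * M / d * dist s' s" using False d \<open>M \<ge> 0\<close> by (intro mult_left_mono) auto
      finally show ?thesis using e by simp
    qed
  qed
qed

text \<open>
  Average \<open>D(s + i t / B)\<close> against the band-limited kernel. For large \<open>B\<close> this is close to \<open>D s\<close>,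
  uniformly in \<open>s\<close>. It is a Dirichlet polynomial because the Fourier transform of the kernel removes all terms
  with \<open>ln n \<ge> 2 * B\<close>; the termwise integration is justified by dominated convergence, since by summation
  by parts the partial sums grow at most like \<open>1 + \<bar>t\<bar>\<close> on the vertical line through \<open>s\<close>.
\<close>

lemma dirichlet_algebra_approx:
  assumes D: "D \<in> dirichlet_algebra" and e: "e > 0"
  shows "\<exists>P\<in>bohr_polys. \<forall>s\<in>right_half_plane. cmod (P (bohr_point s) - D s) \<le> e"
proof -
  obtain a where a: "\<And>s. s \<in> right_half_plane \<Longrightarrow> (\<lambda>n. a n / of_nat (Suc n) powr s) sums D s"
    and uc: "uniformly_continuous_on right_half_plane D"
    using D by (auto simp: dirichlet_algebra_def)
  obtain M where "\<And>s. s \<in> right_half_plane \<Longrightarrow> cmod (D s) \<le> M"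
    using bdd_above_dirichlet_algebra[OF D] by (auto simp: bdd_above_def)
  then have M: "\<And>s. s \<in> right_half_plane \<Longrightarrow> cmod (D s) \<le> max M 0" by (simp add: le_max_iff_disj)
  obtain H :: "real \<Rightarrow> real" where H: "\<And>t. 0 \<le> H t" "integrable lborel (\<lambda>t. (1 + \<bar>t\<bar>) * H t)"
    "integrable lborel H" "integral\<^sup>L lborel H = 1"
    "\<And>l. 2 \<le> \<bar>l\<bar> \<Longrightarrow> (LINT t|lborel. H t *\<^sub>R cis (l * t)) = 0"
    by (rule band_limited_kernel) blast
  have [measurable]: "H \<in> borel_measurable borel" using borel_measurable_integrable[OF H(3)] by simp
  define I where "I = (LINT t|lborel. (1 + \<bar>t\<bar>) * H t)"
  have I0: "I \<ge> 0" unfolding I_def by (intro integral_nonneg_AE) (simp add: H(1))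
  obtain L where L: "L \<ge> 0" "\<And>s s'. s \<in> right_half_plane \<Longrightarrow> s' \<in> right_half_plane \<Longrightarrow> cmod (D s' - D s) \<le> e / 2 + L * dist s' s"
    using uniformly_continuous_linear_modulus[OF uc M _ half_gt_zero[OF e]] by auto
  define B where "B = 2 * (L * I + 1) / e"
  have LI: "L * I + 1 > 0" using L(1) I0 by (simp add: add_nonneg_pos)
  then have B: "B > 0" using e by (simp add: B_def)
  have "L / B * I = e / 2 * (L * I / (L * I + 1))" unfolding B_def using LI e by (simp add: field_simps)
  also have "\<dots> \<le> e / 2 * 1" using LI e by (intro mult_left_mono) auto
  finally have B2: "L / B * I \<le> e / 2" by simp
  define h where "h n = (LINT t|lborel. H t *\<^sub>R cis (- ln (real (Suc n)) / B * t))" for n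
  define N where "N = nat \<lceil>exp (2 * B)\<rceil>"
  have h0: "h n = 0" if "n \<ge> N" for n
  proof -
    have "exp (2 * B) \<le> real (Suc n)" using that unfolding N_def by linarith
    then have "2 * B \<le> ln (real (Suc n))" by (subst ln_ge_iff) auto
    then have "2 \<le> \<bar>- ln (real (Suc n)) / B\<bar>" using B by (simp add: abs_divide field_simps)
    then show ?thesis unfolding h_def by (rule H(5))
  qed
  show ?thesis
  proof (intro bexI[of _ "bohr_poly (\<lambda>n. a n * h n) N"] ballI)
    show "bohr_poly (\<lambda>n. a n * h n) N \<in> bohr_polys" unfolding bohr_polys_def by blast
    fix s assume s: "s \<in> right_half_plane"
    define \<sigma> where "\<sigma> = Re s"
    have \<sigma>: "\<sigma> > 0" using s by (simp add: \<sigma>_def right_half_plane_def)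
    define p where "p t = s + \<i> * of_real (t / B)" for t
    have pR: "p t \<in> right_half_plane" for t using s by (simp add: p_def right_half_plane_def)
    have contp: "continuous_on UNIV p" unfolding p_def using B by (auto intro!: continuous_intros)
    have "continuous_on UNIV (\<lambda>t. D (p t))"
      by (rule continuous_on_compose2[OF uniformly_continuous_imp_continuous[OF uc] contp]) (use pR in auto)
    then have mD [measurable]: "(\<lambda>t. D (p t)) \<in> borel_measurable borel" by (rule borel_measurable_continuous_onI)
    define S where "S K t = (\<Sum>n<K. a n * of_nat (Suc n) powr (- p t))" for K t
    have S_cis: "S K t = (\<Sum>n<K. (a n * of_nat (Suc n) powr (- s)) * cis (- ln (real (Suc n)) / B * t))" for K t
      unfolding S_def p_def
      by (simp only: of_nat_powr_minus_add[OF zero_less_Suc] mult.assoc times_divide_eq_left times_divide_eq_right)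
    have mS [measurable]: "S K \<in> borel_measurable borel" for K
      unfolding S_cis[abs_def] by (intro borel_measurable_continuous_onI continuous_intros)
    have lim: "(\<lambda>K. S K t) \<longlonglongrightarrow> D (p t)" for t
      using a[OF pR[of t]] by (simp add: sums_def S_def powr_minus divide_inverse del: of_nat_Suc)
    \<comment> \<open>the partial sums of \<open>u\<close> are bounded because the series converges at \<open>s - \<sigma> / 2\<close>\<close>
    define u where "u n = a n * of_nat (Suc n) powr (- (s - of_real (\<sigma> / 2)))" for n
    have "s - of_real (\<sigma> / 2) \<in> right_half_plane" using \<sigma> by (simp add: right_half_plane_def \<sigma>_def)
    from a[OF this] have "(\<lambda>K. \<Sum>n<K. u n) \<longlonglongrightarrow> D (s - of_real (\<sigma> / 2))"
      unfolding sums_def u_def powr_minus divide_inverse .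
    then have "Bseq (\<lambda>K. \<Sum>n<K. u n)" by (rule convergent_imp_Bseq[OF convergentI])
    then obtain A where A: "A > 0" "\<And>K. cmod (\<Sum>n<K. u n) \<le> A" by (auto simp: Bseq_def)
    have U: "cmod (\<Sum>n<K. u n) \<le> A * real K powr 0" for K
      using A by (cases "K = 0") auto
    define Z where "Z = (\<Sum>n. real (Suc n) powr (0 - \<sigma> / 2 - 1))"
    have "summable (\<lambda>n. real n powr (0 - \<sigma> / 2 - 1))" using \<sigma> by (simp add: summable_real_powr_iff)
    then have "summable (\<lambda>n. real (Suc n) powr (0 - \<sigma> / 2 - 1))" by (subst summable_Suc_iff)
    then have Z: "Z \<ge> 0" unfolding Z_def by (intro suminf_nonneg) auto
    define A' where "A' = A * (1 + (\<sigma> / 2 + 1 / B) * Z)"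
    have A'0: "A' \<ge> 0" using A \<sigma> B Z by (simp add: A'_def)
    have S_bound: "cmod (S K t) \<le> A' * (1 + \<bar>t\<bar>)" for K t
    proof -
      define z where "z = of_real (\<sigma> / 2) + \<i> * of_real (t / B)"
      have z: "Re z = \<sigma> / 2" by (simp add: z_def)
      have "S K t = (\<Sum>n<K. u n * of_nat (Suc n) powr (- z))"
        unfolding S_def u_def mult.assoc powr_add[symmetric] by (simp add: p_def z_def algebra_simps)
      then have "cmod (S K t) \<le> A * (1 + cmod z * Z)"
        using abel_partial_sum_bound[OF U, of z K] \<sigma> by (simp add: z Z_def)
      also have "cmod z \<le> \<sigma> / 2 + \<bar>t\<bar> / B"
        unfolding z_def by (rule order_trans[OF norm_triangle_ineq]) (use \<sigma> B in \<open>simp add: norm_mult norm_divide\<close>)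
      also have "\<dots> \<le> (\<sigma> / 2 + 1 / B) * (1 + \<bar>t\<bar>)" using \<sigma> B by (simp add: field_simps)
      finally have "cmod (S K t) \<le> A * (1 + ((\<sigma> / 2 + 1 / B) * (1 + \<bar>t\<bar>)) * Z)"
        using A Z by (simp add: mult_left_mono mult_right_mono)
      also have "\<dots> \<le> A * ((1 + \<bar>t\<bar>) + ((\<sigma> / 2 + 1 / B) * (1 + \<bar>t\<bar>)) * Z)"
        using A by (intro mult_left_mono) auto
      also have "\<dots> = A' * (1 + \<bar>t\<bar>)" by (simp add: A'_def algebra_simps add_divide_distrib)
      finally show ?thesis .
    qed
    have conv: "(\<lambda>K. LINT t|lborel. H t *\<^sub>R S K t) \<longlonglongrightarrow> (LINT t|lborel. H t *\<^sub>R D (p t))"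
    proof (rule integral_dominated_convergence[where w = "\<lambda>t. A' * ((1 + \<bar>t\<bar>) * H t)"])
      show "integrable lborel (\<lambda>t. A' * ((1 + \<bar>t\<bar>) * H t))" by (intro integrable_mult_right H(2))
      show "AE t in lborel. (\<lambda>K. H t *\<^sub>R S K t) \<longlonglongrightarrow> H t *\<^sub>R D (p t)"
        by (intro AE_I2 tendsto_scaleR tendsto_const lim)
      show "AE t in lborel. norm (H t *\<^sub>R S K t) \<le> A' * ((1 + \<bar>t\<bar>) * H t)" for K
        using mult_left_mono[OF S_bound[of K] H(1)] H(1) by (intro AE_I2) (simp add: mult_ac)
    qed measurable
    have int_S: "(LINT t|lborel. H t *\<^sub>R S K t) = (\<Sum>n<K. (a n * of_nat (Suc n) powr (- s)) * h n)" for K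
      unfolding S_cis h_def by (rule integral_kernel_trig_sum(2)[OF H(3)])
    have "(LINT t|lborel. H t *\<^sub>R S K t) = bohr_poly (\<lambda>n. a n * h n) N (bohr_point s)" if "K \<ge> N" for K
    proof -
      have "(\<Sum>n<K. (a n * of_nat (Suc n) powr (- s)) * h n) = (\<Sum>n<N. (a n * of_nat (Suc n) powr (- s)) * h n)"
        using that h0 by (intro sum.mono_neutral_right) auto
      then show ?thesis unfolding int_S bohr_poly_bohr_point by (simp add: mult_ac)
    qed
    then have "\<forall>\<^sub>F K in sequentially. (LINT t|lborel. H t *\<^sub>R S K t) = bohr_poly (\<lambda>n. a n * h n) N (bohr_point s)"
      unfolding eventually_sequentially by blast
    with conv have "(\<lambda>K. bohr_poly (\<lambda>n. a n * h n) N (bohr_point s)) \<longlonglongrightarrow> (LINT t|lborel. H t *\<^sub>R D (p t))"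
      by (rule Lim_transform_eventually)
    then have eq: "bohr_poly (\<lambda>n. a n * h n) N (bohr_point s) = (LINT t|lborel. H t *\<^sub>R D (p t))"
      by (rule LIMSEQ_unique[OF tendsto_const])
    have iD: "integrable lborel (\<lambda>t. H t *\<^sub>R D (p t))"
    proof (rule Bochner_Integration.integrable_bound[OF integrable_mult_left[OF H(3), of "max M 0"]])
      show "AE t in lborel. norm (H t *\<^sub>R D (p t)) \<le> norm (H t * max M 0)"
        using mult_left_mono[OF M[OF pR] H(1)] H(1) by (intro AE_I2) (simp add: abs_mult)
    qed measurable
    have iDs: "integrable lborel (\<lambda>t. H t *\<^sub>R D s)" using H(3) by simp
    have "D s = (LINT t|lborel. H t *\<^sub>R D s)" using H(3,4) by simp
    then have "bohr_poly (\<lambda>n. a n * h n) N (bohr_point s) - D s = (LINT t|lborel. H t *\<^sub>R D (p t) - H t *\<^sub>R D s)"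
      unfolding eq by (subst Bochner_Integration.integral_diff[OF iD iDs]) simp
    then have "cmod (bohr_poly (\<lambda>n. a n * h n) N (bohr_point s) - D s) \<le> (LINT t|lborel. cmod (H t *\<^sub>R D (p t) - H t *\<^sub>R D s))"
      by simp
    also have "\<dots> \<le> (LINT t|lborel. e / 2 * H t + L / B * ((1 + \<bar>t\<bar>) * H t))"
    proof (rule integral_mono)
      fix t
      have "cmod (H t *\<^sub>R D (p t) - H t *\<^sub>R D s) = H t * cmod (D (p t) - D s)"
        using H(1) by (simp flip: scaleR_diff_right)
      also have "\<dots> \<le> H t * (e / 2 + L * dist (p t) s)"
        using L(2)[OF s pR] H(1) by (intro mult_left_mono) auto
      also have "dist (p t) s = \<bar>t\<bar> / B" using B by (simp add: p_def dist_norm norm_mult norm_divide)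
      also have "H t * (e / 2 + L * (\<bar>t\<bar> / B)) \<le> H t * (e / 2 + L / B * (1 + \<bar>t\<bar>))"
        using L(1) B H(1) by (intro mult_left_mono add_left_mono) (auto simp: field_simps)
      finally show "cmod (H t *\<^sub>R D (p t) - H t *\<^sub>R D s) \<le> e / 2 * H t + L / B * ((1 + \<bar>t\<bar>) * H t)"
        by (simp add: algebra_simps)
    qed (intro integrable_norm Bochner_Integration.integrable_diff iD iDs Bochner_Integration.integrable_add integrable_mult_right H(2,3))+
    also have "\<dots> = e / 2 + L / B * I" unfolding I_def using H(2,3,4) by simp
    also have "\<dots> \<le> e" using B2 by linarith
    finally show "cmod (bohr_poly (\<lambda>n. a n * h n) N (bohr_point s) - D s) \<le> e" .
  qed
qed

section \<open>Polynomial approximation on a polydisc\<close>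

text \<open>
  Cauchy's inequalities on the circle of radius \<open>\<rho>\<close> and a geometric series.
\<close>

lemma taylor_tail_bound:
  assumes hol: "g holomorphic_on ball 0 R" and M: "\<And>z. cmod z < R \<Longrightarrow> cmod (g z) \<le> M"
    and r: "0 \<le> r" "r < \<rho>" "\<rho> < R" and z: "cmod z \<le> r"
  shows "cmod (g z - (\<Sum>n<N. (deriv ^^ n) g 0 / fact n * z ^ n)) \<le> M * (r / \<rho>) ^ N / (1 - r / \<rho>)"
proof -
  define c where "c n = (deriv ^^ n) g 0 / fact n" for n
  define x where "x = r / \<rho>"
  have x: "0 \<le> x" "x < 1" using r by (auto simp: x_def)
  have M0: "M \<ge> 0" using order_trans[OF norm_ge_zero M[of 0]] r by simp
  have sub: "cball 0 \<rho> \<subseteq> ball 0 R" using r by auto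
  have c: "cmod (c n) \<le> M / \<rho> ^ n" for n
  proof -
    have "cmod ((deriv ^^ n) g 0) \<le> fact n * M / \<rho> ^ n"
    proof (rule Cauchy_inequality)
      show "g holomorphic_on ball 0 \<rho>" using hol r by (rule_tac holomorphic_on_subset) auto
      show "continuous_on (cball 0 \<rho>) g"
        by (rule continuous_on_subset[OF holomorphic_on_imp_continuous_on[OF hol] sub])
      show "cmod (g w) \<le> M" if "cmod (0 - w) = \<rho>" for w using that r by (intro M) simp
    qed (use r in auto)
    then show ?thesis by (simp add: c_def norm_divide field_simps)
  qed
  have sums: "(\<lambda>n. c n * z ^ n) sums g z"
    using holomorphic_power_series[OF hol, of z] z r by (simp add: c_def)
  have each: "cmod (c (n + N) * z ^ (n + N)) \<le> M * x ^ N * x ^ n" for n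
  proof -
    have "cmod (c (n + N) * z ^ (n + N)) \<le> (M / \<rho> ^ (n + N)) * r ^ (n + N)"
      unfolding norm_mult norm_power using M0 r z by (intro mult_mono c power_mono) auto
    also have "\<dots> = M * x ^ N * x ^ n" by (simp add: x_def power_divide power_add mult_ac)
    finally show ?thesis .
  qed
  have geo: "(\<lambda>n. M * x ^ N * x ^ n) sums (M * x ^ N * (1 / (1 - x)))"
    using x by (intro sums_mult geometric_sums) auto
  have "g z - (\<Sum>n<N. c n * z ^ n) = (\<Sum>n. c (n + N) * z ^ (n + N))"
    using suminf_minus_initial_segment[of "\<lambda>n. c n * z ^ n" N] sums by (simp add: sums_iff)
  also have "cmod \<dots> \<le> (\<Sum>n. M * x ^ N * x ^ n)"
    using geo by (intro norm_suminf_le each) (simp add: sums_iff)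
  also have "\<dots> = M * x ^ N / (1 - x)" using geo by (simp add: sums_iff)
  finally show ?thesis by (simp add: c_def x_def)
qed

definition unity_root :: "nat \<Rightarrow> complex" where
  "unity_root q = exp (2 * of_real pi * \<i> / of_nat q)"

text \<open>
  The polynomial of degree less than \<open>q\<close> that interpolates \<open>g\<close> at the \<open>q\<close>-th roots of unity. Its coefficients are
  finite linear combinations of values of \<open>g\<close>; so, if \<open>g\<close> depends holomorphically on further variables, the same
  holds for the coefficients. This is the advantage over Taylor coefficients. In the exponents,
  \<open>q - a\<close> stands for \<open>-a\<close>.
\<close>

definition root_interpolation :: "nat \<Rightarrow> (complex \<Rightarrow> complex) \<Rightarrow> complex \<Rightarrow> complex" where
  "root_interpolation q g z =
     (\<Sum>a<q. z ^ a * ((\<Sum>j<q. unity_root q ^ (j * (q - a)) * g (unity_root q ^ j)) / of_nat q))"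

lemma norm_unity_root: "cmod (unity_root q) = 1"
  by (simp add: unity_root_def)

lemma unity_root_power: "unity_root q ^ j = exp (2 * of_real pi * \<i> * of_nat j / of_nat q)"
  unfolding unity_root_def exp_of_nat_mult[symmetric] by (simp add: mult_ac)

lemma unity_root_power_eq_1_iff: "q \<ge> 1 \<Longrightarrow> unity_root q ^ j = 1 \<longleftrightarrow> q dvd j"
  unfolding unity_root_power by (rule complex_root_unity_eq_1)

lemma sum_unity_root_powers:
  assumes q: "q \<ge> 1"
  shows "(\<Sum>j<q. unity_root q ^ (j * l)) = (if q dvd l then of_nat q else 0)"
proof -
  define w where "w = unity_root q ^ l"
  have "w ^ q = unity_root q ^ (q * l)" by (simp add: w_def mult.commute flip: power_mult)
  also have "\<dots> = 1" using q by (subst unity_root_power_eq_1_iff) auto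
  finally have wq: "w ^ q = 1" .
  have "(\<Sum>j<q. unity_root q ^ (j * l)) = (\<Sum>j<q. w ^ j)"
    by (simp add: w_def mult.commute flip: power_mult)
  also have "\<dots> = (if q dvd l then of_nat q else 0)"
  proof (cases "q dvd l")
    case True
    then have "w = 1" unfolding w_def using q by (simp add: unity_root_power_eq_1_iff)
    then show ?thesis using True by simp
  next
    case False
    then have "w \<noteq> 1" unfolding w_def using q by (simp add: unity_root_power_eq_1_iff)
    then show ?thesis using False wq by (simp add: geometric_sum)
  qed
  finally show ?thesis .
qed

lemma root_interpolation_monomial:
  assumes "b < q" shows "root_interpolation q (\<lambda>w. w ^ b) z = z ^ b"
proof -
  have "(\<Sum>j<q. unity_root q ^ (j * (q - a)) * (unity_root q ^ j) ^ b) = (if a = b then of_nat q else 0)" if "a < q" for a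
  proof -
    have "(\<Sum>j<q. unity_root q ^ (j * (q - a)) * (unity_root q ^ j) ^ b) = (\<Sum>j<q. unity_root q ^ (j * (q - a + b)))"
      by (simp add: power_add distrib_left flip: power_mult)
    moreover have "q dvd q - a + b \<longleftrightarrow> a = b"
    proof
      assume dvd: "q dvd q - a + b"
      then obtain c where c: "q - a + b = q * c" ..
      \<comment> \<open>\<open>0 < q - a + b < 2 * q\<close>, so the only possible quotient is 1\<close>
      have "q * c < q * 2" using c assms that by linarith
      then have "c < 2" by simp
      moreover have "c \<noteq> 0"
      proof
        assume "c = 0"
        then have "q - a + b = 0" using c by simp
        then show False using that by simp
      qed
      ultimately have "c = 1" by simp
      then show "a = b" using c that by simp
    qed (use that in simp)
    ultimately show ?thesis using sum_unity_root_powers[of q "q - a + b"] that by simp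
  qed
  then have "root_interpolation q (\<lambda>w. w ^ b) z = (\<Sum>a<q. if a = b then z ^ a else 0)"
    unfolding root_interpolation_def by (intro sum.cong refl) auto
  then show ?thesis using assms by simp
qed

lemma root_interpolation_diff:
  "root_interpolation q (\<lambda>w. f w - g w) z = root_interpolation q f z - root_interpolation q g z"
  unfolding root_interpolation_def by (simp add: right_diff_distrib sum_subtractf diff_divide_distrib)

lemma root_interpolation_poly:
  "root_interpolation q (\<lambda>w. \<Sum>b<q. c b * w ^ b) z = (\<Sum>b<q. c b * z ^ b)"
proof -
  have "root_interpolation q (\<lambda>w. \<Sum>b<q. c b * w ^ b) z
     = (\<Sum>a<q. \<Sum>b<q. c b * (z ^ a * ((\<Sum>j<q. unity_root q ^ (j * (q - a)) * (unity_root q ^ j) ^ b) / of_nat q)))"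
    unfolding root_interpolation_def
  proof (rule sum.cong[OF refl])
    fix a
    have "(\<Sum>j<q. unity_root q ^ (j * (q - a)) * (\<Sum>b<q. c b * (unity_root q ^ j) ^ b))
        = (\<Sum>b<q. \<Sum>j<q. unity_root q ^ (j * (q - a)) * (c b * (unity_root q ^ j) ^ b))"
      unfolding sum_distrib_left by (rule sum.swap)
    also have "\<dots> = (\<Sum>b<q. c b * (\<Sum>j<q. unity_root q ^ (j * (q - a)) * (unity_root q ^ j) ^ b))"
      unfolding sum_distrib_left by (simp add: mult.left_commute)
    finally show "z ^ a * ((\<Sum>j<q. unity_root q ^ (j * (q - a)) * (\<Sum>b<q. c b * (unity_root q ^ j) ^ b)) / of_nat q)
      = (\<Sum>b<q. c b * (z ^ a * ((\<Sum>j<q. unity_root q ^ (j * (q - a)) * (unity_root q ^ j) ^ b) / of_nat q)))"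
      by (simp only: sum_divide_distrib sum_distrib_left) (simp add: mult_ac)
  qed
  also have "\<dots> = (\<Sum>b<q. c b * root_interpolation q (\<lambda>w. w ^ b) z)"
    unfolding root_interpolation_def sum_distrib_left[of "c _"] by (rule sum.swap)
  also have "\<dots> = (\<Sum>b<q. c b * z ^ b)" by (simp add: root_interpolation_monomial)
  finally show ?thesis .
qed

lemma norm_root_average_le:
  assumes "\<And>w. cmod w = 1 \<Longrightarrow> cmod (g w) \<le> M" and "q \<ge> 1"
  shows "cmod ((\<Sum>j<q. unity_root q ^ (j * l) * g (unity_root q ^ j)) / of_nat q) \<le> M"
proof -
  have "cmod (\<Sum>j<q. unity_root q ^ (j * l) * g (unity_root q ^ j)) \<le> (\<Sum>j<q. M)"
    by (rule sum_norm_le) (simp add: norm_mult norm_power norm_unity_root assms(1))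
  then show ?thesis using assms(2) by (simp add: norm_divide field_simps)
qed

lemma norm_root_interpolation_le:
  assumes "\<And>w. cmod w = 1 \<Longrightarrow> cmod (g w) \<le> M" and "q \<ge> 1" "cmod z \<le> 1"
  shows "cmod (root_interpolation q g z) \<le> real q * M"
proof -
  have "cmod (root_interpolation q g z) \<le> (\<Sum>a<q. 1 * M)"
    unfolding root_interpolation_def
  proof (rule sum_norm_le)
    fix a
    show "cmod (z ^ a * ((\<Sum>j<q. unity_root q ^ (j * (q - a)) * g (unity_root q ^ j)) / of_nat q)) \<le> 1 * M"
      unfolding norm_mult norm_power
      using assms by (intro mult_mono norm_root_average_le power_le_one) auto
  qed
  then show ?thesis by simp
qed

text \<open>
  Interpolation reproduces the Taylor polynomial of degree less than \<open>q\<close> and increases the exponentially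
  small remainder by at most the factor \<open>q\<close>. The number \<open>q\<close> depends on \<open>g\<close> only through \<open>M\<close> and \<open>R\<close>.
\<close>

lemma root_interpolation_approx:
  assumes R: "R > 1" and e: "e > 0"
  shows "\<exists>q\<ge>1. \<forall>g z. g holomorphic_on ball 0 R \<longrightarrow> (\<forall>z. cmod z < R \<longrightarrow> cmod (g z) \<le> M) \<longrightarrow> cmod z \<le> 1
      \<longrightarrow> cmod (g z - root_interpolation q g z) \<le> e"
proof -
  define \<rho> where "\<rho> = (1 + R) / 2"
  have \<rho>: "1 < \<rho>" "\<rho> < R" using R by (auto simp: \<rho>_def)
  define E where "E q = M * (1 / \<rho>) ^ q / (1 - 1 / \<rho>)" for q
  have x: "norm (1 / \<rho>) < 1" using \<rho> by simp
  have "(\<lambda>q. (1 / \<rho>) ^ q + real q * (1 / \<rho>) ^ q) \<longlonglongrightarrow> 0 + 0"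
    by (intro tendsto_add powser_times_n_limit_0 x LIMSEQ_power_zero)
  then have "(\<lambda>q. M / (1 - 1 / \<rho>) * ((1 / \<rho>) ^ q + real q * (1 / \<rho>) ^ q)) \<longlonglongrightarrow> M / (1 - 1 / \<rho>) * (0 + 0)"
    by (intro tendsto_mult tendsto_const)
  then have "(\<lambda>q. (1 + real q) * E q) \<longlonglongrightarrow> 0" by (simp add: E_def algebra_simps add_divide_distrib)
  then have "\<forall>\<^sub>F q in sequentially. (1 + real q) * E q < e" using e by (rule order_tendstoD)
  then obtain q0 where q0: "\<And>q. q \<ge> q0 \<Longrightarrow> (1 + real q) * E q < e" by (auto simp: eventually_sequentially)
  define q where "q = Suc q0"
  show ?thesis
  proof (intro exI[of _ q] conjI allI impI)
    show "q \<ge> 1" by (simp add: q_def)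
    fix g z assume g: "g holomorphic_on ball 0 R" and gM: "\<forall>z. cmod z < R \<longrightarrow> cmod (g z) \<le> M" and z: "cmod z \<le> 1"
    define T where "T w = (\<Sum>n<q. (deriv ^^ n) g 0 / fact n * w ^ n)" for w
    have tail: "cmod (g w - T w) \<le> E q" if "cmod w \<le> 1" for w
      using taylor_tail_bound[OF g gM[rule_format], of 1 \<rho> w q] \<rho> that by (simp add: T_def E_def)
    have "root_interpolation q T z = T z" unfolding T_def by (rule root_interpolation_poly)
    then have "g z - root_interpolation q g z = (g z - T z) - root_interpolation q (\<lambda>w. g w - T w) z"
      by (simp add: root_interpolation_diff)
    also have "cmod \<dots> \<le> E q + real q * E q"
      by (rule order_trans[OF norm_triangle_ineq4])
         (intro add_mono tail norm_root_interpolation_le z; simp add: tail q_def)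
    also have "\<dots> \<le> e" using q0[of q] by (simp add: q_def distrib_right)
    finally show "cmod (g z - root_interpolation q g z) \<le> e" .
  qed
qed

text \<open>
  Induction on the number of variables: interpolate in the last one and apply the induction hypothesis to the
  coefficients, which are averages of \<open>h\<close> and inherit its bound \<open>M\<close>.
\<close>

lemma polydisc_approx:
  assumes R: "R > 1"
    and dep: "\<And>t t'. (\<And>k. k < m \<Longrightarrow> t k = t' k) \<Longrightarrow> h t = h t'"
    and hol: "\<And>t k. (\<And>i. cmod (t i) < R) \<Longrightarrow> k < m \<Longrightarrow> (\<lambda>z. h (t(k := z))) holomorphic_on ball 0 R"
    and bnd: "\<And>t. (\<And>i. cmod (t i) < R) \<Longrightarrow> cmod (h t) \<le> M"
    and e: "e > 0"
  shows "\<exists>P\<in>bohr_polys. \<forall>t. (\<forall>k. cmod (t k) \<le> 1) \<longrightarrow> cmod (h t - P t) \<le> e"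
  using dep hol bnd e
proof (induction m arbitrary: h e)
  case 0
  show ?case
  proof (intro bexI allI impI)
    show "(\<lambda>_. h (\<lambda>_. 0)) \<in> bohr_polys" by (rule bohr_polys_const)
    show "cmod (h t - h (\<lambda>_. 0)) \<le> e" for t using 0(1)[of t "\<lambda>_. 0"] 0(4) by simp
  qed
next
  case (Suc m)
  obtain q where q: "q \<ge> 1" "\<forall>g z. g holomorphic_on ball 0 R \<longrightarrow> (\<forall>z. cmod z < R \<longrightarrow> cmod (g z) \<le> M) \<longrightarrow> cmod z \<le> 1
      \<longrightarrow> cmod (g z - root_interpolation q g z) \<le> e / 2"
    using root_interpolation_approx[OF R half_gt_zero[OF Suc.prems(4)], of M] by blast
  define C where "C a t = (\<Sum>j<q. unity_root q ^ (j * (q - a)) * h (t(m := unity_root q ^ j))) / of_nat q" for a t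
  have uR: "cmod (unity_root q ^ j) < R" for j using R by (simp add: norm_power norm_unity_root)
  have "\<exists>P\<in>bohr_polys. \<forall>t. (\<forall>k. cmod (t k) \<le> 1) \<longrightarrow> cmod (C a t - P t) \<le> e / (2 * real q)" for a
  proof (rule Suc.IH)
    show "C a t = C a t'" if "\<And>k. k < m \<Longrightarrow> t k = t' k" for t t'
      unfolding C_def by (intro arg_cong2[where f = "(/)"] sum.cong refl arg_cong2[where f = "(*)"] Suc.prems(1))
         (auto simp: that less_Suc_eq)
    show "(\<lambda>z. C a (t(k := z))) holomorphic_on ball 0 R" if t: "\<And>i. cmod (t i) < R" and k: "k < m" for t k
      unfolding C_def
    proof (intro holomorphic_intros)
      fix j
      have "(\<lambda>z. h ((t(m := unity_root q ^ j))(k := z))) holomorphic_on ball 0 R"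
        using t uR k by (intro Suc.prems(2)) auto
      moreover have "(t(m := unity_root q ^ j))(k := z) = (t(k := z))(m := unity_root q ^ j)" for z
        using k by (simp add: fun_upd_twist)
      ultimately show "(\<lambda>z. h ((t(k := z))(m := unity_root q ^ j))) holomorphic_on ball 0 R" by simp
    qed (use q in auto)
    show "cmod (C a t) \<le> M" if t: "\<And>i. cmod (t i) < R" for t
      unfolding C_def
    proof (rule norm_root_average_le[where g = "\<lambda>w. h (t(m := w))"])
      show "cmod (h (t(m := w))) \<le> M" if "cmod w = 1" for w
        using t that R by (intro Suc.prems(3)) auto
    qed (rule q)
    show "e / (2 * real q) > 0" using Suc.prems(4) q by simp
  qed
  then obtain P where P: "\<And>a. P a \<in> bohr_polys" "\<And>a t. (\<forall>k. cmod (t k) \<le> 1) \<Longrightarrow> cmod (C a t - P a t) \<le> e / (2 * real q)"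
    by metis
  show ?case
  proof (intro bexI allI impI)
    show "(\<lambda>t. \<Sum>a<q. t m ^ a * P a t) \<in> bohr_polys"
      by (intro bohr_polys_sum bohr_polys_mult bohr_polys_power bohr_polys_coord P(1))
    fix t :: "nat \<Rightarrow> complex" assume t: "\<forall>k. cmod (t k) \<le> 1"
    have tR: "cmod (t i) < R" for i using t R by (meson le_less_trans)
    have "cmod (h (t(m := t m)) - root_interpolation q (\<lambda>z. h (t(m := z))) (t m)) \<le> e / 2"
    proof (rule q(2)[rule_format])
      show "(\<lambda>z. h (t(m := z))) holomorphic_on ball 0 R" using tR by (intro Suc.prems(2)) auto
      show "cmod (h (t(m := z))) \<le> M" if "cmod z < R" for z using tR that by (intro Suc.prems(3)) auto
    qed (use t in auto)
    moreover have "root_interpolation q (\<lambda>z. h (t(m := z))) (t m) = (\<Sum>a<q. t m ^ a * C a t)"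
      by (simp add: root_interpolation_def C_def)
    ultimately have 1: "cmod (h t - (\<Sum>a<q. t m ^ a * C a t)) \<le> e / 2" by simp
    have "cmod ((\<Sum>a<q. t m ^ a * C a t) - (\<Sum>a<q. t m ^ a * P a t)) = cmod (\<Sum>a<q. t m ^ a * (C a t - P a t))"
      by (simp add: right_diff_distrib sum_subtractf)
    also have "\<dots> \<le> (\<Sum>a<q. 1 * (e / (2 * real q)))"
    proof (rule sum_norm_le)
      show "cmod (t m ^ a * (C a t - P a t)) \<le> 1 * (e / (2 * real q))" for a
        unfolding norm_mult norm_power using t by (intro mult_mono P(2) power_le_one) auto
    qed
    also have "\<dots> = e / 2" using q(1) by simp
    finally show "cmod (h t - (\<Sum>a<q. t m ^ a * P a t)) \<le> e"
      using norm_triangle_ineq[of "h t - (\<Sum>a<q. t m ^ a * C a t)" "(\<Sum>a<q. t m ^ a * C a t) - (\<Sum>a<q. t m ^ a * P a t)"] 1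
      by simp
  qed
qed

section \<open>Holomorphic functions under disjoint perturbations\<close>

lemma eq_prime_power_multiplicity:
  fixes n q :: nat
  assumes n: "n > 0" and q: "prime q" and only: "\<And>r. prime r \<Longrightarrow> r dvd n \<Longrightarrow> r = q"
  shows "n = q ^ multiplicity q n"
proof -
  define l where "l = n div q ^ multiplicity q n"
  have nl: "n = q ^ multiplicity q n * l" unfolding l_def by (simp add: multiplicity_dvd)
  have "\<not> q dvd l" unfolding l_def using n q by (intro multiplicity_decompose) auto
  moreover have "r = q" if "prime r" "r dvd l" for r using only[OF that(1)] that(2) nl by (metis dvd_mult)
  ultimately have "l = 1" using prime_factor_nat[of l] by blast
  then show ?thesis using nl by simp
qed

text \<open>
  The increment of the polynomial along the \<open>k\<close>-th axis involves only the coefficients of the powers of the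
  \<open>k\<close>-th prime. These sets of coefficients are disjoint for different \<open>k\<close>, and the sum of the squares of all coefficients
  is at most \<open>M\<^sup>2\<close>. The point \<open>1/2\<close> on the axis makes the sums over powers of one prime converge.
\<close>

lemma bohr_poly_axis_square_sum:
  assumes M: "\<And>s. Re s > 0 \<Longrightarrow> cmod (bohr_poly a N (bohr_point s)) \<le> M"
  shows "(\<Sum>k<m. (cmod (bohr_poly a N ((\<lambda>_. 0)(k := 1 / 2)) - bohr_poly a N (\<lambda>_. 0)))\<^sup>2) \<le> M\<^sup>2"
proof -
  define E where "E k = {n. n < N \<and> (\<exists>e\<ge>1. Suc n = nth_prime k ^ e)}" for k
  have finE: "finite (E k)" for k by (rule finite_subset[of _ "{..<N}"]) (auto simp: E_def)
  define x where "x k = (\<lambda>_. 0 :: complex)(k := 1 / 2)" for k :: nat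
  have diff: "bohr_poly a N (x k) - bohr_poly a N (\<lambda>_. 0) = (\<Sum>n\<in>E k. a n * bohr_monomial (Suc n) (x k))" for k
  proof -
    have out: "bohr_monomial (Suc n) (x k) = bohr_monomial (Suc n) (\<lambda>_. 0)" if "n < N" "n \<notin> E k" for n
    proof (cases "\<forall>r. prime r \<longrightarrow> r dvd Suc n \<longrightarrow> r = nth_prime k")
      case True
      then have eq: "Suc n = nth_prime k ^ multiplicity (nth_prime k) (Suc n)"
        by (intro eq_prime_power_multiplicity prime_nth_prime) auto
      then have "multiplicity (nth_prime k) (Suc n) = 0" using that by (auto simp: E_def not_le Suc_le_eq)
      then have "Suc n = 1" using eq by simp
      then show ?thesis by simp
    next
      case False
      then obtain r where r: "prime r" "r dvd Suc n" "r \<noteq> nth_prime k" by blast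
      then have "prime_index r \<noteq> k" by (metis nth_prime_prime_index)
      then show ?thesis using r by (simp add: bohr_monomial_eq_0[of _ r] x_def)
    qed
    have inside: "bohr_monomial (Suc n) (\<lambda>_. 0) = 0" if nE: "n \<in> E k" for n
    proof -
      obtain e where e: "e \<ge> 1" "Suc n = nth_prime k ^ e" using nE by (auto simp: E_def)
      then have "nth_prime k dvd Suc n" by (metis dvd_power One_nat_def Suc_le_eq)
      then show ?thesis using prime_nth_prime by (intro bohr_monomial_eq_0) auto
    qed
    have "bohr_poly a N (x k) - bohr_poly a N (\<lambda>_. 0)
        = (\<Sum>n<N. a n * (bohr_monomial (Suc n) (x k) - bohr_monomial (Suc n) (\<lambda>_. 0)))"
      by (simp add: bohr_poly_def sum_subtractf right_diff_distrib)
    also have "\<dots> = (\<Sum>n\<in>E k. a n * (bohr_monomial (Suc n) (x k) - bohr_monomial (Suc n) (\<lambda>_. 0)))"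
      using out by (intro sum.mono_neutral_right) (auto simp: E_def)
    finally show ?thesis using inside by simp
  qed
  have geo: "(\<Sum>n\<in>E k. (cmod (bohr_monomial (Suc n) (x k)))\<^sup>2) \<le> 1" for k
  proof -
    define ex where "ex n = multiplicity (nth_prime k) (Suc n) - 1" for n
    have exn: "Suc n = nth_prime k ^ Suc (ex n)" if nE: "n \<in> E k" for n
    proof -
      obtain e where e: "e \<ge> 1" "Suc n = nth_prime k ^ e" using nE by (auto simp: E_def)
      then show ?thesis using prime_nth_prime[of k] by (simp add: ex_def)
    qed
    have inj: "inj_on ex (E k)"
    proof (rule inj_onI)
      fix n l assume "n \<in> E k" "l \<in> E k" "ex n = ex l"
      then have "Suc n = Suc l" using exn by metis
      then show "n = l" by simp
    qed
    have "(cmod (bohr_monomial (Suc n) (x k)))\<^sup>2 = 1/4 * (1/4) ^ ex n" if "n \<in> E k" for n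
    proof -
      have "bohr_monomial (Suc n) (x k) = (1 / 2) ^ Suc (ex n)"
        using exn[OF that] bohr_monomial_prime_power[of k "Suc (ex n)" "x k"] by (simp add: x_def)
      then have "cmod (bohr_monomial (Suc n) (x k)) = (1 / 2) ^ Suc (ex n)" by (simp only: norm_power) simp
      then have "(cmod (bohr_monomial (Suc n) (x k)))\<^sup>2 = ((1 / 2)\<^sup>2) ^ Suc (ex n)"
        by (simp only: power_mult[symmetric] mult.commute)
      then show ?thesis by (simp add: power2_eq_square)
    qed
    then have "(\<Sum>n\<in>E k. (cmod (bohr_monomial (Suc n) (x k)))\<^sup>2) = (\<Sum>n\<in>E k. 1/4 * (1/4) ^ ex n)"
      by (rule sum.cong[OF refl])
    also have "\<dots> = 1/4 * (\<Sum>e\<in>ex ` E k. (1/4) ^ e)"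
      by (simp add: sum.reindex[OF inj] sum_distrib_left)
    also have "(\<Sum>e\<in>ex ` E k. (1/4) ^ e) \<le> (\<Sum>e. (1/4::real) ^ e)"
      using finE by (intro sum_le_suminf summable_geometric) auto
    also have "(\<Sum>e. (1/4::real) ^ e) = 4/3" by (subst suminf_geometric) auto
    finally show ?thesis by simp
  qed
  have each: "(cmod (bohr_poly a N (x k) - bohr_poly a N (\<lambda>_. 0)))\<^sup>2 \<le> (\<Sum>n\<in>E k. (cmod (a n))\<^sup>2)" for k
  proof -
    have "cmod (bohr_poly a N (x k) - bohr_poly a N (\<lambda>_. 0)) \<le> (\<Sum>n\<in>E k. \<bar>cmod (a n)\<bar> * \<bar>cmod (bohr_monomial (Suc n) (x k))\<bar>)"
      unfolding diff by (rule order_trans[OF norm_sum]) (simp add: norm_mult)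
    also have "\<dots> \<le> L2_set (\<lambda>n. cmod (a n)) (E k) * L2_set (\<lambda>n. cmod (bohr_monomial (Suc n) (x k))) (E k)"
      by (rule L2_set_mult_ineq)
    also have "\<dots> \<le> L2_set (\<lambda>n. cmod (a n)) (E k) * 1"
      using geo[of k] by (intro mult_left_mono L2_set_nonneg) (simp add: L2_set_def)
    finally have "(cmod (bohr_poly a N (x k) - bohr_poly a N (\<lambda>_. 0)))\<^sup>2 \<le> (L2_set (\<lambda>n. cmod (a n)) (E k))\<^sup>2"
      by (intro power_mono) auto
    then show ?thesis by (simp add: L2_set_def sum_nonneg)
  qed
  have disj: "E k \<inter> E l = {}" if "k \<noteq> l" for k l
  proof (rule ccontr)
    assume "E k \<inter> E l \<noteq> {}"
    then obtain n e e' where "e \<ge> 1" "Suc n = nth_prime k ^ e" "Suc n = nth_prime l ^ e'" by (auto simp: E_def)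
    then have "nth_prime k dvd nth_prime l ^ e'" by (metis dvd_power One_nat_def Suc_le_eq)
    then have "nth_prime k dvd nth_prime l" using prime_nth_prime prime_dvd_power by blast
    then have "nth_prime k = nth_prime l" using prime_nth_prime primes_dvd_imp_eq by blast
    then show False using that by (metis prime_index_nth_prime)
  qed
  have "(\<Sum>k<m. (cmod (bohr_poly a N (x k) - bohr_poly a N (\<lambda>_. 0)))\<^sup>2) \<le> (\<Sum>k<m. \<Sum>n\<in>E k. (cmod (a n))\<^sup>2)"
    by (intro sum_mono each)
  also have "\<dots> = (\<Sum>n\<in>(\<Union>k<m. E k). (cmod (a n))\<^sup>2)"
    using finE disj by (subst sum.UNION_disjoint) auto
  also have "\<dots> \<le> (\<Sum>n<N. (cmod (a n))\<^sup>2)"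
    by (intro sum_mono2) (auto simp: E_def)
  also have "\<dots> \<le> M\<^sup>2"
    by (rule dirichlet_poly_parseval) (use M in \<open>simp add: bohr_poly_bohr_point del: of_nat_Suc\<close>)
  finally show ?thesis by (simp add: x_def)
qed

lemmas c0_nth_simps = zero_c0.rep_eq plus_c0.rep_eq minus_c0.rep_eq uminus_c0.rep_eq scaleR_c0.rep_eq scaleC_c0.rep_eq

lemma c0_nth_sum: "c0_nth (\<Sum>j\<in>A. x j) i = (\<Sum>j\<in>A. c0_nth (x j) i)"
  by (induction A rule: infinite_finite_induct) (auto simp: c0_nth_simps)

lemma norm_scaleC_c0_le: "norm (scaleC_c0 z x) \<le> cmod z * norm x"
  by (rule norm_c0_least) (simp add: c0_nth_simps norm_mult mult_left_mono norm_c0_nth_le)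

lemma scaleC_c0_0: "scaleC_c0 0 x = 0"
  by (rule c0_eqI) (simp add: c0_nth_simps)

lemma bounded_linear_scaleC_c0: "bounded_linear (\<lambda>z. scaleC_c0 z h)"
proof (rule bounded_linear_intro[where K = "norm h"])
  show "norm (scaleC_c0 z h) \<le> cmod z * norm h" for z by (rule norm_scaleC_c0_le)
qed (rule c0_eqI, simp add: c0_nth_simps algebra_simps)+

lemma complex_frechet_line_derivative:
  assumes L: "(f has_derivative L) (at (x + scaleC_c0 z h))" "\<And>c h. L (scaleC_c0 c h) = c * L h"
  shows "((\<lambda>z. f (x + scaleC_c0 z h)) has_field_derivative L h) (at z)"
proof -
  have "((\<lambda>z. x + scaleC_c0 z h) has_derivative (\<lambda>w. 0 + scaleC_c0 w h)) (at z)"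
    by (intro has_derivative_add has_derivative_const bounded_linear_imp_has_derivative bounded_linear_scaleC_c0)
  then have "((\<lambda>z. f (x + scaleC_c0 z h)) has_derivative (\<lambda>w. L (0 + scaleC_c0 w h))) (at z)"
    by (rule has_derivative_compose) (rule L(1))
  then show ?thesis
    unfolding has_field_derivative_def by (rule has_derivative_eq_rhs) (simp add: fun_eq_iff L(2))
qed

lemma complex_frechet_holomorphic_on_line:
  assumes "\<And>z. z \<in> S \<Longrightarrow> complex_frechet_differentiable f (x + scaleC_c0 z h)"
  shows "(\<lambda>z. f (x + scaleC_c0 z h)) holomorphic_on S"
  unfolding holomorphic_on_def field_differentiable_def
proof (intro ballI)
  fix z assume "z \<in> S"
  from assms[OF this] obtain L
    where L: "(f has_derivative L) (at (x + scaleC_c0 z h))" "\<And>c h. L (scaleC_c0 c h) = c * L h"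
    unfolding complex_frechet_differentiable_def by blast
  from complex_frechet_line_derivative[OF L]
  show "\<exists>f'. ((\<lambda>z. f (x + scaleC_c0 z h)) has_field_derivative f') (at z within S)"
    using has_field_derivative_at_within by blast
qed

lemma ball_algebra_holomorphic_on_line:
  assumes f: "f \<in> ball_algebra" and S: "\<And>z. z \<in> S \<Longrightarrow> norm (x + scaleC_c0 z h) < 1"
  shows "(\<lambda>z. f (x + scaleC_c0 z h)) holomorphic_on S"
  by (rule complex_frechet_holomorphic_on_line) (use f S in \<open>auto simp: ball_algebra_def\<close>)

text \<open>
  The function \<open>t \<mapsto> f (v + \<Sum> t\<^sub>j b\<^sub>j)\<close> of \<open>m\<close> complex variables is holomorphic on a polydisc of radius 2, hence close
  to a polynomial on the unit polydisc, and the bound for polynomials applies. The 1 in \<open>M + 1\<close> pays for the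
  approximation, whose accuracy \<open>e\<close> is adapted to \<open>m\<close>.
\<close>

lemma block_square_sum_bound:
  fixes v :: c0 and b :: "nat \<Rightarrow> c0"
  assumes f: "f \<in> ball_algebra" and M: "\<And>x. norm x < 1 \<Longrightarrow> cmod (f x) \<le> M"
    and inside: "\<And>t. (\<And>k. cmod (t k) < 2) \<Longrightarrow> norm (v + (\<Sum>j<m. scaleC_c0 (t j) (b j))) < 1"
  shows "(\<Sum>j<m. (cmod (f (v + scaleC_c0 (1 / 2) (b j)) - f v))\<^sup>2) \<le> (M + 1)\<^sup>2"
proof -
  define h where "h t = f (v + (\<Sum>j<m. scaleC_c0 (t j) (b j)))" for t
  \<comment> \<open>so that the total error \<open>e + 2 * e * sqrt m\<close> is 1\<close>
  define e where "e = 1 / (1 + 2 * sqrt (real m))"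
  have pos: "1 + 2 * sqrt (real m) > 0" by (simp add: add_pos_nonneg)
  then have e: "e > 0" and me: "e * (1 + 2 * sqrt (real m)) = 1" by (simp_all add: e_def)
  have upd: "(\<Sum>j<m. scaleC_c0 ((t(k := z)) j) (b j)) = (\<Sum>j\<in>{..<m} - {k}. scaleC_c0 (t j) (b j)) + scaleC_c0 z (b k)"
    if "k < m" for t k z
    using that by (subst sum.remove[of _ k]) (auto intro!: sum.cong simp: add.commute)
  have "\<exists>P\<in>bohr_polys. \<forall>t. (\<forall>k. cmod (t k) \<le> 1) \<longrightarrow> cmod (h t - P t) \<le> e"
  proof (rule polydisc_approx[where R = 2 and M = M and m = m])
    show "h t = h t'" if "\<And>k. k < m \<Longrightarrow> t k = t' k" for t t'
      using that by (simp add: h_def)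
    show "(\<lambda>z. h (t(k := z))) holomorphic_on ball 0 2" if t: "\<And>i. cmod (t i) < 2" and k: "k < m" for t k
      unfolding h_def upd[OF k] add.assoc[symmetric]
    proof (rule ball_algebra_holomorphic_on_line[OF f])
      fix z :: complex assume "z \<in> ball 0 2"
      then show "norm (v + (\<Sum>j\<in>{..<m} - {k}. scaleC_c0 (t j) (b j)) + scaleC_c0 z (b k)) < 1"
        using inside[of "t(k := z)"] t unfolding upd[OF k] by (simp add: add.assoc)
    qed
    show "cmod (h t) \<le> M" if "\<And>i. cmod (t i) < 2" for t
      unfolding h_def by (intro M inside that)
  qed (use e in auto)
  then obtain Q where "Q \<in> bohr_polys" and Q: "\<forall>t. (\<forall>k. cmod (t k) \<le> 1) \<longrightarrow> cmod (h t - Q t) \<le> e" by blast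
  then obtain a N where aN: "Q = bohr_poly a N" unfolding bohr_polys_def by blast
  have P: "cmod (h t - bohr_poly a N t) \<le> e" if "\<forall>k. cmod (t k) \<le> 1" for t
    using Q that unfolding aN by blast
  define x where "x k = (\<lambda>_. 0 :: complex)(k := 1 / 2)" for k :: nat
  have x1: "\<forall>i. cmod (x k i) \<le> 1" for k by (simp add: x_def)
  have half: "(\<Sum>k<m. (cmod (bohr_poly a N (x k) - bohr_poly a N (\<lambda>_. 0)))\<^sup>2) \<le> (M + e)\<^sup>2"
    unfolding x_def
  proof (rule bohr_poly_axis_square_sum)
    fix s :: complex assume s: "Re s > 0"
    have lt1: "cmod (bohr_point s k) < 1" for k
      using norm_bohr_point_le[OF s, of k] s by (smt (verit) powr_less_one)
    then have 1: "cmod (h (bohr_point s) - bohr_poly a N (bohr_point s)) \<le> e" by (intro P) (simp add: less_imp_le)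
    have "cmod (h (bohr_point s)) \<le> M" unfolding h_def
    proof (intro M inside)
      show "cmod (bohr_point s k) < 2" for k using lt1[of k] by simp
    qed
    then show "cmod (bohr_poly a N (bohr_point s)) \<le> M + e"
      using 1 norm_triangle_ineq4[of "h (bohr_point s)" "h (bohr_point s) - bohr_poly a N (bohr_point s)"] by simp
  qed
  have hx: "h (x k) = f (v + scaleC_c0 (1 / 2) (b k))" if "k < m" for k
    unfolding h_def x_def upd[OF that] by (simp add: scaleC_c0_0)
  have h0: "h (\<lambda>_. 0) = f v"
    unfolding h_def by (simp add: scaleC_c0_0)
  define d where "d k = cmod (f (v + scaleC_c0 (1 / 2) (b k)) - f v)" for k
  define p where "p k = cmod (bohr_poly a N (x k) - bohr_poly a N (\<lambda>_. 0))" for k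
  have M0: "M \<ge> 0" using order_trans[OF norm_ge_zero M[of 0]] by simp
  have "d k \<le> p k + 2 * e" if "k < m" for k
  proof -
    have "f (v + scaleC_c0 (1 / 2) (b k)) - f v = (h (x k) - bohr_poly a N (x k))
       + (bohr_poly a N (x k) - bohr_poly a N (\<lambda>_. 0)) - (h (\<lambda>_. 0) - bohr_poly a N (\<lambda>_. 0))"
      by (simp add: hx[OF that] h0)
    then show ?thesis
      unfolding d_def p_def using P[OF x1, of k] P[of "\<lambda>_. 0"]
        norm_triangle_ineq4[of "(h (x k) - bohr_poly a N (x k)) + (bohr_poly a N (x k) - bohr_poly a N (\<lambda>_. 0))" "h (\<lambda>_. 0) - bohr_poly a N (\<lambda>_. 0)"]
        norm_triangle_ineq[of "h (x k) - bohr_poly a N (x k)" "bohr_poly a N (x k) - bohr_poly a N (\<lambda>_. 0)"]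
      by simp
  qed
  then have "L2_set d {..<m} \<le> L2_set (\<lambda>k. p k + 2 * e) {..<m}"
    by (intro L2_set_mono) (auto simp: d_def)
  also have "\<dots> \<le> L2_set p {..<m} + L2_set (\<lambda>_. 2 * e) {..<m}" by (rule L2_set_triangle_ineq)
  also have "L2_set (\<lambda>_. 2 * e) {..<m} = sqrt (real m) * (2 * e)"
    using e by (simp add: L2_set_def real_sqrt_mult)
  also have "L2_set p {..<m} \<le> M + e"
    using half M0 e by (simp add: L2_set_def p_def real_le_lsqrt sum_nonneg)
  also have "M + e + sqrt (real m) * (2 * e) = M + e * (1 + 2 * sqrt (real m))" by (simp add: algebra_simps)
  also have "\<dots> = M + 1" using me by simp
  finally have "(L2_set d {..<m})\<^sup>2 \<le> (M + 1)\<^sup>2" by (intro power_mono L2_set_nonneg) auto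
  then show ?thesis by (simp add: L2_set_def sum_nonneg d_def)
qed

section \<open>The gliding hump\<close>

text \<open>
  Defined for arbitrary sequences and not only for null sequences, because the gliding hump runs along
  the truncations of a bounded sequence.
\<close>

lift_definition head_c0 :: "nat \<Rightarrow> (nat \<Rightarrow> complex) \<Rightarrow> c0" is "\<lambda>k u i. if i < k then u i else 0"
proof -
  fix k :: nat and u :: "nat \<Rightarrow> complex"
  have "\<forall>\<^sub>F i in sequentially. (if i < k then u i else 0) = 0"
    unfolding eventually_sequentially by (intro exI[of _ k]) auto
  then show "(\<lambda>i. if i < k then u i else 0) \<longlonglongrightarrow> 0" by (rule tendsto_eventually)
qed

lemmas c0_nth_head = head_c0.rep_eq

lemma norm_head_c0_le: "B \<ge> 0 \<Longrightarrow> (\<And>i. cmod (u i) \<le> B) \<Longrightarrow> norm (head_c0 k u) \<le> B"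
  by (rule norm_c0_least) (simp add: c0_nth_head)

lemma norm_head_c0_nth_le: "norm (head_c0 k (c0_nth x)) \<le> norm x"
  by (rule norm_head_c0_le) (auto intro: norm_c0_nth_le)

lemma head_c0_tendsto: "(\<lambda>k. head_c0 k (c0_nth x)) \<longlonglongrightarrow> x"
proof (rule LIMSEQ_I)
  fix r :: real assume r: "r > 0"
  obtain K where K: "\<And>i. i \<ge> K \<Longrightarrow> cmod (c0_nth x i) < r / 2"
    using LIMSEQ_D[OF c0_nth_tendsto[of x], of "r / 2"] r by auto
  have "norm (head_c0 k (c0_nth x) - x) < r" if "k \<ge> K" for k
  proof -
    have "norm (head_c0 k (c0_nth x) - x) \<le> r / 2"
    proof (rule norm_c0_least)
      fix i
      show "cmod (c0_nth (head_c0 k (c0_nth x) - x) i) \<le> r / 2"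
        using K[of i] that r by (cases "i < k") (auto simp: c0_nth_simps c0_nth_head)
    qed
    then show ?thesis using r by simp
  qed
  then show "\<exists>K. \<forall>k\<ge>K. norm (head_c0 k (c0_nth x) - x) < r" by blast
qed

lemma ball_algebra_continuous_at: "f \<in> ball_algebra \<Longrightarrow> norm x < 1 \<Longrightarrow> isCont f x"
  unfolding ball_algebra_def complex_frechet_differentiable_def
  by (auto intro: has_derivative_continuous)

lemma ball_algebra_bound:
  assumes "f \<in> ball_algebra"
  shows "\<exists>M\<ge>0. \<forall>x. norm x < 1 \<longrightarrow> cmod (f x) \<le> M"
proof -
  obtain M where "\<forall>x\<in>ball 0 1. cmod (f x) \<le> M"
    using bdd_above_ball_algebra[OF assms] by (auto simp: bdd_above_def)
  then have M: "cmod (f x) \<le> M" if "norm x < 1" for x using that by simp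
  show ?thesis using M order_trans[OF norm_ge_zero M[of 0]] by (intro exI[of _ M]) simp
qed

text \<open>
  Disjoint supports keep all combinations of the blocks with coefficients bounded by 4 inside the unit ball,
  whatever their number is: the norm is at most \<open>1/4 + 4 * 1/8\<close>.
\<close>

lemma disjoint_block_square_sum:
  fixes c :: "nat \<Rightarrow> c0"
  assumes f: "f \<in> ball_algebra" and M: "\<And>x. norm x < 1 \<Longrightarrow> cmod (f x) \<le> M"
    and v: "norm v \<le> 1/4" and c: "\<And>j. norm (c j) \<le> 1/8"
    and disj: "\<And>i j l. c0_nth (c j) i \<noteq> 0 \<Longrightarrow> c0_nth (c l) i \<noteq> 0 \<Longrightarrow> j = l"
  shows "(\<Sum>j<m. (cmod (f (v + c j) - f v))\<^sup>2) \<le> (M + 1)\<^sup>2"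
proof -
  \<comment> \<open>the increments of \<open>f\<close> are taken at parameter \<open>1/2\<close>\<close>
  define b where "b j = scaleC_c0 2 (c j)" for j
  have half: "scaleC_c0 (1 / 2) (b j) = c j" for j
    by (rule c0_eqI) (simp add: b_def c0_nth_simps)
  have "(\<Sum>j<m. (cmod (f (v + scaleC_c0 (1 / 2) (b j)) - f v))\<^sup>2) \<le> (M + 1)\<^sup>2"
  proof (rule block_square_sum_bound[OF f M])
    fix t :: "nat \<Rightarrow> complex" assume t: "\<And>k. cmod (t k) < 2"
    have "norm (v + (\<Sum>j<m. scaleC_c0 (t j) (b j))) \<le> 3/4"
    proof (rule norm_c0_least)
      fix i
      have "cmod (\<Sum>j<m. t j * (2 * c0_nth (c j) i)) \<le> 1/2"
      proof (cases "\<exists>l<m. c0_nth (c l) i \<noteq> 0")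
        case True
        then obtain l where l: "l < m" "c0_nth (c l) i \<noteq> 0" by blast
        then have "c0_nth (c j) i = 0" if "j \<noteq> l" for j using disj[of j i l] that by blast
        then have "(\<Sum>j<m. t j * (2 * c0_nth (c j) i)) = (\<Sum>j\<in>{l}. t j * (2 * c0_nth (c j) i))"
          using l by (intro sum.mono_neutral_right) auto
        also have "cmod \<dots> = cmod (t l) * (2 * cmod (c0_nth (c l) i))" by (simp add: norm_mult)
        also have "\<dots> \<le> 2 * (2 * (1/8))"
          using t[of l] order_trans[OF norm_c0_nth_le c, of l i] by (intro mult_mono) auto
        finally show ?thesis by simp
      qed simp
      moreover have "cmod (c0_nth v i) \<le> 1/4" using norm_c0_nth_le[of v i] v by simp
      ultimately show "cmod (c0_nth (v + (\<Sum>j<m. scaleC_c0 (t j) (b j))) i) \<le> 3/4"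
        using norm_triangle_ineq[of "c0_nth v i" "\<Sum>j<m. t j * (2 * c0_nth (c j) i)"]
        by (simp add: c0_nth_simps c0_nth_sum b_def)
    qed
    then show "norm (v + (\<Sum>j<m. scaleC_c0 (t j) (b j))) < 1" by simp
  qed
  then show ?thesis by (simp add: half)
qed

definition supported_in :: "c0 \<Rightarrow> nat \<Rightarrow> nat \<Rightarrow> bool" where
  "supported_in w n s \<longleftrightarrow> (\<forall>i. c0_nth w i \<noteq> 0 \<longrightarrow> n \<le> i \<and> i < s)"

definition tail_vector :: "nat \<Rightarrow> c0 \<Rightarrow> bool" where
  "tail_vector n w \<longleftrightarrow> (\<forall>i<n. c0_nth w i = 0)"

text \<open>
  By continuity of \<open>f\<close> a perturbation can be replaced by one of its truncations.
\<close>

lemma finite_tail_perturbation: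
  assumes f: "f \<in> ball_algebra" and v: "norm v \<le> 1/4"
    and w: "norm w \<le> 1/8" "tail_vector n w" "cmod (f (v + w) - f v) > e"
  shows "\<exists>w' s. n \<le> s \<and> norm w' \<le> norm w \<and> supported_in w' n s \<and> cmod (f (v + w') - f v) > e"
proof -
  have "norm (v + w) < 1" using norm_triangle_ineq[of v w] v w by simp
  then have cont: "isCont f (v + w)" by (rule ball_algebra_continuous_at[OF f])
  have "(\<lambda>k. cmod (f (v + head_c0 k (c0_nth w)) - f v)) \<longlonglongrightarrow> cmod (f (v + w) - f v)"
    by (intro tendsto_intros isCont_tendsto_compose[OF cont] head_c0_tendsto)
  then have "\<forall>\<^sub>F k in sequentially. cmod (f (v + head_c0 k (c0_nth w)) - f v) > e"
    using w(3) by (rule order_tendstoD)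
  then obtain k where k: "\<And>l. l \<ge> k \<Longrightarrow> cmod (f (v + head_c0 l (c0_nth w)) - f v) > e"
    by (auto simp: eventually_sequentially)
  have "supported_in (head_c0 (max n k) (c0_nth w)) n (max n k)"
    using w(2) by (auto simp: supported_in_def tail_vector_def c0_nth_head not_less[symmetric] split: if_splits)
  then show ?thesis using k[of "max n k"] norm_head_c0_nth_le[of "max n k" w]
    by (intro exI[of _ "head_c0 (max n k) (c0_nth w)"] exI[of _ "max n k"]) auto
qed

text \<open>
  Otherwise there are perturbations \<open>W\<close> arbitrarily far out, which can be chosen successively with
  disjoint supports, each changing \<open>f v\<close> by more than \<open>e\<close>. This contradicts the square sum bound.
\<close>

lemma tail_continuity_at_point:
  assumes f: "f \<in> ball_algebra" and v: "norm v \<le> 1/4" and e: "e > 0"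
  shows "\<exists>n. \<forall>w. norm w \<le> 1/8 \<longrightarrow> tail_vector n w \<longrightarrow> cmod (f (v + w) - f v) \<le> e"
proof (rule ccontr)
  assume "\<not> ?thesis"
  then have bad: "\<exists>w. norm w \<le> 1/8 \<and> tail_vector n w \<and> cmod (f (v + w) - f v) > e" for n
    by (meson not_le)
  have "\<exists>w s. n \<le> s \<and> norm w \<le> 1/8 \<and> supported_in w n s \<and> cmod (f (v + w) - f v) > e" for n
  proof -
    obtain w where w: "norm w \<le> 1/8" "tail_vector n w" "cmod (f (v + w) - f v) > e" using bad by blast
    from finite_tail_perturbation[OF f v w] w(1) show ?thesis by (meson order_trans)
  qed
  then obtain W S where WS: "\<And>n. n \<le> S n" "\<And>n. norm (W n) \<le> 1/8" "\<And>n. supported_in (W n) n (S n)"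
    "\<And>n. cmod (f (v + W n) - f v) > e" by metis
  obtain M where M: "M \<ge> 0" "\<And>x. norm x < 1 \<Longrightarrow> cmod (f x) \<le> M" using ball_algebra_bound[OF f] by blast
  define N where "N = rec_nat 0 (\<lambda>_. S)"
  have N: "N (Suc j) = S (N j)" for j by (simp add: N_def)
  have mono: "N j \<le> N l" if "j \<le> l" for j l
    using that by (induction rule: dec_induct) (auto simp: N intro: order_trans[OF _ WS(1)])
  obtain m where m: "real m * e\<^sup>2 > (M + 1)\<^sup>2"
    using reals_Archimedean2[of "(M + 1)\<^sup>2 / e\<^sup>2"] e by (auto simp: divide_less_eq)
  have "(\<Sum>j<m. e\<^sup>2) \<le> (\<Sum>j<m. (cmod (f (v + W (N j)) - f v))\<^sup>2)"
    using WS(4) e by (intro sum_mono power_mono) (auto intro: less_imp_le)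
  also have "\<dots> \<le> (M + 1)\<^sup>2"
  proof (rule disjoint_block_square_sum[OF f M(2) v WS(2)])
    fix i j l assume "c0_nth (W (N j)) i \<noteq> 0" "c0_nth (W (N l)) i \<noteq> 0"
    then have "N j \<le> i" "i < N (Suc j)" "N l \<le> i" "i < N (Suc l)"
      using WS(3) by (auto simp: supported_in_def N)
    then show "j = l" using mono[of "Suc j" l] mono[of "Suc l" j] by (metis Suc_leI le_less_trans less_le_not_le linorder_neqE_nat)
  qed
  finally show False using m by simp
qed

text \<open>
  The point that is perturbed now moves with \<open>n\<close>. Suppose that there are bad perturbations \<open>W n\<close> for all \<open>n\<close>. Choose
  positions \<open>N j\<close> so far apart that, by continuity along tails at the points \<open>head_c0 (N j) u\<close> and
  \<open>head_c0 (N j) u + W (N j)\<close>, nothing beyond position \<open>N (j + 1)\<close> matters to them. Then all of them can be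
  replaced by perturbations of the single point \<open>U = head_c0 (N m) u\<close>: the block \<open>c' j\<close> erases \<open>u\<close> between
  \<open>N j\<close> and \<open>N (j + 1)\<close>, and \<open>c j\<close> moreover inserts \<open>W (N j)\<close> there. For every \<open>j < m\<close> the values of \<open>f\<close> at
  \<open>U + c j\<close> and \<open>U + c' j\<close> differ by at least \<open>e / 2\<close>, so one of them is far from \<open>f U\<close>, which is impossible
  for large \<open>m\<close>.
\<close>

lemma gliding_hump:
  assumes f: "f \<in> ball_algebra" and u: "\<And>i. cmod (u i) \<le> 1/16" and e: "e > 0"
  shows "\<exists>n. \<forall>w. norm w \<le> 1/16 \<longrightarrow> tail_vector n w \<longrightarrow> cmod (f (head_c0 n u + w) - f (head_c0 n u)) \<le> e"
proof (rule ccontr)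
  assume "\<not> ?thesis"
  then have bad: "\<exists>w. norm w \<le> 1/16 \<and> tail_vector n w \<and> cmod (f (head_c0 n u + w) - f (head_c0 n u)) > e" for n
    by (meson not_le)
  have u16: "cmod (u i) * 16 \<le> 1" for i using u[of i] by simp
  have hu: "norm (head_c0 n u) \<le> 1/16" for n by (rule norm_head_c0_le[OF _ u]) simp
  have "\<exists>w s. n \<le> s \<and> norm w \<le> 1/16 \<and> supported_in w n s \<and> cmod (f (head_c0 n u + w) - f (head_c0 n u)) > e" for n
  proof -
    obtain w where w: "norm w \<le> 1/16" "tail_vector n w" "cmod (f (head_c0 n u + w) - f (head_c0 n u)) > e" using bad by blast
    have "norm (head_c0 n u) \<le> 1/4" "norm w \<le> 1/8" using hu[of n] w(1) by auto
    from finite_tail_perturbation[OF f this w(2,3)] w(1) show ?thesis by (meson order_trans)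
  qed
  then obtain W S where WS: "\<And>n. n \<le> S n" "\<And>n. norm (W n) \<le> 1/16" "\<And>n. supported_in (W n) n (S n)"
    "\<And>n. cmod (f (head_c0 n u + W n) - f (head_c0 n u)) > e" by metis
  have "\<exists>t\<ge>S n. \<forall>w. norm w \<le> 1/8 \<longrightarrow> tail_vector t w \<longrightarrow>
      cmod (f (head_c0 n u + W n + w) - f (head_c0 n u + W n)) \<le> e/4 \<and> cmod (f (head_c0 n u + w) - f (head_c0 n u)) \<le> e/4" for n
  proof -
    have "norm (head_c0 n u + W n) \<le> 1/4" using norm_triangle_ineq[of "head_c0 n u" "W n"] hu[of n] WS(2)[of n] by simp
    from tail_continuity_at_point[OF f this, of "e/4"] e obtain t1 where
      t1: "\<forall>w. norm w \<le> 1/8 \<longrightarrow> tail_vector t1 w \<longrightarrow> cmod (f (head_c0 n u + W n + w) - f (head_c0 n u + W n)) \<le> e/4" by auto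
    have "norm (head_c0 n u) \<le> 1/4" using hu[of n] by simp
    from tail_continuity_at_point[OF f this, of "e/4"] e obtain t2 where
      t2: "\<forall>w. norm w \<le> 1/8 \<longrightarrow> tail_vector t2 w \<longrightarrow> cmod (f (head_c0 n u + w) - f (head_c0 n u)) \<le> e/4" by auto
    show ?thesis
      by (intro exI[of _ "max (S n) (max t1 t2)"] conjI allI impI t1[rule_format] t2[rule_format])
         (auto simp: tail_vector_def)
  qed
  then obtain T where T: "\<And>n. T n \<ge> S n"
    "\<And>n w. norm w \<le> 1/8 \<Longrightarrow> tail_vector (T n) w \<Longrightarrow> cmod (f (head_c0 n u + W n + w) - f (head_c0 n u + W n)) \<le> e/4"
    "\<And>n w. norm w \<le> 1/8 \<Longrightarrow> tail_vector (T n) w \<Longrightarrow> cmod (f (head_c0 n u + w) - f (head_c0 n u)) \<le> e/4"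
    by metis
  obtain M where M: "M \<ge> 0" "\<And>x. norm x < 1 \<Longrightarrow> cmod (f x) \<le> M" using ball_algebra_bound[OF f] by blast
  define N where "N = rec_nat 0 (\<lambda>_. T)"
  have N: "N (Suc j) = T (N j)" for j by (simp add: N_def)
  have step: "N j \<le> N (Suc j)" for j using order_trans[OF WS(1) T(1)] by (simp add: N)
  have mono: "N j \<le> N l" if "j \<le> l" for j l using that step by (rule lift_Suc_mono_le[rotated])
  obtain m where m: "real m * e\<^sup>2 > 16 * (M + 1)\<^sup>2"
    using reals_Archimedean2[of "16 * (M + 1)\<^sup>2 / e\<^sup>2"] e by (auto simp: divide_less_eq)
  define U where "U = head_c0 (N m) u"
  have U: "norm U \<le> 1/4" using hu[of "N m"] by (simp add: U_def)
  define c' where "c' j = head_c0 (N j) u - head_c0 (N (Suc j)) u" for j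
  define c where "c j = c' j + W (N j)" for j
  have c'_nth: "c0_nth (c' j) i = (if N j \<le> i \<and> i < N (Suc j) then - u i else 0)" for i j
    using step[of j] by (auto simp: c'_def c0_nth_simps c0_nth_head)
  have c'_norm: "norm (c' j) \<le> 1/16" for j
    by (rule norm_c0_least) (simp add: c'_nth u16)
  have c_norm: "norm (c j) \<le> 1/8" for j
    using norm_triangle_ineq[of "c' j" "W (N j)"] c'_norm[of j] WS(2)[of "N j"] by (simp add: c_def)
  have supp': "N j \<le> i \<and> i < N (Suc j)" if "c0_nth (c' j) i \<noteq> 0" for i j
    using that by (simp add: c'_nth split: if_splits)
  have supp: "N j \<le> i \<and> i < N (Suc j)" if "c0_nth (c j) i \<noteq> 0" for i j
  proof (cases "c0_nth (c' j) i = 0")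
    case True
    then have "c0_nth (W (N j)) i \<noteq> 0" using that by (simp add: c_def c0_nth_simps)
    then have "N j \<le> i \<and> i < S (N j)" using WS(3) by (simp add: supported_in_def)
    then show ?thesis using T(1)[of "N j"] by (simp add: N)
  qed (use supp' in blast)
  have separate: "j = l" if "N j \<le> i \<and> i < N (Suc j)" "N l \<le> i \<and> i < N (Suc l)" for i j l
    using mono[of "Suc j" l] mono[of "Suc l" j] that by (metis Suc_leI le_less_trans less_le_not_le linorder_neqE_nat)
  have each: "e\<^sup>2 / 8 \<le> (cmod (f (U + c j) - f U))\<^sup>2 + (cmod (f (U + c' j) - f U))\<^sup>2" if j: "j < m" for j
  proof -
    \<comment> \<open>the part of \<open>U\<close> beyond the \<open>j\<close>-th block, which hardly changes the values of \<open>f\<close>\<close>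
    define R where "R = U - head_c0 (N (Suc j)) u"
    have R_nth: "c0_nth R i = (if N (Suc j) \<le> i \<and> i < N m then u i else 0)" for i
      using mono[of "Suc j" m] j by (auto simp: R_def U_def c0_nth_simps c0_nth_head)
    have "norm R \<le> 1/16" by (rule norm_c0_least) (simp add: R_nth u16)
    then have R: "norm R \<le> 1/8" "tail_vector (T (N j)) R"
      by (auto simp: tail_vector_def R_nth N)
    have "U + c j = head_c0 (N j) u + W (N j) + R" "U + c' j = head_c0 (N j) u + R"
      by (simp_all add: c_def c'_def R_def)
    then have 1: "cmod (f (U + c j) - f (head_c0 (N j) u + W (N j))) \<le> e/4"
      and 2: "cmod (f (U + c' j) - f (head_c0 (N j) u)) \<le> e/4"
      using T(2)[OF R] T(3)[OF R] by auto
    have "f (head_c0 (N j) u + W (N j)) - f (head_c0 (N j) u) =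
      (f (U + c j) - f U) - (f (U + c' j) - f U) - (f (U + c j) - f (head_c0 (N j) u + W (N j))) + (f (U + c' j) - f (head_c0 (N j) u))"
      by simp
    then have "e < cmod (\<dots>)" using WS(4)[of "N j"] by simp
    also have "\<dots> \<le> cmod (f (U + c j) - f U) + cmod (f (U + c' j) - f U) + e/4 + e/4"
      by (intro norm_triangle_le norm_triangle_le_diff add_mono 1 2 order_refl)
    finally have ab: "e/2 \<le> cmod (f (U + c j) - f U) + cmod (f (U + c' j) - f U)" by simp
    have sq: "(a + b)\<^sup>2 \<le> 2 * (a\<^sup>2 + b\<^sup>2)" for a b :: real
      using sum_squares_bound[of a b] by (simp add: power2_sum)
    have "(e/2)\<^sup>2 \<le> (cmod (f (U + c j) - f U) + cmod (f (U + c' j) - f U))\<^sup>2"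
      using ab e by (intro power_mono) auto
    also note sq
    finally show ?thesis by (simp add: power_divide)
  qed
  have "(\<Sum>j<m. e\<^sup>2 / 8) \<le> (\<Sum>j<m. (cmod (f (U + c j) - f U))\<^sup>2 + (cmod (f (U + c' j) - f U))\<^sup>2)"
    using each by (intro sum_mono) auto
  also have "\<dots> = (\<Sum>j<m. (cmod (f (U + c j) - f U))\<^sup>2) + (\<Sum>j<m. (cmod (f (U + c' j) - f U))\<^sup>2)"
    by (rule sum.distrib)
  also have "\<dots> \<le> (M + 1)\<^sup>2 + (M + 1)\<^sup>2"
  proof (rule add_mono)
    show "(\<Sum>j<m. (cmod (f (U + c j) - f U))\<^sup>2) \<le> (M + 1)\<^sup>2"
      by (rule disjoint_block_square_sum[OF f M(2) U c_norm]) (assumption, rule separate[OF supp supp])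
    show "(\<Sum>j<m. (cmod (f (U + c' j) - f U))\<^sup>2) \<le> (M + 1)\<^sup>2"
    proof (rule disjoint_block_square_sum[OF f M(2) U])
      show "norm (c' j) \<le> 1/8" for j using c'_norm[of j] by simp
    qed (assumption, rule separate[OF supp' supp'])
  qed
  finally show False using m by simp
qed

section \<open>Density of the polynomials on the ball\<close>

text \<open>
  A sequence of counterexamples has a subsequence that converges in every coordinate, to some \<open>u\<close> in
  \<open>\<ell>\<^sub>\<infinity>\<close>. The gliding hump lemma provides \<open>n\<close> such that beyond position \<open>n\<close> changes of \<open>head_c0 n u\<close>
  are irrelevant, and the first \<open>n\<close> coordinates of a late counterexample are close to those of \<open>u\<close>.
\<close>

lemma uniform_head_approx_small_ball:
  assumes f: "f \<in> ball_algebra" and e: "e > 0"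
  shows "\<exists>k. \<forall>x. norm x \<le> 1/16 \<longrightarrow> cmod (f x - f (head_c0 k (c0_nth x))) \<le> e"
proof (rule ccontr)
  assume "\<not> ?thesis"
  then have "\<forall>k. \<exists>x. norm x \<le> 1/16 \<and> cmod (f x - f (head_c0 k (c0_nth x))) > e"
    by (meson not_le)
  then obtain X where X: "\<And>k. norm (X k) \<le> 1/16" "\<And>k. cmod (f (X k) - f (head_c0 k (c0_nth (X k)))) > e"
    by metis
  have Xi: "cmod (c0_nth (X k) i) \<le> 1/16" for k i using order_trans[OF norm_c0_nth_le X(1)] .
  have "\<exists>r :: nat \<Rightarrow> nat. strict_mono r \<and> (\<forall>i. \<exists>l. (\<lambda>n. c0_nth (X (r n)) i) \<longlonglongrightarrow> l)"
  proof (rule function_convergent_subsequence[of UNIV "\<lambda>k. c0_nth (X k)" "1/16"])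
    show "norm (c0_nth (X k) i) \<le> 1/16" for k i by (rule Xi)
  qed (simp, blast)
  then obtain r :: "nat \<Rightarrow> nat" where r: "strict_mono r" "\<And>i. \<exists>l. (\<lambda>n. c0_nth (X (r n)) i) \<longlonglongrightarrow> l"
    by blast
  then obtain u where u: "\<And>i. (\<lambda>n. c0_nth (X (r n)) i) \<longlonglongrightarrow> u i" by metis
  have u16: "cmod (u i) \<le> 1/16" for i
  proof (rule tendsto_upperbound[OF tendsto_norm[OF u]])
    show "\<forall>\<^sub>F n in sequentially. norm (c0_nth (X (r n)) i) \<le> 1/16"
      by (rule always_eventually) (rule allI, rule Xi)
  qed simp
  have e8: "e/8 > 0" using e by simp
  obtain n where n': "\<forall>w. norm w \<le> 1/16 \<longrightarrow> tail_vector n w \<longrightarrow> cmod (f (head_c0 n u + w) - f (head_c0 n u)) \<le> e/8"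
    using gliding_hump[OF f u16 e8] ..
  note n = n'[rule_format]
  have "uniformly_continuous_on (ball 0 1) f" using f by (simp add: ball_algebra_def)
  then obtain d where d: "d > 0" "\<And>x y. x \<in> ball 0 1 \<Longrightarrow> y \<in> ball 0 1 \<Longrightarrow> dist y x < d \<Longrightarrow> dist (f y) (f x) < e/8"
    using e8 unfolding uniformly_continuous_on_def by blast
  have "\<forall>\<^sub>F l in sequentially. \<forall>i<n. cmod (c0_nth (X (r l)) i - u i) < d/2"
  proof -
    have "\<forall>\<^sub>F l in sequentially. cmod (c0_nth (X (r l)) i - u i) < d/2" for i
      using tendstoD[OF u, of "d/2" i] d(1) by (simp add: dist_norm)
    then have "\<forall>\<^sub>F l in sequentially. \<forall>i\<in>{..<n}. cmod (c0_nth (X (r l)) i - u i) < d/2"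
      by (intro eventually_ball_finite finite_lessThan ballI)
    then show ?thesis by (simp only: Ball_def lessThan_iff)
  qed
  then obtain l0 where l0: "\<And>l i. l \<ge> l0 \<Longrightarrow> i < n \<Longrightarrow> cmod (c0_nth (X (r l)) i - u i) < d/2"
    unfolding eventually_sequentially by blast
  define l where "l = max l0 n"
  define k where "k = r l"
  have k: "n \<le> k" using seq_suble[OF r(1), of l] by (simp add: k_def l_def)
  define x where "x = X k"
  have x: "norm x \<le> 1/16" "\<And>i. i < n \<Longrightarrow> cmod (c0_nth x i - u i) < d/2"
    using X(1) l0[of l] by (auto simp: x_def k_def l_def)
  have hn: "norm (head_c0 n u) \<le> 1/16" by (rule norm_head_c0_le[OF _ u16]) simp
  have close: "cmod (f y - f (head_c0 n u)) \<le> e/4"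
    if y: "norm y \<le> 1/16" "\<And>i. i < n \<Longrightarrow> c0_nth y i = c0_nth x i" for y
  proof -
    define w where "w = y - head_c0 n (c0_nth y)"
    have w_nth: "c0_nth w i = (if i < n then 0 else c0_nth y i)" for i
      by (simp add: w_def c0_nth_simps c0_nth_head)
    have "norm w \<le> norm y" by (rule norm_c0_least) (simp add: w_nth norm_c0_nth_le)
    then have w: "norm w \<le> 1/16" "tail_vector n w" using y(1) by (simp_all add: tail_vector_def w_nth)
    have "norm (y - (head_c0 n u + w)) \<le> d/2"
    proof (rule norm_c0_least)
      fix i show "cmod (c0_nth (y - (head_c0 n u + w)) i) \<le> d/2"
        using x(2)[of i] y(2)[of i] d(1) by (auto simp: c0_nth_simps c0_nth_head w_nth)
    qed
    then have "dist y (head_c0 n u + w) < d" using d(1) by (simp add: dist_norm)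
    moreover have "norm (head_c0 n u + w) < 1" using norm_triangle_ineq[of "head_c0 n u" w] hn w(1) by simp
    ultimately have "dist (f y) (f (head_c0 n u + w)) < e/8" using y(1) by (intro d(2)) auto
    then show ?thesis using n[OF w] norm_triangle_ineq[of "f y - f (head_c0 n u + w)" "f (head_c0 n u + w) - f (head_c0 n u)"]
      by (simp add: dist_norm)
  qed
  have "cmod (f x - f (head_c0 n u)) \<le> e/4" by (rule close[OF x(1)]) simp
  moreover have "cmod (f (head_c0 k (c0_nth x)) - f (head_c0 n u)) \<le> e/4"
    using k by (intro close order_trans[OF norm_head_c0_nth_le x(1)]) (simp add: c0_nth_head)
  ultimately have "cmod (f x - f (head_c0 k (c0_nth x))) \<le> e/2"
    using norm_triangle_ineq4[of "f x - f (head_c0 n u)" "f (head_c0 k (c0_nth x)) - f (head_c0 n u)"] by simp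
  then show False using X(2)[of k] e by (simp add: x_def)
qed

text \<open>
  Smallness on a small disc controls the first Taylor coefficients, and the bound \<open>M\<close> controls the
  remainder. The threshold \<open>\<eta>\<close> does not depend on \<open>g\<close>.
\<close>

lemma small_disc_to_disc:
  assumes r: "0 \<le> r" "r < 1" and e: "e > 0"
  shows "\<exists>\<eta>>0. \<forall>g z. g holomorphic_on ball 0 1 \<longrightarrow> (\<forall>z. cmod z < 1 \<longrightarrow> cmod (g z) \<le> M)
    \<longrightarrow> (\<forall>z. cmod z \<le> 1/16 \<longrightarrow> cmod (g z) \<le> \<eta>) \<longrightarrow> cmod z \<le> r \<longrightarrow> cmod (g z) \<le> e"
proof -
  define \<rho> where "\<rho> = (1 + r) / 2"
  have \<rho>: "r < \<rho>" "\<rho> < 1" using r by (auto simp: \<rho>_def)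
  have "(\<lambda>N. M / (1 - r / \<rho>) * (r / \<rho>) ^ N) \<longlonglongrightarrow> M / (1 - r / \<rho>) * 0"
    using \<rho> r by (intro tendsto_mult tendsto_const LIMSEQ_power_zero) auto
  then have "\<forall>\<^sub>F N in sequentially. M / (1 - r / \<rho>) * (r / \<rho>) ^ N < e / 2"
    using e by (intro order_tendstoD) auto
  then obtain N where N: "M / (1 - r / \<rho>) * (r / \<rho>) ^ N < e / 2" by (auto simp: eventually_sequentially)
  define A where "A = (\<Sum>n<N. 16 ^ n :: real)"
  have A: "A \<ge> 0" by (simp add: A_def sum_nonneg)
  \<comment> \<open>Cauchy's inequality on the circle of radius \<open>1/16\<close> bounds the \<open>n\<close>-th coefficient by \<open>\<eta> * 16 ^ n\<close>\<close>
  define \<eta> where "\<eta> = e / (2 * (A + 1))"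
  have \<eta>: "\<eta> > 0" "\<eta> * A \<le> e / 2"
  proof -
    show "\<eta> > 0" using e A by (simp add: \<eta>_def)
    have "\<eta> * A \<le> \<eta> * (A + 1)" using \<open>\<eta> > 0\<close> by simp
    also have "\<dots> = e / 2" using A unfolding \<eta>_def by (simp add: divide_simps)
    finally show "\<eta> * A \<le> e / 2" .
  qed
  show ?thesis
  proof (intro exI[of _ \<eta>] conjI allI impI)
    fix g z assume g: "g holomorphic_on ball 0 1" and M: "\<forall>z. cmod z < 1 \<longrightarrow> cmod (g z) \<le> M"
      and small: "\<forall>z. cmod z \<le> 1/16 \<longrightarrow> cmod (g z) \<le> \<eta>" and z: "cmod z \<le> r"
    have c: "cmod ((deriv ^^ n) g 0 / fact n) \<le> \<eta> * 16 ^ n" for n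
    proof -
      have "cmod ((deriv ^^ n) g 0) \<le> fact n * \<eta> / (1/16) ^ n"
      proof (rule Cauchy_inequality)
        show "g holomorphic_on ball 0 (1/16)" using g by (rule holomorphic_on_subset) auto
        show "continuous_on (cball 0 (1/16)) g"
          by (rule continuous_on_subset[OF holomorphic_on_imp_continuous_on[OF g]]) auto
        show "cmod (g w) \<le> \<eta>" if "cmod (0 - w) = 1/16" for w using small that by simp
      qed simp
      then show ?thesis by (simp add: norm_divide power_divide field_simps)
    qed
    have "cmod (\<Sum>n<N. (deriv ^^ n) g 0 / fact n * z ^ n) \<le> (\<Sum>n<N. (\<eta> * 16 ^ n) * 1)"
    proof (rule sum_norm_le)
      show "cmod ((deriv ^^ n) g 0 / fact n * z ^ n) \<le> (\<eta> * 16 ^ n) * 1" for n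
        unfolding norm_mult norm_power using z r \<eta> c by (intro mult_mono power_le_one) auto
    qed
    also have "\<dots> = \<eta> * A" by (simp add: A_def sum_distrib_left)
    finally have 1: "cmod (\<Sum>n<N. (deriv ^^ n) g 0 / fact n * z ^ n) \<le> e / 2" using \<eta>(2) by simp
    have "cmod (g z - (\<Sum>n<N. (deriv ^^ n) g 0 / fact n * z ^ n)) \<le> M * (r / \<rho>) ^ N / (1 - r / \<rho>)"
      by (rule taylor_tail_bound[OF g M[rule_format] r(1) \<rho> z])
    also have "\<dots> \<le> e / 2" using N by simp
    finally show "cmod (g z) \<le> e" using 1 norm_triangle_sub[of "g z" "\<Sum>n<N. (deriv ^^ n) g 0 / fact n * z ^ n"] by simp
  qed (rule \<eta>)
qed

lemma scaleC_c0_of_real: "scaleC_c0 (of_real r) x = r *\<^sub>R x"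
  by (rule c0_eqI) (simp add: c0_nth_simps scaleR_conv_of_real)

lemma dilation_close:
  assumes f: "f \<in> ball_algebra" and e: "e > 0"
  shows "\<exists>r. 0 < r \<and> r < 1 \<and> (\<forall>x. norm x < 1 \<longrightarrow> cmod (f x - f (r *\<^sub>R x)) \<le> e \<and> cmod (f x - f ((r * r) *\<^sub>R x)) \<le> e)"
proof -
  have "uniformly_continuous_on (ball 0 1) f" using f by (simp add: ball_algebra_def)
  then obtain d where d: "d > 0" "\<And>x y. x \<in> ball 0 1 \<Longrightarrow> y \<in> ball 0 1 \<Longrightarrow> dist y x < d \<Longrightarrow> dist (f y) (f x) < e"
    using e unfolding uniformly_continuous_on_def by blast
  define r where "r = max (1/2) (1 - d/4)"
  have r: "0 < r" "r < 1" "1 - r \<le> d/4" using d(1) max.cobounded2[of "1 - d/4" "1/2"] unfolding r_def by linarith+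
  have main: "cmod (f x - f (s *\<^sub>R x)) \<le> e" if x: "norm x < 1" and s: "0 \<le> s" "s \<le> 1" "1 - s \<le> d/2" for x s
  proof -
    have "x - s *\<^sub>R x = (1 - s) *\<^sub>R x" by (simp add: algebra_simps)
    then have "dist x (s *\<^sub>R x) = (1 - s) * norm x" using s by (simp add: dist_norm)
    also have "\<dots> \<le> (1 - s) * 1" using x s by (intro mult_left_mono) auto
    also have "\<dots> < d" using s d(1) by simp
    finally have "dist x (s *\<^sub>R x) < d" .
    moreover have "norm (s *\<^sub>R x) < 1" using x s mult_right_mono[of s 1 "norm x"] by simp
    ultimately show ?thesis using d(2)[of "s *\<^sub>R x" x] x by (simp add: dist_norm)
  qed
  have "1 - r * r = (1 - r) * (1 + r)" by (simp add: algebra_simps)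
  also have "\<dots> \<le> d/4 * 2" using r d(1) by (intro mult_mono) auto
  finally have rr: "1 - r * r \<le> d/2" by simp
  show ?thesis
    using r d(1) rr by (intro exI[of _ r] conjI allI impI main) (auto simp: mult_le_one)
qed

text \<open>
  On the line through \<open>0\<close> and \<open>x\<close> the difference \<open>f x - f (head_c0 k x)\<close> is holomorphic in one variable, bounded, and
  small near \<open>0\<close>; hence it is small at \<open>r * x\<close> for any fixed \<open>r < 1\<close>, and uniform continuity lets \<open>r\<close> be close to 1.
\<close>

lemma uniform_head_approx:
  assumes f: "f \<in> ball_algebra" and e: "e > 0"
  shows "\<exists>k. \<forall>x. norm x < 1 \<longrightarrow> cmod (f x - f (head_c0 k (c0_nth x))) \<le> e"
proof -
  have e3: "e/3 > 0" using e by simp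
  obtain M where M: "M \<ge> 0" "\<And>x. norm x < 1 \<Longrightarrow> cmod (f x) \<le> M" using ball_algebra_bound[OF f] by blast
  obtain r where r: "0 < r" "r < 1" "\<And>x. norm x < 1 \<Longrightarrow> cmod (f x - f (r *\<^sub>R x)) \<le> e/3"
    using dilation_close[OF f e3] by blast
  obtain \<eta> where \<eta>: "\<eta> > 0" "\<forall>g z. g holomorphic_on ball 0 1 \<longrightarrow> (\<forall>z. cmod z < 1 \<longrightarrow> cmod (g z) \<le> 2 * M)
    \<longrightarrow> (\<forall>z. cmod z \<le> 1/16 \<longrightarrow> cmod (g z) \<le> \<eta>) \<longrightarrow> cmod z \<le> r \<longrightarrow> cmod (g z) \<le> e/3"
    using small_disc_to_disc[OF less_imp_le[OF r(1)] r(2) e3, of "2 * M"] by blast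
  obtain k where k: "\<And>x. norm x \<le> 1/16 \<Longrightarrow> cmod (f x - f (head_c0 k (c0_nth x))) \<le> \<eta>"
    using uniform_head_approx_small_ball[OF f \<eta>(1)] by blast
  show ?thesis
  proof (intro exI[of _ k] allI impI)
    fix x :: c0 assume x: "norm x < 1"
    define y where "y = head_c0 k (c0_nth x)"
    have y: "norm y < 1" using norm_head_c0_nth_le[of k x] x by (simp add: y_def)
    have y_eq: "head_c0 k (c0_nth (scaleC_c0 z x)) = scaleC_c0 z y" for z
      by (rule c0_eqI) (simp add: y_def c0_nth_simps c0_nth_head)
    define g where "g z = f (scaleC_c0 z x) - f (scaleC_c0 z y)" for z
    have inside: "norm (scaleC_c0 z w) < 1" if "cmod z < 1" "norm w < 1" for z w
      using norm_scaleC_c0_le[of z w] mult_strict_mono'[of "cmod z" 1 "norm w" 1] that by simp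
    have line: "(\<lambda>z. f (scaleC_c0 z w)) holomorphic_on ball 0 1" if "norm w < 1" for w
      using ball_algebra_holomorphic_on_line[OF f, of "ball 0 1" 0 w] inside that by simp
    have "g holomorphic_on ball 0 1" unfolding g_def by (intro holomorphic_intros line x y)
    moreover have "cmod (g z) \<le> 2 * M" if "cmod z < 1" for z
      using norm_triangle_ineq4[of "f (scaleC_c0 z x)" "f (scaleC_c0 z y)"] M(2)[OF inside[OF that x]] M(2)[OF inside[OF that y]]
      by (simp add: g_def)
    moreover have "cmod (g z) \<le> \<eta>" if z: "cmod z \<le> 1/16" for z
    proof -
      have "norm (scaleC_c0 z x) \<le> 1/16 * 1"
        by (rule order_trans[OF norm_scaleC_c0_le]) (use z x in \<open>intro mult_mono, auto\<close>)
      then show ?thesis using k[of "scaleC_c0 z x"] by (simp add: g_def y_eq)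
    qed
    ultimately have "cmod (g (of_real r)) \<le> e/3" using \<eta>(2) r by simp
    then have "cmod (f (r *\<^sub>R x) - f (r *\<^sub>R y)) \<le> e/3" by (simp add: g_def scaleC_c0_of_real)
    moreover have "f x - f y = (f x - f (r *\<^sub>R x)) + (f (r *\<^sub>R x) - f (r *\<^sub>R y)) - (f y - f (r *\<^sub>R y))" by simp
    then have "cmod (f x - f y) \<le> cmod (f x - f (r *\<^sub>R x)) + cmod (f (r *\<^sub>R x) - f (r *\<^sub>R y)) + cmod (f y - f (r *\<^sub>R y))"
      using norm_triangle_ineq4[of "(f x - f (r *\<^sub>R x)) + (f (r *\<^sub>R x) - f (r *\<^sub>R y))" "f y - f (r *\<^sub>R y)"]
        norm_triangle_ineq[of "f x - f (r *\<^sub>R x)" "f (r *\<^sub>R x) - f (r *\<^sub>R y)"] by simp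
    ultimately show "cmod (f x - f (head_c0 k (c0_nth x))) \<le> e" using r(3)[OF x] r(3)[OF y] by (simp add: y_def)
  qed
qed

text \<open>
  After truncation and dilation, \<open>f\<close> becomes a holomorphic function of \<open>k\<close> variables on a polydisc of radius
  \<open>1 / r > 1\<close>. The dilation is by \<open>r * r\<close>, so that this larger polydisc is still mapped into the open ball.
\<close>

lemma ball_algebra_approx:
  assumes f: "f \<in> ball_algebra" and e: "e > 0"
  shows "\<exists>P\<in>bohr_polys. \<forall>x. norm x < 1 \<longrightarrow> cmod (f x - P (c0_nth x)) \<le> e"
proof -
  have e3: "e/3 > 0" using e by simp
  obtain M where M: "M \<ge> 0" "\<And>x. norm x < 1 \<Longrightarrow> cmod (f x) \<le> M" using ball_algebra_bound[OF f] by blast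
  obtain k where k: "\<And>x. norm x < 1 \<Longrightarrow> cmod (f x - f (head_c0 k (c0_nth x))) \<le> e/3"
    using uniform_head_approx[OF f e3] by blast
  obtain r where r: "0 < r" "r < 1" "\<And>x. norm x < 1 \<Longrightarrow> cmod (f x - f ((r * r) *\<^sub>R x)) \<le> e/3"
    using dilation_close[OF f e3] by blast
  define h where "h t = f ((r * r) *\<^sub>R head_c0 k t)" for t
  have inside: "norm ((r * r) *\<^sub>R head_c0 k t) < 1" if "\<And>i. cmod (t i) < 1 / r" for t
  proof -
    have "norm (head_c0 k t) \<le> 1 / r" using that r by (intro norm_head_c0_le) (auto intro: less_imp_le)
    then have "(r * r) * norm (head_c0 k t) \<le> (r * r) * (1 / r)" using r by (intro mult_left_mono) auto
    also have "\<dots> = r" using r by simp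
    finally have "norm ((r * r) *\<^sub>R head_c0 k t) \<le> r" using r(1) by (simp only: norm_scaleR) simp
    then show ?thesis using r(2) by simp
  qed
  have "\<exists>P\<in>bohr_polys. \<forall>t. (\<forall>k. cmod (t k) \<le> 1) \<longrightarrow> cmod (h t - P t) \<le> e/3"
  proof (rule polydisc_approx[where R = "1 / r" and M = M and m = k])
    show "1 / r > 1" using r by simp
    show "h t = h t'" if "\<And>i. i < k \<Longrightarrow> t i = t' i" for t t'
      unfolding h_def by (intro arg_cong[where f = "\<lambda>x. f ((r * r) *\<^sub>R x)"] c0_eqI) (simp add: c0_nth_head that)
    show "(\<lambda>z. h (t(i := z))) holomorphic_on ball 0 (1 / r)" if t: "\<And>i. cmod (t i) < 1 / r" and i: "i < k" for t i
    proof -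
      define x where "x = (r * r) *\<^sub>R head_c0 k (t(i := 0))"
      define b where "b = (r * r) *\<^sub>R head_c0 k ((\<lambda>_. 0)(i := 1))"
      have eq: "(r * r) *\<^sub>R head_c0 k (t(i := z)) = x + scaleC_c0 z b" for z
        by (rule c0_eqI) (auto simp: x_def b_def c0_nth_simps c0_nth_head scaleR_conv_of_real)
      have "(\<lambda>z. f (x + scaleC_c0 z b)) holomorphic_on ball 0 (1 / r)"
      proof (rule ball_algebra_holomorphic_on_line[OF f])
        fix z :: complex assume "z \<in> ball 0 (1 / r)"
        then show "norm (x + scaleC_c0 z b) < 1" unfolding eq[symmetric] using t by (intro inside) auto
      qed
      then show ?thesis by (simp add: h_def eq)
    qed
    show "cmod (h t) \<le> M" if "\<And>i. cmod (t i) < 1 / r" for t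
      unfolding h_def by (intro M inside that)
  qed (rule e3)
  then obtain P where P: "P \<in> bohr_polys" "\<And>t. (\<forall>k. cmod (t k) \<le> 1) \<Longrightarrow> cmod (h t - P t) \<le> e/3" by blast
  show ?thesis
  proof (intro bexI[OF _ P(1)] allI impI)
    fix x :: c0 assume x: "norm x < 1"
    define y where "y = head_c0 k (c0_nth x)"
    have y: "norm y < 1" using norm_head_c0_nth_le[of k x] x by (simp add: y_def)
    have 1: "cmod (f x - f y) \<le> e/3" using k[OF x] by (simp add: y_def)
    have 2: "cmod (f y - h (c0_nth x)) \<le> e/3" using r(3)[OF y] by (simp add: h_def y_def)
    have "cmod (c0_nth x i) \<le> 1" for i using norm_c0_nth_le[of x i] x by simp
    then have 3: "cmod (h (c0_nth x) - P (c0_nth x)) \<le> e/3" by (intro P(2)) simp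
    have "f x - P (c0_nth x) = (f x - f y) + (f y - h (c0_nth x)) + (h (c0_nth x) - P (c0_nth x))" by simp
    also have "cmod \<dots> \<le> e/3 + e/3 + e/3" by (intro norm_triangle_le add_mono 1 2 3)
    finally show "cmod (f x - P (c0_nth x)) \<le> e" by simp
  qed
qed

section \<open>Uniform limits of polynomials on the ball\<close>

text \<open>
  Explicit derivatives and constants, so that the properties needed of polynomials, boundedness,
  Lipschitz continuity and complex differentiability, follow together by induction on their structure.
\<close>

definition lipschitz_frechet ::
  "(c0 \<Rightarrow> complex) \<Rightarrow> (c0 \<Rightarrow> c0 \<Rightarrow> complex) \<Rightarrow> real \<Rightarrow> real \<Rightarrow> bool" where
  "lipschitz_frechet g g' B L \<longleftrightarrow> 0 \<le> B \<and> 0 \<le> L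
    \<and> (\<forall>x. (g has_derivative g' x) (at x)) \<and> (\<forall>x c h. g' x (scaleC_c0 c h) = c * g' x h)
    \<and> (\<forall>x. norm x < 1 \<longrightarrow> cmod (g x) \<le> B)
    \<and> (\<forall>x y. norm x < 1 \<longrightarrow> norm y < 1 \<longrightarrow> cmod (g x - g y) \<le> L * norm (x - y))"

lemma lipschitz_frechetD:
  assumes "lipschitz_frechet g g' B L"
  shows "0 \<le> B" "0 \<le> L" "(g has_derivative g' x) (at x)" "g' x (scaleC_c0 c h) = c * g' x h"
    "norm x < 1 \<Longrightarrow> cmod (g x) \<le> B"
    "norm x < 1 \<Longrightarrow> norm y < 1 \<Longrightarrow> cmod (g x - g y) \<le> L * norm (x - y)"
  using assms by (simp_all add: lipschitz_frechet_def)

lemma lipschitz_frechet_const: "lipschitz_frechet (\<lambda>_. c) (\<lambda>_ _. 0) (cmod c) 0"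
  by (simp add: lipschitz_frechet_def)

lemma lipschitz_frechet_coord: "lipschitz_frechet (\<lambda>x. c0_nth x k) (\<lambda>_ h. c0_nth h k) 1 1"
  unfolding lipschitz_frechet_def
proof (intro conjI allI impI)
  have "bounded_linear (\<lambda>x. c0_nth x k)"
    by (rule bounded_linear_intro[where K = 1]) (auto simp: c0_nth_simps norm_c0_nth_le)
  then show "((\<lambda>x. c0_nth x k) has_derivative (\<lambda>h. c0_nth h k)) (at x)" for x
    by (rule bounded_linear_imp_has_derivative)
  show "cmod (c0_nth x k) \<le> 1" if "norm x < 1" for x
    using norm_c0_nth_le[of x k] that by simp
  show "cmod (c0_nth x k - c0_nth y k) \<le> 1 * norm (x - y)" for x y
    using norm_c0_nth_le[of "x - y" k] by (simp add: c0_nth_simps)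
qed (auto simp: c0_nth_simps)

lemma lipschitz_frechet_add:
  assumes f: "lipschitz_frechet f f' B L" and g: "lipschitz_frechet g g' C K"
  shows "lipschitz_frechet (\<lambda>x. f x + g x) (\<lambda>x h. f' x h + g' x h) (B + C) (L + K)"
  unfolding lipschitz_frechet_def
proof (intro conjI allI impI)
  show "((\<lambda>x. f x + g x) has_derivative (\<lambda>h. f' x h + g' x h)) (at x)" for x
    by (intro has_derivative_add lipschitz_frechetD(3)[OF f] lipschitz_frechetD(3)[OF g])
  show "cmod (f x + g x) \<le> B + C" if "norm x < 1" for x
    by (intro norm_triangle_le add_mono lipschitz_frechetD(5)[OF f that] lipschitz_frechetD(5)[OF g that])
  show "cmod ((f x + g x) - (f y + g y)) \<le> (L + K) * norm (x - y)" if "norm x < 1" "norm y < 1" for x y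
    unfolding distrib_right add_diff_add
    by (intro norm_triangle_le add_mono lipschitz_frechetD(6)[OF f that] lipschitz_frechetD(6)[OF g that])
qed (use lipschitz_frechetD(1,2)[OF f] lipschitz_frechetD(1,2)[OF g] in
    \<open>simp_all add: distrib_left lipschitz_frechetD(4)[OF f] lipschitz_frechetD(4)[OF g]\<close>)

lemma lipschitz_frechet_mult:
  assumes f: "lipschitz_frechet f f' B L" and g: "lipschitz_frechet g g' C K"
  shows "lipschitz_frechet (\<lambda>x. f x * g x) (\<lambda>x h. f x * g' x h + f' x h * g x) (B * C) (B * K + L * C)"
  unfolding lipschitz_frechet_def
proof (intro conjI allI impI)
  note nonneg = lipschitz_frechetD(1,2)[OF f] lipschitz_frechetD(1,2)[OF g]
  show "0 \<le> B * C" "0 \<le> B * K + L * C" using nonneg by simp_all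
  show "((\<lambda>x. f x * g x) has_derivative (\<lambda>h. f x * g' x h + f' x h * g x)) (at x)" for x
    by (intro has_derivative_mult lipschitz_frechetD(3)[OF f] lipschitz_frechetD(3)[OF g])
  show "cmod (f x * g x) \<le> B * C" if "norm x < 1" for x
    unfolding norm_mult
    by (intro mult_mono lipschitz_frechetD(5)[OF f that] lipschitz_frechetD(5)[OF g that] nonneg norm_ge_zero)
  show "cmod (f x * g x - f y * g y) \<le> (B * K + L * C) * norm (x - y)" if "norm x < 1" "norm y < 1" for x y
  proof -
    have "f x * g x - f y * g y = f x * (g x - g y) + (f x - f y) * g y" by (simp add: algebra_simps)
    moreover have "cmod (f x * (g x - g y)) \<le> B * (K * norm (x - y))"
      unfolding norm_mult
      by (intro mult_mono lipschitz_frechetD(5)[OF f that(1)] lipschitz_frechetD(6)[OF g that] nonneg norm_ge_zero)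
    moreover have "cmod ((f x - f y) * g y) \<le> L * norm (x - y) * C"
      unfolding norm_mult using nonneg
      by (intro mult_mono lipschitz_frechetD(6)[OF f that] lipschitz_frechetD(5)[OF g that(2)]) auto
    ultimately have "cmod (f x * g x - f y * g y) \<le> B * (K * norm (x - y)) + L * norm (x - y) * C"
      by (simp add: norm_triangle_le add_mono)
    then show ?thesis by (simp add: algebra_simps)
  qed
qed (simp add: algebra_simps lipschitz_frechetD(4)[OF f] lipschitz_frechetD(4)[OF g])

lemma lipschitz_frechet_bohr_poly:
  assumes "P \<in> bohr_polys"
  shows "\<exists>g' B L. lipschitz_frechet (\<lambda>x. P (c0_nth x)) g' B L"
proof -
  obtain a N where P: "P = bohr_poly a N" using assms unfolding bohr_polys_def by blast
  have prod: "\<exists>g' B L. lipschitz_frechet (\<lambda>x. \<Prod>p\<in>#A. c0_nth x (prime_index p)) g' B L" for A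
  proof (induction A)
    case empty
    show ?case using lipschitz_frechet_const[of 1] by auto
  next
    case (add p A)
    then obtain g' B L where "lipschitz_frechet (\<lambda>x. \<Prod>p\<in>#A. c0_nth x (prime_index p)) g' B L" by blast
    from lipschitz_frechet_mult[OF lipschitz_frechet_coord[of "prime_index p"] this]
    show ?case unfolding image_mset_add_mset prod_mset.add_mset by (intro exI)
  qed
  have "\<exists>g' B L. lipschitz_frechet (\<lambda>x. \<Sum>n<N. a n * bohr_monomial (Suc n) (c0_nth x)) g' B L" for N
  proof (induction N)
    case 0
    show ?case using lipschitz_frechet_const[of 0] by auto
  next
    case (Suc N)
    then obtain g' B L where "lipschitz_frechet (\<lambda>x. \<Sum>n<N. a n * bohr_monomial (Suc n) (c0_nth x)) g' B L" by blast
    moreover obtain h' C K where "lipschitz_frechet (\<lambda>x. bohr_monomial (Suc N) (c0_nth x)) h' C K"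
      using prod unfolding bohr_monomial_def by blast
    ultimately show ?case unfolding sum.lessThan_Suc
      by (intro exI) (rule lipschitz_frechet_add, assumption, rule lipschitz_frechet_mult, rule lipschitz_frechet_const)
  qed
  then show ?thesis unfolding P bohr_poly_def .
qed

text \<open>
  Cauchy's inequality for the restriction of \<open>g\<close> to the complex line through \<open>x\<close> in direction \<open>h\<close>, on a disc that stays
  inside the ball; the factor 2 comes from using half of the available radius.
\<close>

lemma frechet_cauchy_estimate:
  assumes g: "\<And>y. norm y < 1 \<Longrightarrow> complex_frechet_differentiable g y" "\<And>y. norm y < 1 \<Longrightarrow> cmod (g y) \<le> e"
    and L: "(g has_derivative L) (at x)" "\<And>c h. L (scaleC_c0 c h) = c * L h"
    and x: "norm x < 1"
  shows "cmod (L h) \<le> 2 * e / (1 - norm x) * norm h"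
proof (cases "h = 0")
  case True
  have "L 0 = 0" using L(1) by (simp add: has_derivative_def linear_0 bounded_linear.linear)
  then show ?thesis using True by simp
next
  case False
  define \<rho> where "\<rho> = 1 - norm x"
  define R where "R = \<rho> / (2 * norm h)"
  have \<rho>: "\<rho> > 0" using x by (simp add: \<rho>_def)
  then have R: "R > 0" using False by (simp add: R_def)
  have inside: "norm (x + scaleC_c0 z h) < 1" if "cmod z \<le> R" for z
  proof -
    have "norm (scaleC_c0 z h) \<le> R * norm h"
      by (rule order_trans[OF norm_scaleC_c0_le]) (use that in \<open>intro mult_right_mono, auto\<close>)
    also have "\<dots> = \<rho> / 2" using False by (simp add: R_def)
    finally show ?thesis using norm_triangle_ineq[of x "scaleC_c0 z h"] \<rho> by (simp add: \<rho>_def)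
  qed
  define \<phi> where "\<phi> z = g (x + scaleC_c0 z h)" for z
  have hol: "\<phi> holomorphic_on cball 0 R"
    unfolding \<phi>_def by (rule complex_frechet_holomorphic_on_line) (auto intro: g(1) inside)
  have "(\<phi> has_field_derivative L h) (at 0)"
    unfolding \<phi>_def using L by (intro complex_frechet_line_derivative) (simp_all add: scaleC_c0_0)
  then have "deriv \<phi> 0 = L h" by (rule DERIV_imp_deriv)
  moreover have "cmod ((deriv ^^ 1) \<phi> 0) \<le> fact 1 * e / R ^ 1"
  proof (rule Cauchy_inequality)
    show "\<phi> holomorphic_on ball 0 R" using hol by (rule holomorphic_on_subset) auto
    show "continuous_on (cball 0 R) \<phi>" by (rule holomorphic_on_imp_continuous_on[OF hol])
    show "cmod (\<phi> w) \<le> e" if "cmod (0 - w) = R" for w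
      unfolding \<phi>_def using that by (intro g(2) inside) simp
  qed (rule R)
  ultimately show ?thesis using \<rho> False by (simp add: R_def \<rho>_def field_simps)
qed

text \<open>
  By Cauchy's estimate the derivatives converge uniformly on smaller balls, so the limit function is
  differentiable there and its derivative, as a limit of complex linear maps, is complex linear.
\<close>

lemma ball_algebra_uniform_limit:
  assumes P: "\<And>j. P j \<in> bohr_polys"
    and lim: "\<And>e. e > 0 \<Longrightarrow> \<exists>J. \<forall>i\<ge>J. \<forall>j\<ge>J. \<forall>x. norm x < 1 \<longrightarrow> cmod (P i (c0_nth x) - P j (c0_nth x)) \<le> e"
  shows "\<exists>f\<in>ball_algebra. \<forall>x. norm x < 1 \<longrightarrow> (\<lambda>j. P j (c0_nth x)) \<longlonglongrightarrow> f x"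
proof -
  define p where "p j x = P j (c0_nth x)" for j x
  have "\<forall>j. \<exists>g'. \<forall>x. (p j has_derivative g' x) (at x) \<and> (\<forall>c h. g' x (scaleC_c0 c h) = c * g' x h)"
  proof
    fix j
    obtain g' B L where g': "lipschitz_frechet (p j) g' B L"
      using lipschitz_frechet_bohr_poly[OF P] unfolding p_def by blast
    show "\<exists>g'. \<forall>x. (p j has_derivative g' x) (at x) \<and> (\<forall>c h. g' x (scaleC_c0 c h) = c * g' x h)"
      by (intro exI[of _ g'] allI conjI lipschitz_frechetD(3,4)[OF g'])
  qed
  from choice[OF this] obtain p' where
    p_all: "\<forall>j x. (p j has_derivative p' j x) (at x) \<and> (\<forall>c h. p' j x (scaleC_c0 c h) = c * p' j x h)" ..
  have p': "(p j has_derivative p' j x) (at x)" "p' j x (scaleC_c0 c h) = c * p' j x h" for j x c h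
    using p_all by simp_all
  have est: "cmod (p' i x h - p' j x h) \<le> 2 * e / (1 - norm x) * norm h"
    if e: "\<And>y. norm y < 1 \<Longrightarrow> cmod (p i y - p j y) \<le> e" and x: "norm x < 1" for i j e x h
  proof (rule frechet_cauchy_estimate[where g = "\<lambda>x. p i x - p j x" and L = "\<lambda>h. p' i x h - p' j x h"])
    have d: "((\<lambda>x. p i x - p j x) has_derivative (\<lambda>h. p' i y h - p' j y h)) (at y)" for y
      by (intro has_derivative_diff p')
    then show "((\<lambda>x. p i x - p j x) has_derivative (\<lambda>h. p' i x h - p' j x h)) (at x)" .
    show "complex_frechet_differentiable (\<lambda>x. p i x - p j x) y" for y
      unfolding complex_frechet_differentiable_def
      by (intro exI[of _ "\<lambda>h. p' i y h - p' j y h"] conjI d) (simp add: p'(2) right_diff_distrib)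
  qed (use e x in \<open>simp_all add: p'(2) right_diff_distrib\<close>)
  have near: "\<exists>J. \<forall>i\<ge>J. \<forall>j\<ge>J. \<forall>x h. norm x < r \<longrightarrow> cmod (p' i x h - p' j x h) \<le> e * norm h"
    if r: "r < 1" and e: "e > 0" for r e
  proof -
    define \<eta> where "\<eta> = e * (1 - r) / 2"
    have \<eta>: "\<eta> > 0" using r e by (simp add: \<eta>_def)
    obtain J where J: "\<forall>i\<ge>J. \<forall>j\<ge>J. \<forall>x. norm x < 1 \<longrightarrow> cmod (p i x - p j x) \<le> \<eta>"
      using lim[OF \<eta>] unfolding p_def ..
    have "cmod (p' i x h - p' j x h) \<le> e * norm h" if "i \<ge> J" "j \<ge> J" "norm x < r" for i j x h
    proof -
      have "cmod (p' i x h - p' j x h) \<le> 2 * \<eta> / (1 - norm x) * norm h"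
        by (rule est) (use J that r in auto)
      also have "\<dots> \<le> e * norm h"
      proof (rule mult_right_mono)
        have "2 * \<eta> \<le> e * (1 - norm x)" using that(3) e by (simp add: \<eta>_def)
        then show "2 * \<eta> / (1 - norm x) \<le> e" using that(3) r by (simp add: divide_le_eq)
      qed simp
      finally show ?thesis .
    qed
    then show ?thesis by blast
  qed
  have convp: "convergent (\<lambda>j. p j x)" if x: "norm x < 1" for x
    unfolding Cauchy_convergent_iff[symmetric] Cauchy_def dist_norm
  proof (intro allI impI)
    fix e :: real assume "e > 0"
    then have "e / 2 > 0" by simp
    from lim[OF this] obtain J where J: "\<forall>i\<ge>J. \<forall>j\<ge>J. \<forall>x. norm x < 1 \<longrightarrow> cmod (p i x - p j x) \<le> e / 2"
      unfolding p_def ..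
    have "cmod (p i x - p j x) < e" if "i \<ge> J" "j \<ge> J" for i j
      using J[rule_format, OF that x] \<open>e > 0\<close> by simp
    then show "\<exists>M. \<forall>i\<ge>M. \<forall>j\<ge>M. cmod (p i x - p j x) < e" by blast
  qed
  have convp': "convergent (\<lambda>j. p' j x h)" if x: "norm x < 1" for x h
    unfolding Cauchy_convergent_iff[symmetric] Cauchy_def dist_norm
  proof (intro allI impI)
    fix e :: real assume e: "e > 0"
    obtain r where r: "norm x < r" "r < 1" using dense[OF x] by blast
    have "e / (norm h + 1) > 0" using e by (simp add: add_nonneg_pos)
    from near[OF r(2) this] obtain J where
      J: "\<forall>i\<ge>J. \<forall>j\<ge>J. \<forall>x h'. norm x < r \<longrightarrow> cmod (p' i x h' - p' j x h') \<le> e / (norm h + 1) * norm h'" ..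
    have pos: "norm h + 1 > 0" by (simp add: add_nonneg_pos)
    then have small: "e / (norm h + 1) * norm h < e" using e by (simp add: field_simps)
    have "cmod (p' i x h - p' j x h) < e" if "i \<ge> J" "j \<ge> J" for i j
      using J[rule_format, OF that r(1), of h] small by linarith
    then show "\<exists>M. \<forall>i\<ge>M. \<forall>j\<ge>M. cmod (p' i x h - p' j x h) < e" by blast
  qed
  define f where "f x = (if norm x < 1 then lim (\<lambda>j. p j x) else 0)" for x
  define f' where "f' x h = lim (\<lambda>j. p' j x h)" for x h
  have f: "(\<lambda>j. p j x) \<longlonglongrightarrow> f x" if "norm x < 1" for x
    using convp[OF that] that by (simp add: f_def convergent_LIMSEQ_iff)
  have f': "(\<lambda>j. p' j x h) \<longlonglongrightarrow> f' x h" if "norm x < 1" for x h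
    using convp'[OF that] by (simp add: f'_def convergent_LIMSEQ_iff)
  have deriv: "(f has_derivative f' x) (at x)" if x: "norm x < 1" for x
  proof -
    obtain r where r: "norm x < r" "r < 1" using dense[OF x] by blast
    have r1: "norm y < 1" if "y \<in> ball 0 r" for y :: c0 using that r by simp
    have "\<exists>g. \<forall>y\<in>ball 0 r. (\<lambda>j. p j y) \<longlonglongrightarrow> g y \<and> (g has_derivative f' y) (at y within ball 0 r)"
    proof (rule has_derivative_sequence)
      show "(p j has_derivative p' j y) (at y within ball 0 r)" for j y
        by (rule has_derivative_at_withinI[OF p'(1)])
      show "x \<in> ball 0 r" using r by simp
      show "(\<lambda>j. p j x) \<longlonglongrightarrow> f x" by (rule f[OF x])
      show "\<forall>\<^sub>F j in sequentially. \<forall>y\<in>ball 0 r. \<forall>h. cmod (p' j y h - f' y h) \<le> e * norm h" if e: "e > 0" for e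
      proof -
        obtain J where J: "\<forall>i\<ge>J. \<forall>j\<ge>J. \<forall>x h. norm x < r \<longrightarrow> cmod (p' i x h - p' j x h) \<le> e * norm h"
          using near[OF r(2) e] ..
        have "cmod (p' j y h - f' y h) \<le> e * norm h" if j: "j \<ge> J" and y: "y \<in> ball 0 r" for j y h
        proof (rule tendsto_upperbound)
          show "(\<lambda>i. cmod (p' j y h - p' i y h)) \<longlonglongrightarrow> cmod (p' j y h - f' y h)"
            by (rule tendsto_norm[OF tendsto_diff[OF tendsto_const f'[OF r1[OF y]]]])
          have "norm y < r" using y by simp
          then show "\<forall>\<^sub>F i in sequentially. cmod (p' j y h - p' i y h) \<le> e * norm h"
            unfolding eventually_sequentially using J[rule_format, OF j] by blast
        qed (rule sequentially_bot)
        then show ?thesis unfolding eventually_sequentially by blast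
      qed
    qed (rule convex_ball)
    then obtain g where
      g_all: "\<forall>y\<in>ball 0 r. (\<lambda>j. p j y) \<longlonglongrightarrow> g y \<and> (g has_derivative f' y) (at y within ball 0 r)" ..
    have g: "(\<lambda>j. p j y) \<longlonglongrightarrow> g y" "(g has_derivative f' y) (at y within ball 0 r)" if "y \<in> ball 0 r" for y
      using g_all that by blast+
    have xr: "x \<in> ball 0 r" using r by simp
    have "(g has_derivative f' x) (at x)" using g(2)[OF xr] unfolding at_within_open[OF xr open_ball] .
    then show ?thesis
    proof (rule has_derivative_transform_within_open[OF _ open_ball xr])
      show "g y = f y" if "y \<in> ball 0 r" for y using LIMSEQ_unique[OF g(1)[OF that] f[OF r1[OF that]]] .
    qed
  qed
  have linear: "f' x (scaleC_c0 c h) = c * f' x h" if x: "norm x < 1" for x c h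
  proof (rule LIMSEQ_unique[OF f'[OF x]])
    show "(\<lambda>j. p' j x (scaleC_c0 c h)) \<longlonglongrightarrow> c * f' x h"
      unfolding p'(2) by (intro tendsto_intros f' x)
  qed
  have "uniformly_continuous_on (ball 0 1) f"
  proof (rule uniformly_continuous_uniform_approx)
    fix e :: real assume e: "e > 0"
    obtain J where J: "\<forall>i\<ge>J. \<forall>j\<ge>J. \<forall>x. norm x < 1 \<longrightarrow> cmod (p i x - p j x) \<le> e"
      using lim[OF e] unfolding p_def ..
    have "dist (p J x) (f x) \<le> e" if x: "x \<in> ball 0 1" for x
      unfolding dist_norm
    proof (rule tendsto_upperbound)
      have x1: "norm x < 1" using x by simp
      show "(\<lambda>i. cmod (p J x - p i x)) \<longlonglongrightarrow> cmod (p J x - f x)"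
        by (rule tendsto_norm[OF tendsto_diff[OF tendsto_const f[OF x1]]])
      show "\<forall>\<^sub>F i in sequentially. cmod (p J x - p i x) \<le> e"
        unfolding eventually_sequentially using J[rule_format, OF order_refl _ x1] by blast
    qed (rule sequentially_bot)
    moreover have "uniformly_continuous_on (ball 0 1) (p J)"
    proof -
      obtain g' B L where L: "lipschitz_frechet (p J) g' B L"
        using lipschitz_frechet_bohr_poly[OF P] unfolding p_def by blast
      show ?thesis
        by (intro lipschitz_on_uniformly_continuous[of L] lipschitz_onI)
           (simp_all add: dist_norm lipschitz_frechetD(2,6)[OF L])
    qed
    ultimately show "\<exists>g. uniformly_continuous_on (ball 0 1) g \<and> (\<forall>x\<in>ball 0 1. dist (g x) (f x) \<le> e)" by blast
  qed
  moreover have "complex_frechet_differentiable f x" if "x \<in> ball 0 1" for x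
  proof -
    have x: "norm x < 1" using that by simp
    show ?thesis unfolding complex_frechet_differentiable_def
      by (intro exI[of _ "f' x"] conjI allI deriv[OF x] linear[OF x])
  qed
  moreover have "f x = 0" if "x \<notin> ball 0 1" for x using that by (simp add: f_def)
  ultimately have "f \<in> ball_algebra" unfolding ball_algebra_def by blast
  moreover have "\<forall>x. norm x < 1 \<longrightarrow> (\<lambda>j. P j (c0_nth x)) \<longlonglongrightarrow> f x"
    using f by (simp add: p_def)
  ultimately show ?thesis by blast
qed

section \<open>The Bohr transform\<close>

lemma right_half_plane_nonempty: "right_half_plane \<noteq> {}"
proof -
  have "1 \<in> right_half_plane" by (simp add: right_half_plane_def)
  then show ?thesis by blast
qed

text \<open>
  Only meaningful for \<open>Re s > 0\<close>, where \<open>bohr_point s\<close> is a null sequence.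
\<close>

definition bohr_point_c0 :: "complex \<Rightarrow> c0" where
  "bohr_point_c0 s = Abs_c0 (bohr_point s)"

lemma c0_nth_bohr_point_c0:
  assumes s: "Re s > 0" shows "c0_nth (bohr_point_c0 s) = bohr_point s"
proof -
  have "bohr_point s \<longlonglongrightarrow> 0"
  proof (rule Lim_null_comparison)
    show "(\<lambda>k. real k powr (- Re s)) \<longlonglongrightarrow> 0"
      using s by (intro tendsto_neg_powr filterlim_real_sequentially) simp
    have "cmod (bohr_point s k) \<le> real k powr (- Re s)" if k: "k \<ge> 1" for k
      unfolding norm_bohr_point using s k le_nth_prime[of k] by (intro powr_mono2') auto
    then show "\<forall>\<^sub>F k in sequentially. cmod (bohr_point s k) \<le> real k powr (- Re s)"
      unfolding eventually_sequentially by blast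
  qed
  then show ?thesis unfolding bohr_point_c0_def by (intro Abs_c0_inverse) simp
qed

lemma norm_bohr_point_c0_less_1:
  assumes s: "Re s > 0" shows "norm (bohr_point_c0 s) < 1"
proof -
  have "norm (bohr_point_c0 s) \<le> 2 powr (- Re s)"
    by (rule norm_c0_least) (simp add: c0_nth_bohr_point_c0[OF s] norm_bohr_point_le[OF s])
  also have "\<dots> < 1" using s by (intro powr_less_one) auto
  finally show ?thesis .
qed

text \<open>
  The value \<open>0\<close> outside the half-plane follows the representation of function spaces by total functions.
\<close>

definition bohr_transform :: "(c0 \<Rightarrow> complex) \<Rightarrow> complex \<Rightarrow> complex" where
  "bohr_transform f s = (if Re s > 0 then f (bohr_point_c0 s) else 0)"

lemma ball_algebra_approx_sequence:
  assumes f: "f \<in> ball_algebra"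
  shows "\<exists>P. \<forall>j. P j \<in> bohr_polys \<and> (\<forall>x. norm x < 1 \<longrightarrow> cmod (f x - P j (c0_nth x)) \<le> 1 / real (Suc j))"
proof (rule choice, rule allI)
  fix j
  have "1 / real (Suc j) > 0" by simp
  from ball_algebra_approx[OF f this]
  show "\<exists>P. P \<in> bohr_polys \<and> (\<forall>x. norm x < 1 \<longrightarrow> cmod (f x - P (c0_nth x)) \<le> 1 / real (Suc j))" by blast
qed

lemma eventually_inverse_Suc_le:
  assumes "e > 0" shows "\<forall>\<^sub>F j in sequentially. 1 / real (Suc j) \<le> e"
proof -
  have "(\<lambda>j. 1 / real (Suc j)) \<longlonglongrightarrow> 0" by (rule LIMSEQ_Suc[OF lim_1_over_n])
  then have "\<forall>\<^sub>F j in sequentially. 1 / real (Suc j) < e" using assms by (rule order_tendstoD)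
  then show ?thesis by eventually_elim simp
qed

lemma bohr_transform_in_dirichlet_algebra:
  assumes f: "f \<in> ball_algebra"
  shows "bohr_transform f \<in> dirichlet_algebra"
proof -
  obtain P where P_all: "\<forall>j. P j \<in> bohr_polys \<and> (\<forall>x. norm x < 1 \<longrightarrow> cmod (f x - P j (c0_nth x)) \<le> 1 / real (Suc j))"
    using ball_algebra_approx_sequence[OF f] ..
  have P: "P j \<in> bohr_polys" "norm x < 1 \<Longrightarrow> cmod (f x - P j (c0_nth x)) \<le> 1 / real (Suc j)" for j x
    using P_all by blast+
  have close: "cmod (P j (bohr_point s) - bohr_transform f s) \<le> 1 / real (Suc j)" if "s \<in> right_half_plane" for j s
  proof -
    have s: "Re s > 0" using that by (simp add: right_half_plane_def)
    show ?thesis using P(2)[OF norm_bohr_point_c0_less_1[OF s], of j] s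
      by (simp add: bohr_transform_def c0_nth_bohr_point_c0 norm_minus_commute)
  qed
  have lim: "\<forall>\<^sub>F j in sequentially. \<forall>s\<in>right_half_plane. cmod (P j (bohr_point s) - bohr_transform f s) \<le> e" if "e > 0" for e
    using eventually_inverse_Suc_le[OF that]
  proof eventually_elim
    case (elim j)
    then show ?case using order_trans[OF close] by blast
  qed
  have "bohr_transform f s = 0" if "s \<notin> right_half_plane" for s
    using that by (simp add: bohr_transform_def right_half_plane_def)
  then show ?thesis
    unfolding dirichlet_algebra_def using dirichlet_series_uniform_limit[OF P(1) lim] by blast
qed

lemma bohr_transform_isometry:
  assumes f: "f \<in> ball_algebra"
  shows "sup_norm right_half_plane (bohr_transform f) = sup_norm (ball 0 1) f"
proof (rule antisym)
  have bdd: "bdd_above ((\<lambda>x. cmod (f x)) ` ball 0 1)" by (rule bdd_above_ball_algebra[OF f])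
  have bddD: "bdd_above ((\<lambda>s. cmod (bohr_transform f s)) ` right_half_plane)"
    by (rule bdd_above_dirichlet_algebra[OF bohr_transform_in_dirichlet_algebra[OF f]])
  show "sup_norm right_half_plane (bohr_transform f) \<le> sup_norm (ball 0 1) f"
    unfolding sup_norm_def
  proof (rule cSUP_least)
    show "right_half_plane \<noteq> {}" using right_half_plane_nonempty .
    fix s assume "s \<in> right_half_plane"
    then have s: "Re s > 0" by (simp add: right_half_plane_def)
    have "cmod (f (bohr_point_c0 s)) \<le> (SUP x\<in>ball 0 1. cmod (f x))"
      by (rule cSUP_upper[OF _ bdd]) (simp add: norm_bohr_point_c0_less_1[OF s])
    then show "cmod (bohr_transform f s) \<le> (SUP x\<in>ball 0 1. cmod (f x))" using s by (simp add: bohr_transform_def)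
  qed
  obtain P where P_all: "\<forall>j. P j \<in> bohr_polys \<and> (\<forall>x. norm x < 1 \<longrightarrow> cmod (f x - P j (c0_nth x)) \<le> 1 / real (Suc j))"
    using ball_algebra_approx_sequence[OF f] ..
  have P: "P j \<in> bohr_polys" "norm x < 1 \<Longrightarrow> cmod (f x - P j (c0_nth x)) \<le> 1 / real (Suc j)" for j x
    using P_all by blast+
  define S where "S = sup_norm right_half_plane (bohr_transform f)"
  show "sup_norm (ball 0 1) f \<le> sup_norm right_half_plane (bohr_transform f)"
    unfolding sup_norm_def[of "ball 0 1"] S_def[symmetric]
  proof (rule cSUP_least)
    fix x :: c0 assume "x \<in> ball 0 1"
    then have x: "norm x < 1" by simp
    have le: "cmod (f x) \<le> S + 2 * (1 / real (Suc j))" for j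
    proof -
      have "cmod (P j (c0_nth x)) \<le> S + 1 / real (Suc j)"
      proof (rule bohr_poly_le_of_half_plane[OF P(1) _ x norm_c0_nth_le])
        fix s :: complex assume s: "Re s > 0"
        have "cmod (bohr_transform f s) \<le> S" unfolding S_def sup_norm_def
          by (rule cSUP_upper[OF _ bddD]) (simp add: right_half_plane_def s)
        moreover have "cmod (f (bohr_point_c0 s) - P j (bohr_point s)) \<le> 1 / real (Suc j)"
          using P(2)[OF norm_bohr_point_c0_less_1[OF s], of j] by (simp add: c0_nth_bohr_point_c0[OF s])
        ultimately show "cmod (P j (bohr_point s)) \<le> S + 1 / real (Suc j)"
          using norm_triangle_ineq4[of "f (bohr_point_c0 s)" "f (bohr_point_c0 s) - P j (bohr_point s)"] s
          by (simp add: bohr_transform_def)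
      qed
      then show ?thesis using P(2)[OF x, of j] norm_triangle_sub[of "f x" "P j (c0_nth x)"] by simp
    qed
    have "(\<lambda>j. S + 2 * (1 / real (Suc j))) \<longlonglongrightarrow> S + 2 * 0"
      by (intro tendsto_add tendsto_mult tendsto_const LIMSEQ_Suc[OF lim_1_over_n])
    then have "cmod (f x) \<le> S + 2 * 0"
      by (rule tendsto_lowerbound) (simp_all only: le eventually_True trivial_limit_sequentially not_False_eq_True)
    then show "cmod (f x) \<le> S" by simp
  qed simp
qed

text \<open>
  Dirichlet polynomials converging to \<open>D\<close> are Cauchy in the supremum norm; by the norm comparison so are the
  corresponding polynomials on the ball, and their limit is the preimage.
\<close>

lemma bohr_transform_surj:
  assumes D: "D \<in> dirichlet_algebra"
  shows "\<exists>f\<in>ball_algebra. bohr_transform f = D"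
proof -
  have "\<forall>j. \<exists>P. P \<in> bohr_polys \<and> (\<forall>s\<in>right_half_plane. cmod (P (bohr_point s) - D s) \<le> 1 / real (Suc j))"
  proof
    fix j
    have "1 / real (Suc j) > 0" by simp
    from dirichlet_algebra_approx[OF D this] obtain P
      where P: "P \<in> bohr_polys" "\<forall>s\<in>right_half_plane. cmod (P (bohr_point s) - D s) \<le> 1 / real (Suc j)" ..
    then show "\<exists>P. P \<in> bohr_polys \<and> (\<forall>s\<in>right_half_plane. cmod (P (bohr_point s) - D s) \<le> 1 / real (Suc j))" by blast
  qed
  from choice[OF this] obtain P where
    P_all: "\<forall>j. P j \<in> bohr_polys \<and> (\<forall>s\<in>right_half_plane. cmod (P j (bohr_point s) - D s) \<le> 1 / real (Suc j))" ..
  have P: "P j \<in> bohr_polys" "s \<in> right_half_plane \<Longrightarrow> cmod (P j (bohr_point s) - D s) \<le> 1 / real (Suc j)" for j s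
    using P_all by blast+
  have "\<exists>f\<in>ball_algebra. \<forall>x. norm x < 1 \<longrightarrow> (\<lambda>j. P j (c0_nth x)) \<longlonglongrightarrow> f x"
  proof (rule ball_algebra_uniform_limit[OF P(1)])
    fix e :: real assume "e > 0"
    then have "e / 2 > 0" by simp
    from eventually_inverse_Suc_le[OF this] obtain J where J: "\<And>j. j \<ge> J \<Longrightarrow> 1 / real (Suc j) \<le> e / 2"
      unfolding eventually_sequentially by blast
    have "cmod (P i (c0_nth x) - P j (c0_nth x)) \<le> e" if ij: "i \<ge> J" "j \<ge> J" and x: "norm x < 1" for i j x
    proof (rule bohr_poly_le_of_half_plane[OF bohr_polys_diff[OF P(1) P(1)] _ x norm_c0_nth_le])
      fix s :: complex assume "Re s > 0"
      then have s: "s \<in> right_half_plane" by (simp add: right_half_plane_def)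
      show "cmod (P i (bohr_point s) - P j (bohr_point s)) \<le> e"
        using norm_triangle_ineq4[of "P i (bohr_point s) - D s" "P j (bohr_point s) - D s"]
          order_trans[OF P(2)[OF s] J[OF ij(1)]] order_trans[OF P(2)[OF s] J[OF ij(2)]] by simp
    qed
    then show "\<exists>J. \<forall>i\<ge>J. \<forall>j\<ge>J. \<forall>x. norm x < 1 \<longrightarrow> cmod (P i (c0_nth x) - P j (c0_nth x)) \<le> e" by blast
  qed
  then obtain f where f: "f \<in> ball_algebra" and f_lim: "\<forall>x. norm x < 1 \<longrightarrow> (\<lambda>j. P j (c0_nth x)) \<longlonglongrightarrow> f x" ..
  have "bohr_transform f s = D s" for s
  proof (cases "Re s > 0")
    case True
    then have s: "s \<in> right_half_plane" by (simp add: right_half_plane_def)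
    have 1: "(\<lambda>j. P j (bohr_point s)) \<longlonglongrightarrow> f (bohr_point_c0 s)"
      using f_lim[rule_format, OF norm_bohr_point_c0_less_1[OF True]] by (simp add: c0_nth_bohr_point_c0[OF True])
    have "(\<lambda>j. P j (bohr_point s) - D s) \<longlonglongrightarrow> 0"
    proof (rule Lim_null_comparison)
      show "(\<lambda>j. 1 / real (Suc j)) \<longlonglongrightarrow> 0" by (rule LIMSEQ_Suc[OF lim_1_over_n])
      show "\<forall>\<^sub>F j in sequentially. cmod (P j (bohr_point s) - D s) \<le> 1 / real (Suc j)"
        by (rule always_eventually) (rule allI, rule P(2)[OF s])
    qed
    then have 2: "(\<lambda>j. P j (bohr_point s)) \<longlonglongrightarrow> D s" by (rule LIM_zero_cancel)
    show ?thesis using LIMSEQ_unique[OF 1 2] True by (simp add: bohr_transform_def)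
  next
    case False
    then show ?thesis using D by (auto simp: bohr_transform_def dirichlet_algebra_def right_half_plane_def)
  qed
  then have "bohr_transform f = D" by (rule ext)
  then show ?thesis by (rule bexI[OF _ f])
qed

lemma bohr_transform_add: "bohr_transform (\<lambda>x. f x + g x) = (\<lambda>s. bohr_transform f s + bohr_transform g s)"
  by (auto simp: bohr_transform_def)

lemma bohr_transform_cmult: "bohr_transform (\<lambda>x. c * f x) = (\<lambda>s. c * bohr_transform f s)"
  by (auto simp: bohr_transform_def)

lemma bohr_transform_inj: "inj_on bohr_transform ball_algebra"
proof (rule inj_onI)
  fix f g assume f: "f \<in> ball_algebra" and g: "g \<in> ball_algebra" and eq: "bohr_transform f = bohr_transform g"
  define d where "d = (\<lambda>x. f x + (- 1) * g x)"
  have d: "d \<in> ball_algebra" unfolding d_def by (intro ball_algebra_add ball_algebra_mult_const f g)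
  have "bohr_transform d = (\<lambda>_. 0)"
    unfolding d_def bohr_transform_add bohr_transform_cmult eq by simp
  then have "sup_norm (ball 0 1) d = sup_norm right_half_plane (\<lambda>_. 0)"
    using bohr_transform_isometry[OF d] by simp
  also have "\<dots> = 0"
  proof -
    have "right_half_plane \<noteq> {}" using right_half_plane_nonempty .
    then show ?thesis by (simp add: sup_norm_def)
  qed
  finally have 0: "sup_norm (ball 0 1) d = 0" .
  show "f = g"
  proof
    fix x
    show "f x = g x"
    proof (cases "x \<in> ball 0 1")
      case True
      then have "cmod (d x) \<le> sup_norm (ball 0 1) d"
        unfolding sup_norm_def by (rule cSUP_upper[OF _ bdd_above_ball_algebra[OF d]])
      then show ?thesis using 0 by (simp add: d_def)
    next
      case False
      then show ?thesis using f g by (simp add: ball_algebra_def)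
    qed
  qed
qed

text \<open>
  The isomorphism is the inverse of the Bohr transform.
\<close>

theorem theorem2p4:
  shows "isometrically_isomorphic right_half_plane dirichlet_algebra (ball 0 1) ball_algebra"
proof -
  have bij: "bij_betw bohr_transform ball_algebra dirichlet_algebra"
    unfolding bij_betw_def
    using bohr_transform_inj bohr_transform_in_dirichlet_algebra bohr_transform_surj by blast
  define \<Phi> where "\<Phi> = inv_into ball_algebra bohr_transform"
  have \<Phi>_in: "\<Phi> D \<in> ball_algebra" and right: "bohr_transform (\<Phi> D) = D" if "D \<in> dirichlet_algebra" for D
    using that bij_betw_imp_surj_on[OF bij] unfolding \<Phi>_def
    by (simp_all add: inv_into_into f_inv_into_f)
  have left: "\<Phi> (bohr_transform f) = f" if "f \<in> ball_algebra" for f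
    unfolding \<Phi>_def using that bohr_transform_inj by (simp add: inv_into_f_f)
  show ?thesis
    unfolding isometrically_isomorphic_def
  proof (intro exI[of _ \<Phi>] conjI ballI allI)
    show "bij_betw \<Phi> dirichlet_algebra ball_algebra"
      unfolding \<Phi>_def by (rule bij_betw_inv_into[OF bij])
  next
    fix D E assume D: "D \<in> dirichlet_algebra" and E: "E \<in> dirichlet_algebra"
    have "bohr_transform (\<lambda>x. \<Phi> D x + \<Phi> E x) = (\<lambda>s. D s + E s)"
      by (simp add: bohr_transform_add right D E)
    then show "\<Phi> (\<lambda>s. D s + E s) = (\<lambda>x. \<Phi> D x + \<Phi> E x)"
      using left[OF ball_algebra_add[OF \<Phi>_in[OF D] \<Phi>_in[OF E]]] by simp
  next
    fix c D assume D: "D \<in> dirichlet_algebra"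
    have "bohr_transform (\<lambda>x. c * \<Phi> D x) = (\<lambda>s. c * D s)"
      by (simp add: bohr_transform_cmult right D)
    then show "\<Phi> (\<lambda>s. c * D s) = (\<lambda>x. c * \<Phi> D x)"
      using left[OF ball_algebra_mult_const[OF \<Phi>_in[OF D]], of c] by simp
  next
    fix D assume D: "D \<in> dirichlet_algebra"
    show "sup_norm (ball 0 1) (\<Phi> D) = sup_norm right_half_plane D"
      using bohr_transform_isometry[OF \<Phi>_in[OF D]] by (simp add: right D)
  qed
qed

end
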